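(* Let $n\ge 3$ and let $q$ be a prime power. If $C$ is an EKR-set of maximal flags in $\mathrm{PG}(n,q)$, then $$|C| \le \frac{\left[{n+1\atop 1}\right]_q\left[{n\atop 1}\right]_q\cdots\left[{2\atop 1}\right]_q\left[{1\atop 1}\right]_q}{1+q^{(n+1)/2}}.$$
   Context: $\left[{k\atop 1}\right]_q=(q^k-1)/(q-1)$. Let $V=\mathbb{F}_q^{n+1}$ with standard basis $e_1,\dots,e_{n+1}$; $\mathrm{PG}(n,q)$ is the geometry of subspaces of $V$. A maximal flag is a chain $U_1\subset U_2\subset\dots\subset U_n$ of subspaces of $V$ with $\dim U_i=i$ (vector space dimension). Let $G=\mathrm{PGL}(n+1,q)$, let $F=\{\langle e_1\rangle,\langle e_1,e_2\rangle,\dots,\langle e_1,\dots,e_n\rangle\}$ be the standard flag and $B$ its stabilizer in $G$, so that maximal flags $gF$ correspond to cosets $gB$. The Weyl group $W=\mathrm{Sym}(n+1)$ acts by $we_i=e_{w(i)}$, and its longest element (with respect to the generators $s_i=(i,i+1)$) is $w_0=(1,n+1)(2,n)(3,n-1)\cdots$. Two maximal flags $gF$ and $hF$ are opposite if $Bh^{-1}gB=Bw_0B$. A set $C$ of maximal flags is an EKR-set if no two flags of $C$ are opposite. *)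

theory Defs
  imports
    "Jordan_Normal_Form.VS_Connect"
    "HOL-Algebra.Group_Action"
    "HOL-Number_Theory.Prime_Powers"
    "HOL-Library.Cardinality"
begin

text \<open>
  The field \<open>F\<^sub>q\<close> is a type \<open>'a\<close> of sort \<open>{field, finite}\<close> with \<open>CARD('a) = q\<close>. The parameter
  \<open>n\<close> is the projective dimension, so that \<open>V = F\<^sub>q\<^bsup>n+1\<^esup>\<close>.
\<close>

abbreviation pg_space :: "'a itself \<Rightarrow> nat \<Rightarrow> ('a::field, 'a vec) module" where
  "pg_space ty n \<equiv> module_vec ty (n + 1)"

definition pg_subspace :: "nat \<Rightarrow> 'a::field vec set \<Rightarrow> bool" where
  "pg_subspace n U \<longleftrightarrow> VectorSpace.subspace class_ring U (pg_space TYPE('a) n)"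

definition pg_dim :: "nat \<Rightarrow> 'a::field vec set \<Rightarrow> nat" where
  "pg_dim n U = vectorspace.dim class_ring ((pg_space TYPE('a) n)\<lparr>carrier := U\<rparr>)"

definition pg_span :: "nat \<Rightarrow> 'a::field vec set \<Rightarrow> 'a vec set" where
  "pg_span n S = LinearCombinations.module.span class_ring (pg_space TYPE('a) n) S"

text \<open>The chain \<open>U\<^sub>1 \<subset> \<dots> \<subset> U\<^sub>n\<close> is identified with the set \<open>{U\<^sub>1, \<dots>, U\<^sub>n}\<close>.\<close>

definition maximal_flag :: "nat \<Rightarrow> 'a::field vec set set \<Rightarrow> bool" where
  "maximal_flag n f \<longleftrightarrow>
     (\<exists>U. f = U ` {1..n} \<and>
          (\<forall>i\<in>{1..n}. pg_subspace n (U i) \<and> pg_dim n (U i) = i) \<and>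
          (\<forall>i\<in>{1..<n}. U i \<subset> U (i + 1)))"

text \<open>The basis vectors are indexed by \<open>1, \<dots>, n+1\<close>; \<open>unit_vec\<close> and matrix entries count from 0.\<close>

definition basis_vec :: "nat \<Rightarrow> nat \<Rightarrow> 'a::field vec" where
  "basis_vec n i = unit_vec (n + 1) (i - 1)"

definition std_flag :: "nat \<Rightarrow> 'a::field vec set set" where
  "std_flag n = (\<lambda>i. pg_span n (basis_vec n ` {1..i})) ` {1..n}"

definition GL :: "nat \<Rightarrow> 'a::field mat monoid" where
  "GL n = units_of (ring_mat TYPE('a) (n + 1) ())"

definition scalar_mats :: "nat \<Rightarrow> 'a::field mat set" where
  "scalar_mats n = {c \<cdot>\<^sub>m 1\<^sub>m (n + 1) | c. c \<noteq> 0}"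

definition PGL :: "nat \<Rightarrow> 'a::field mat set monoid" where
  "PGL n = GL n Mod scalar_mats n"

text \<open>An element of \<open>PGL n\<close> is a coset \<open>X\<close> of scalar multiples of one matrix; all \<open>A \<in> X\<close> map a
  subspace \<open>U\<close> to the same subspace, which is therefore the union below.\<close>

definition subspace_act :: "'a::field mat set \<Rightarrow> 'a vec set \<Rightarrow> 'a vec set" where
  "subspace_act X U = (\<Union>A\<in>X. (\<lambda>v. A *\<^sub>v v) ` U)"

definition flag_act :: "'a::field mat set \<Rightarrow> 'a vec set set \<Rightarrow> 'a vec set set" where
  "flag_act X f = subspace_act X ` f"

definition borel_subgroup :: "nat \<Rightarrow> 'a::field mat set set" where
  "borel_subgroup n = stabilizer (PGL n) flag_act (std_flag n)"

text \<open>The element of \<open>PGL n\<close> with \<open>e\<^sub>i \<mapsto> e\<^bsub>w(i)\<^esub>\<close> for a permutation \<open>w\<close> of \<open>{1..n+1}\<close>.\<close>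

definition perm_mat :: "nat \<Rightarrow> (nat \<Rightarrow> nat) \<Rightarrow> 'a::field mat" where
  "perm_mat n w = mat (n + 1) (n + 1) (\<lambda>(r, c). if r + 1 = w (c + 1) then 1 else 0)"

definition weyl_elem :: "nat \<Rightarrow> (nat \<Rightarrow> nat) \<Rightarrow> 'a::field mat set" where
  "weyl_elem n w = scalar_mats n #>\<^bsub>GL n\<^esub> perm_mat n w"

lemma perm_mat_basis_vec:
  assumes "i \<in> {1..n + 1}" "w i \<in> {1..n + 1}"
  shows "perm_mat n w *\<^sub>v basis_vec n i = (basis_vec n (w i) :: 'a::field vec)"
proof -
  have "perm_mat n w *\<^sub>v basis_vec n i = col (perm_mat n w :: 'a mat) (i - 1)"
    using assms by (auto simp: perm_mat_def basis_vec_def intro!: eq_vecI)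
  also have "\<dots> = basis_vec n (w i)"
    using assms by (intro eq_vecI) (auto simp: perm_mat_def basis_vec_def unit_vec_def)
  finally show ?thesis .
qed

text \<open>The permutation \<open>(1,n+1)(2,n)(3,n-1)\<dots>\<close>.\<close>

definition w0 :: "nat \<Rightarrow> nat \<Rightarrow> nat" where
  "w0 n i = (if i \<in> {1..n + 1} then n + 2 - i else i)"

lemma w0_permutes: "w0 n permutes {1..n + 1}"
  by (rule bij_imp_permutes, rule bij_betw_byWitness[where f' = "w0 n"]) (auto simp: w0_def)

definition double_coset :: "nat \<Rightarrow> 'a::field mat set \<Rightarrow> 'a mat set set" where
  "double_coset n x = borel_subgroup n <#>\<^bsub>PGL n\<^esub> (x <#\<^bsub>PGL n\<^esub> borel_subgroup n)"

definition opposite :: "nat \<Rightarrow> 'a::field vec set set \<Rightarrow> 'a vec set set \<Rightarrow> bool" where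
  "opposite n f f' \<longleftrightarrow>
     (\<exists>g\<in>carrier (PGL n). \<exists>h\<in>carrier (PGL n).
        f = flag_act g (std_flag n) \<and> f' = flag_act h (std_flag n) \<and>
        double_coset n (inv\<^bsub>PGL n\<^esub> h \<otimes>\<^bsub>PGL n\<^esub> g) = double_coset n (weyl_elem n (w0 n)))"

definition EKR_set :: "nat \<Rightarrow> 'a::field vec set set set \<Rightarrow> bool" where
  "EKR_set n C \<longleftrightarrow>
     (\<forall>f\<in>C. maximal_flag n f) \<and> pairwise (\<lambda>f f'. \<not> opposite n f f') C"

definition gauss_num :: "nat \<Rightarrow> nat \<Rightarrow> real" where
  "gauss_num q k = (real q ^ k - 1) / (real q - 1)"

end

theory Submission
  imports Defs "Jordan_Normal_Form.Spectral_Radius"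
begin

text \<open>
Number the maximal flags by \<open>0, \<dots>, m - 1\<close> and let \<open>T\<^sub>i\<close> be the 0/1 matrix of \<open>i\<close>-adjacency,
where two flags are \<open>i\<close>-adjacent if they differ exactly in the subspace of dimension \<open>i\<close>. These
matrices satisfy the relations of the Iwahori-Hecke algebra of \<open>Sym(n+1)\<close>: each panel has \<open>q +
1\<close> flags, so \<open>T\<^sub>i T\<^sub>i = (q - 1) T\<^sub>i + q\<close>, and the braid relations hold. The product \<open>A\<close> of the
words \<open>T\<^sub>k \<dots> T\<^sub>2 T\<^sub>1\<close> for \<open>k = 1, \<dots>, n\<close> is a reduced word of the longest element, and it is the
0/1 matrix of opposition, because opposite flags are joined by exactly one gallery of this type
(\<open>long_word_rel_mat\<close>), and other flags by none. An EKR-set is thus a coclique of the opposition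
graph. This graph is regular of degree \<open>\<kappa>\<close>, where \<open>\<kappa>\<close> is \<open>q\<close> to the power \<open>n (n + 1) / 2\<close>, and
if all eigenvalues of \<open>A\<close> on the orthogonal complement of the all-one vector are at most \<open>\<rho>\<close> in
absolute value, then a coclique has at most \<open>m / (1 + \<kappa> / \<rho>)\<close> elements (the ratio bound of
Delsarte and Hoffman, \<open>hecke_coclique_bound\<close>). The theorem is this bound for \<open>\<rho> = q\<close> to the
power \<open>(n\<^sup>2 - 1) / 2\<close>, and \<open>m\<close> is the product of the Gaussian numbers (\<open>card_flags\<close>).

The value of \<open>\<rho>\<close> is usually obtained from the character theory of the Hecke algebra. A
determinant suffices (\<open>central_eigenvalue_bound\<close>). Opposition exchanges the types \<open>i\<close> and \<open>n + 1
- i\<close>, that is \<open>A T\<^sub>i = T\<^sub>j A\<close> with \<open>j = n + 1 - i\<close>, hence \<open>A\<^sup>2\<close> commutes with every \<open>T\<^sub>i\<close>. Let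
\<open>\<mu>\<close> be an eigenvalue of \<open>A\<close> with an eigenvector orthogonal to the all-one vector, and let \<open>E\<close> be
the space of all vectors orthogonal to the all-one vector on which \<open>A\<^sup>2\<close> is multiplication by
\<open>\<mu>\<^sup>2\<close>. Every \<open>T\<^sub>i\<close> acts on \<open>E\<close>. Put \<open>d = dim E\<close>. The eigenvalues of \<open>T\<^sub>i\<close> are \<open>q\<close> and \<open>-1\<close>; by
the braid relations all \<open>T\<^sub>i\<close> have the same determinant on \<open>E\<close>, so their eigenspaces for \<open>-1\<close> in
\<open>E\<close> have a common dimension \<open>b\<close>. A vector with \<open>T\<^sub>i v = q v\<close> for all \<open>i\<close> is constant on panels,
hence constant since any two flags are joined by a gallery, hence zero if it lies in \<open>E\<close>. So the
\<open>n\<close> eigenspaces for \<open>q\<close>, each of codimension \<open>b\<close> in \<open>E\<close>, intersect trivially, and therefore \<open>d \<le>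
n b\<close>. As \<open>A\<close> is a word with \<open>n (n + 1) / 2\<close> letters, comparing determinants gives that \<open>\<bar>\<mu>\<bar>\<^sup>2\<close>
to the power \<open>d\<close> equals \<open>q\<close> to the power \<open>(d - b) n (n + 1)\<close>, which is at most \<open>q\<close> to the power
\<open>d (n - 1) (n + 1)\<close>.

For sequences \<open>U\<close>, \<open>V\<close> of subspaces, opposition here means that \<open>U\<^sub>i\<close> and \<open>V\<^sub>j\<close> with \<open>j = n + 1
- i\<close> meet trivially for all \<open>i\<close>. Two such flags have a common adapted basis, and the matrix with
these basis vectors as columns exhibits the flags as opposite in the sense of double cosets
(\<open>opp_rel_imp_opposite\<close>).
\<close>

section \<open>Subspaces as ranges of injective matrices\<close>

text \<open>
Subspaces are plain sets of coordinate vectors over an arbitrary field, so that the same notion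
serves for complex eigenspaces and for the subspaces in a flag.
\<close>

definition lin_sub :: "nat \<Rightarrow> 'a::field vec set \<Rightarrow> bool" where
  "lin_sub m E \<longleftrightarrow> E \<subseteq> carrier_vec m \<and> 0\<^sub>v m \<in> E \<and> (\<forall>u\<in>E. \<forall>v\<in>E. u + v \<in> E)
     \<and> (\<forall>c. \<forall>v\<in>E. c \<cdot>\<^sub>v v \<in> E)"

definition injective_mat :: "'a::field mat \<Rightarrow> bool" where
  "injective_mat P \<longleftrightarrow> (\<forall>v\<in>carrier_vec (dim_col P). P *\<^sub>v v = 0\<^sub>v (dim_row P) \<longrightarrow> v = 0\<^sub>v (dim_col P))"

text \<open>
Zero rows turn the matrix into a square one, which is singular.
\<close>

lemma wide_mat_kernel:
  fixes A :: "'a::field mat"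
  assumes A: "A \<in> carrier_mat r d" and rd: "r < d"
  shows "\<exists>v\<in>carrier_vec d. v \<noteq> 0\<^sub>v d \<and> A *\<^sub>v v = 0\<^sub>v r"
proof -
  define A' where "A' = mat d d (\<lambda>(i,j). if i < r then A $$ (i,j) else 0)"
  have A': "A' \<in> carrier_mat d d" by (simp add: A'_def)
  have "A'\<^sup>T *\<^sub>v unit_vec d r = 0\<^sub>v d"
    using rd by (intro eq_vecI) (auto simp: A'_def)
  moreover have "unit_vec d r \<noteq> (0\<^sub>v d :: 'a vec)"
    using rd by (metis index_unit_vec(1) index_zero_vec(1) one_neq_zero)
  ultimately have "det A'\<^sup>T = 0"
    using det_0_iff_vec_prod_zero[of "A'\<^sup>T" d] A' by (meson transpose_carrier_mat unit_vec_carrier)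
  hence "det A' = 0" using det_transpose[OF A'] by simp
  then obtain v where v: "v \<in> carrier_vec d" "v \<noteq> 0\<^sub>v d" "A' *\<^sub>v v = 0\<^sub>v d"
    using det_0_iff_vec_prod_zero[OF A'] by blast
  have "A *\<^sub>v v = 0\<^sub>v r"
  proof (intro eq_vecI)
    fix i assume "i < dim_vec (0\<^sub>v r :: 'a vec)"
    hence i: "i < r" by simp
    have "row A' i = row A i" using A i rd by (intro eq_vecI) (auto simp: A'_def)
    hence "(A *\<^sub>v v) $ i = (A' *\<^sub>v v) $ i" using A A' i rd by simp
    thus "(A *\<^sub>v v) $ i = 0\<^sub>v r $ i" using v(3) i rd by simp
  qed (use A in auto)
  thus ?thesis using v by blast
qed

lemma injective_mat_dim_le:
  assumes "P \<in> carrier_mat m d" "injective_mat P"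
  shows "d \<le> m"
proof (rule ccontr)
  assume "\<not> d \<le> m"
  then obtain v where "v \<in> carrier_vec d" "v \<noteq> 0\<^sub>v d" "P *\<^sub>v v = 0\<^sub>v m"
    using wide_mat_kernel[OF assms(1)] by auto
  thus False using assms unfolding injective_mat_def by auto
qed

lemma injective_mat_cancel:
  assumes P: "P \<in> carrier_mat m d" "injective_mat P" and u: "u \<in> carrier_vec d"
    and v: "v \<in> carrier_vec d"
    and eq: "P *\<^sub>v u = P *\<^sub>v v"
  shows "u = v"
proof -
  have "P *\<^sub>v (u - v) = P *\<^sub>v u - P *\<^sub>v v" using P u v by (simp add: mult_minus_distrib_mat_vec)
  also have "\<dots> = 0\<^sub>v m" using eq P v by simp
  finally have "u - v = 0\<^sub>v d" using P u v unfolding injective_mat_def by auto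
  hence "(u - v) + v = v" using v by simp
  thus ?thesis using u v by (simp add: minus_add_uminus_vec assoc_add_vec[of u d "- v" v])
qed

lemma mat_mult_unit_vec:
  "(A :: 'a::field mat) \<in> carrier_mat r d \<Longrightarrow> j < d \<Longrightarrow> A *\<^sub>v unit_vec d j = col A j"
  by (auto intro!: eq_vecI)

lemma mat_eq_by_vec:
  fixes A B :: "'a::field mat"
  assumes A: "A \<in> carrier_mat r d" and B: "B \<in> carrier_mat r d"
    and eq: "\<And>v. v \<in> carrier_vec d \<Longrightarrow> A *\<^sub>v v = B *\<^sub>v v"
  shows "A = B"
proof (rule mat_col_eqI)
  fix j assume "j < dim_col B"
  hence j: "j < d" using B by simp
  have "col A j = A *\<^sub>v unit_vec d j" "col B j = B *\<^sub>v unit_vec d j"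
    using mat_mult_unit_vec[OF A j] mat_mult_unit_vec[OF B j] by simp_all
  thus "col A j = col B j" using eq[of "unit_vec d j"] by simp
qed (use A B in auto)

lemma injective_mat_cancel_mat:
  fixes P :: "'a::field mat"
  assumes P: "P \<in> carrier_mat m d" "injective_mat P" and A: "A \<in> carrier_mat d k"
    and B: "B \<in> carrier_mat d k"
    and eq: "P * A = P * B"
  shows "A = B"
proof (rule mat_eq_by_vec[OF A B])
  fix v :: "'a vec" assume v: "v \<in> carrier_vec k"
  have "P *\<^sub>v (A *\<^sub>v v) = P *\<^sub>v (B *\<^sub>v v)"
    using eq assoc_mult_mat_vec[OF P(1) A v] assoc_mult_mat_vec[OF P(1) B v] by simp
  thus "A *\<^sub>v v = B *\<^sub>v v"
    using injective_mat_cancel[OF P, of "A *\<^sub>v v" "B *\<^sub>v v"] A B v by simp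
qed

text \<open>
The columns of \<open>B\<close> are preimages under \<open>P\<close> of the columns of \<open>A\<close>. With an injective \<open>P\<close> this
turns an operator that preserves the range of \<open>P\<close> into a square matrix, which has a determinant.
\<close>

lemma factor_through_range:
  fixes A P :: "'a::field mat"
  assumes P: "P \<in> carrier_mat m d" and A: "A \<in> carrier_mat m k"
    and rng: "\<And>v. v \<in> carrier_vec k \<Longrightarrow> A *\<^sub>v v \<in> (\<lambda>u. P *\<^sub>v u) ` carrier_vec d"
  obtains B where "B \<in> carrier_mat d k" "A = P * B"
proof -
  have "\<forall>j. \<exists>u. u \<in> carrier_vec d \<and> A *\<^sub>v unit_vec k j = P *\<^sub>v u"
    using rng by (metis (no_types, lifting) imageE unit_vec_carrier)
  then obtain c where c: "\<And>j. c j \<in> carrier_vec d" "\<And>j. A *\<^sub>v unit_vec k j = P *\<^sub>v c j" by metis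
  define B where "B = mat d k (\<lambda>(i,j). c j $ i)"
  have B: "B \<in> carrier_mat d k" by (simp add: B_def)
  have "A = P * B"
  proof (rule mat_col_eqI)
    fix j assume "j < dim_col (P * B)"
    hence j: "j < k" using B by simp
    have "col A j = A *\<^sub>v unit_vec k j" using mat_mult_unit_vec[OF A j] by simp
    moreover have "col B j = c j" using j c(1)[of j] by (auto simp: B_def intro!: eq_vecI)
    ultimately show "col A j = col (P * B) j" using c(2)[of j] col_mult2[OF P B j] by simp
  qed (use A P B in auto)
  thus ?thesis using that B by blast
qed

text \<open>
The columns of \<open>P\<close> form a basis of \<open>E\<close>. Among the injective matrices with range in \<open>E\<close> one with
the largest number of columns has range \<open>E\<close>: a vector of \<open>E\<close> outside the range could be appended
as one more column.
\<close>

lemma lin_sub_range: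
  assumes "lin_sub m E"
  obtains d P where "P \<in> carrier_mat m d" "injective_mat P" "(\<lambda>v. P *\<^sub>v v) ` carrier_vec d = E"
proof -
  define D where "D = {d. \<exists>P\<in>carrier_mat m d. injective_mat P \<and> (\<forall>v\<in>carrier_vec d. P *\<^sub>v v \<in> E)}"
  have "D \<subseteq> {..m}" using injective_mat_dim_le unfolding D_def by auto
  hence fin: "finite D" by (rule finite_subset) simp
  have "mat m 0 (\<lambda>_. 0) *\<^sub>v v = 0\<^sub>v m" if "v \<in> carrier_vec 0" for v :: "'a vec"
    using that by (intro eq_vecI) (auto simp: scalar_prod_def)
  hence "0 \<in> D" using assms unfolding D_def lin_sub_def injective_mat_def
    by (intro CollectI bexI[of _ "mat m 0 (\<lambda>_. 0)"]) auto
  hence "Max D \<in> D" using fin by (intro Max_in) auto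
  then obtain d P where d: "d = Max D" and P: "P \<in> carrier_mat m d" "injective_mat P"
    and PE: "\<And>v. v \<in> carrier_vec d \<Longrightarrow> P *\<^sub>v v \<in> E" unfolding D_def by blast
  have "E \<subseteq> (\<lambda>v. P *\<^sub>v v) ` carrier_vec d"
  proof (rule ccontr)
    assume "\<not> ?thesis"
    then obtain e where e: "e \<in> E" "e \<notin> (\<lambda>v. P *\<^sub>v v) ` carrier_vec d" by blast
    have ec: "e \<in> carrier_vec m" using e assms unfolding lin_sub_def by auto
    define P' where "P' = mat m (Suc d) (\<lambda>(i,j). if j < d then P $$ (i,j) else e $ i)"
    have P': "P' \<in> carrier_mat m (Suc d)" by (simp add: P'_def)
    have P'v: "P' *\<^sub>v v = P *\<^sub>v vec d (\<lambda>i. v $ i) + v $ d \<cdot>\<^sub>v e" if "v \<in> carrier_vec (Suc d)" for v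
    proof (intro eq_vecI)
      fix i assume "i < dim_vec (P *\<^sub>v vec d (\<lambda>i. v $ i) + v $ d \<cdot>\<^sub>v e)"
      hence i: "i < m" using ec by simp
      show "(P' *\<^sub>v v) $ i = (P *\<^sub>v vec d (\<lambda>i. v $ i) + v $ d \<cdot>\<^sub>v e) $ i"
        using i that ec P by (simp add: P'_def scalar_prod_def mult.commute)
    qed (use P' P ec in auto)
    have "P' *\<^sub>v v \<in> E" if "v \<in> carrier_vec (Suc d)" for v
      using P'v[OF that] PE[of "vec d (\<lambda>i. v $ i)"] e(1) assms unfolding lin_sub_def by auto
    moreover have "injective_mat P'"
      unfolding injective_mat_def
    proof (intro ballI impI)
      fix v assume "v \<in> carrier_vec (dim_col P')" and "P' *\<^sub>v v = 0\<^sub>v (dim_row P')"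
      hence v: "v \<in> carrier_vec (Suc d)" and z: "P *\<^sub>v vec d (\<lambda>i. v $ i) + v $ d \<cdot>\<^sub>v e = 0\<^sub>v m"
        using P' P'v by auto
      define w where "w = vec d (\<lambda>i. v $ i)"
      have w: "w \<in> carrier_vec d" by (simp add: w_def)
      have vd: "v $ d = 0"
      proof (rule ccontr)
        assume nz: "v $ d \<noteq> 0"
        have "e = P *\<^sub>v ((- inverse (v $ d)) \<cdot>\<^sub>v w)"
        proof (intro eq_vecI)
          fix i assume "i < dim_vec (P *\<^sub>v ((- inverse (v $ d)) \<cdot>\<^sub>v w))"
          hence i: "i < m" using P by simp
          have "(P *\<^sub>v w) $ i + v $ d * e $ i = 0"
          proof -
            have "(P *\<^sub>v w + v $ d \<cdot>\<^sub>v e) $ i = 0" using z i by (simp add: w_def)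
            thus ?thesis using i P ec by simp
          qed
          hence "v $ d * e $ i = - (P *\<^sub>v w) $ i" by (simp add: eq_neg_iff_add_eq_0 add.commute)
          hence "e $ i = - inverse (v $ d) * (P *\<^sub>v w) $ i" using nz
            by (simp add: field_simps)
          thus "e $ i = (P *\<^sub>v ((- inverse (v $ d)) \<cdot>\<^sub>v w)) $ i"
            using P w i mult_mat_vec[OF P(1) w, of "- inverse (v $ d)"]
              by (metis carrier_matD(1) dim_mult_mat_vec index_smult_vec(1))
        qed (use P ec in simp)
        moreover have "(- inverse (v $ d)) \<cdot>\<^sub>v w \<in> carrier_vec d" using w by simp
        ultimately show False using e(2) by (metis (no_types, lifting) image_eqI)
      qed
      have "P *\<^sub>v w = 0\<^sub>v m"
      proof (intro eq_vecI)
        fix i assume "i < dim_vec (0\<^sub>v m :: 'a vec)"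
        hence i: "i < m" by simp
        have "(P *\<^sub>v w + v $ d \<cdot>\<^sub>v e) $ i = 0" using z i by (simp add: w_def)
        thus "(P *\<^sub>v w) $ i = 0\<^sub>v m $ i" using i P ec vd by simp
      qed (use P in auto)
      hence "w = 0\<^sub>v d" using P w unfolding injective_mat_def by auto
      hence "v $ i = 0" if "i < d" for i using that unfolding w_def
        by (metis index_vec index_zero_vec(1))
      hence "v = 0\<^sub>v (Suc d)" using v vd by (intro eq_vecI) (auto simp: less_Suc_eq)
      thus "v = 0\<^sub>v (dim_col P')" using P' by simp
    qed
    ultimately have "Suc d \<in> D" unfolding D_def using P' by blast
    hence "Suc d \<le> d" unfolding d using fin Max_ge by blast
    thus False by simp
  qed
  hence "(\<lambda>v. P *\<^sub>v v) ` carrier_vec d = E" using PE by auto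
  thus ?thesis using that P by blast
qed

text \<open>
Subspaces of codimension at most \<open>b\<^sub>1, \<dots>, b\<^sub>n\<close> with trivial intersection: stacking the matrices
that cut them out gives an injective matrix with \<open>b\<^sub>1 + \<dots> + b\<^sub>n\<close> rows.
\<close>

lemma common_kernel_dim:
  fixes R :: "nat \<Rightarrow> 'a::field mat"
  assumes R: "\<And>i. i \<in> {1..n} \<Longrightarrow> R i \<in> carrier_mat (b i) d"
    and ker: "\<And>v. v \<in> carrier_vec d \<Longrightarrow> (\<And>i. i \<in> {1..n} \<Longrightarrow> R i *\<^sub>v v = 0\<^sub>v (b i)) \<Longrightarrow> v = 0\<^sub>v d"
  shows "d \<le> (\<Sum>i = 1..n. b i)"
proof -
  have "\<exists>S\<in>carrier_mat (\<Sum>i = 1..k. b i) d. \<forall>v\<in>carrier_vec d. 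
      S *\<^sub>v v = 0\<^sub>v (\<Sum>i = 1..k. b i) \<longrightarrow> (\<forall>i\<in>{1..k}. R i *\<^sub>v v = 0\<^sub>v (b i))" if "k \<le> n" for k
    using that
  proof (induction k)
    case 0 show ?case by (auto intro!: exI[of _ "0\<^sub>m 0 d"])
  next
    case (Suc k)
    define s where "s = (\<Sum>i = 1..k. b i)"
    from Suc obtain S where S: "S \<in> carrier_mat s d" and
      Sv: "\<And>v. v \<in> carrier_vec d \<Longrightarrow> S *\<^sub>v v = 0\<^sub>v s \<Longrightarrow> \<forall>i\<in>{1..k}. R i *\<^sub>v v = 0\<^sub>v (b i)"
      unfolding s_def by auto
    have Rk: "R (Suc k) \<in> carrier_mat (b (Suc k)) d" using R Suc.prems by simp
    have sum: "(\<Sum>i = 1..Suc k. b i) = s + b (Suc k)" by (simp add: s_def)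
    show ?case unfolding sum
    proof (intro bexI[of _ "S @\<^sub>r R (Suc k)"] ballI impI)
      fix v :: "'a vec" and i assume v: "v \<in> carrier_vec d" 
        and z: "(S @\<^sub>r R (Suc k)) *\<^sub>v v = 0\<^sub>v (s + b (Suc k))" and i: "i \<in> {1..Suc k}"
      have "S *\<^sub>v v @\<^sub>v R (Suc k) *\<^sub>v v = 0\<^sub>v s @\<^sub>v 0\<^sub>v (b (Suc k))"
        using z mat_mult_append[OF S Rk v] by (auto intro!: eq_vecI)
      hence "S *\<^sub>v v = 0\<^sub>v s" "R (Suc k) *\<^sub>v v = 0\<^sub>v (b (Suc k))"
        using S Rk v append_vec_eq[of "S *\<^sub>v v" s "0\<^sub>v s"] by auto
      thus "R i *\<^sub>v v = 0\<^sub>v (b i)" using Sv[OF v] i by (cases "i = Suc k") auto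
    qed (use S Rk in auto)
  qed
  from this[of n] obtain S where S: "S \<in> carrier_mat (\<Sum>i = 1..n. b i) d" and
    "\<And>v. v \<in> carrier_vec d \<Longrightarrow> S *\<^sub>v v = 0\<^sub>v (\<Sum>i = 1..n. b i) \<Longrightarrow> \<forall>i\<in>{1..n}. R i *\<^sub>v v = 0\<^sub>v (b i)" by blast
  hence "injective_mat S" unfolding injective_mat_def using ker by auto
  thus ?thesis using injective_mat_dim_le[OF S] by simp
qed

section \<open>Matrices with two eigenvalues\<close>

lemma injective_matI:
  assumes "P \<in> carrier_mat m d" "\<And>v. v \<in> carrier_vec d \<Longrightarrow> P *\<^sub>v v = 0\<^sub>v m \<Longrightarrow> v = 0\<^sub>v d"
  shows "injective_mat P"
  using assms unfolding injective_mat_def by auto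

lemma mult_mat_zero_vec:
  "A \<in> carrier_mat r d \<Longrightarrow> A *\<^sub>v 0\<^sub>v d = 0\<^sub>v r"
  by (intro eq_vecI) auto

lemma lin_sub_eigenspace:
  assumes M: "M \<in> carrier_mat d d"
  shows "lin_sub d {v \<in> carrier_vec d. M *\<^sub>v v = c \<cdot>\<^sub>v v}"
  unfolding lin_sub_def
proof (intro conjI ballI allI)
  show "0\<^sub>v d \<in> {v \<in> carrier_vec d. M *\<^sub>v v = c \<cdot>\<^sub>v v}" using M by (auto intro!: eq_vecI)
next
  fix u v assume "u \<in> {v \<in> carrier_vec d. M *\<^sub>v v = c \<cdot>\<^sub>v v}" "v \<in> {v \<in> carrier_vec d. M *\<^sub>v v = c \<cdot>\<^sub>v v}"
  thus "u + v \<in> {v \<in> carrier_vec d. M *\<^sub>v v = c \<cdot>\<^sub>v v}"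
    using M by (simp add: mult_add_distrib_mat_vec[of M d d] smult_add_distrib_vec[of _ d])
next
  fix a v assume "v \<in> {v \<in> carrier_vec d. M *\<^sub>v v = c \<cdot>\<^sub>v v}"
  thus "a \<cdot>\<^sub>v v \<in> {v \<in> carrier_vec d. M *\<^sub>v v = c \<cdot>\<^sub>v v}"
    using M mult_mat_vec[of M d d v a] by (simp add: smult_smult_assoc mult.commute)
qed auto

text \<open>
Such a matrix is diagonalisable with eigenvalues \<open>q\<close> and \<open>-1\<close>, since \<open>(q + 1) v = (M v + v) + (q
v - M v)\<close> splits every vector into eigenvectors. Here \<open>b\<close> is the dimension of the eigenspace for
\<open>-1\<close>, and \<open>R\<close> assigns to a vector the coordinates of its component there; so the eigenspace for
\<open>q\<close> is given by \<open>b\<close> equations.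
\<close>

lemma quadratic_mat_det:
  fixes M :: "'a::field mat"
  assumes M: "M \<in> carrier_mat d d" and quad: "M * M = (q - 1) \<cdot>\<^sub>m M + q \<cdot>\<^sub>m 1\<^sub>m d" and q: "q + 1 \<noteq> 0"
  obtains b R where "b \<le> d" "det M = q ^ (d - b) * (-1) ^ b" "R \<in> carrier_mat b d"
    "\<And>v. v \<in> carrier_vec d \<Longrightarrow> R *\<^sub>v v = 0\<^sub>v b \<Longrightarrow> M *\<^sub>v v = q \<cdot>\<^sub>v v"
proof -
  have MM: "M *\<^sub>v (M *\<^sub>v v) = (q - 1) \<cdot>\<^sub>v (M *\<^sub>v v) + q \<cdot>\<^sub>v v" if v: "v \<in> carrier_vec d" for v
  proof -
    have "M *\<^sub>v (M *\<^sub>v v) = (M * M) *\<^sub>v v" using M v by simp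
    also have "\<dots> = ((q - 1) \<cdot>\<^sub>m M) *\<^sub>v v + (q \<cdot>\<^sub>m 1\<^sub>m d) *\<^sub>v v" unfolding quad
      by (rule add_mult_distrib_mat_vec) (use M v in auto)
    also have "((q - 1) \<cdot>\<^sub>m M) *\<^sub>v v = (q - 1) \<cdot>\<^sub>v (M *\<^sub>v v)" using M v by (intro eq_vecI) auto
    also have "(q \<cdot>\<^sub>m 1\<^sub>m d) *\<^sub>v v = q \<cdot>\<^sub>v v" using v by (intro eq_vecI) auto
    finally show ?thesis .
  qed
  obtain a P where P: "P \<in> carrier_mat d a" "injective_mat P"
    and Pr: "(\<lambda>v. P *\<^sub>v v) ` carrier_vec a = {v \<in> carrier_vec d. M *\<^sub>v v = q \<cdot>\<^sub>v v}"
    by (rule lin_sub_range[OF lin_sub_eigenspace[OF M]])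
  obtain b Q where Q: "Q \<in> carrier_mat d b" "injective_mat Q"
    and Qr: "(\<lambda>v. Q *\<^sub>v v) ` carrier_vec b = {v \<in> carrier_vec d. M *\<^sub>v v = (-1) \<cdot>\<^sub>v v}"
    by (rule lin_sub_range[OF lin_sub_eigenspace[OF M]])
  define A where "A = inverse (q + 1) \<cdot>\<^sub>m (M + 1\<^sub>m d)"
  define B where "B = inverse (q + 1) \<cdot>\<^sub>m (q \<cdot>\<^sub>m 1\<^sub>m d - M)"
  have A: "A \<in> carrier_mat d d" and B: "B \<in> carrier_mat d d" using M by (auto simp: A_def B_def)
  have Av: "A *\<^sub>v v = inverse (q + 1) \<cdot>\<^sub>v (M *\<^sub>v v + v)" if v: "v \<in> carrier_vec d" for v
  proof -
    have "A *\<^sub>v v = inverse (q + 1) \<cdot>\<^sub>v ((M + 1\<^sub>m d) *\<^sub>v v)"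
      using M v by (intro eq_vecI) (auto simp: A_def)
    also have "(M + 1\<^sub>m d) *\<^sub>v v = M *\<^sub>v v + v" using M v by (simp add: add_mult_distrib_mat_vec)
    finally show ?thesis .
  qed
  have Bv: "B *\<^sub>v v = inverse (q + 1) \<cdot>\<^sub>v (q \<cdot>\<^sub>v v - M *\<^sub>v v)" if v: "v \<in> carrier_vec d" for v
  proof -
    have "B *\<^sub>v v = inverse (q + 1) \<cdot>\<^sub>v ((q \<cdot>\<^sub>m 1\<^sub>m d - M) *\<^sub>v v)"
      using M v by (intro eq_vecI) (auto simp: B_def)
    also have "(q \<cdot>\<^sub>m 1\<^sub>m d - M) *\<^sub>v v = (q \<cdot>\<^sub>m 1\<^sub>m d) *\<^sub>v v - M *\<^sub>v v" 
      using M v by (intro minus_mult_distrib_mat_vec) auto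
    also have "(q \<cdot>\<^sub>m 1\<^sub>m d) *\<^sub>v v = q \<cdot>\<^sub>v v" using v by (intro eq_vecI) auto
    finally show ?thesis .
  qed
  have "A *\<^sub>v v \<in> (\<lambda>v. P *\<^sub>v v) ` carrier_vec a" if v: "v \<in> carrier_vec d" for v
  proof -
    have "M *\<^sub>v (A *\<^sub>v v) = inverse (q + 1) \<cdot>\<^sub>v (M *\<^sub>v (M *\<^sub>v v) + M *\<^sub>v v)"
      unfolding Av[OF v] using M v by (simp add: mult_mat_vec mult_add_distrib_mat_vec)
    also have "\<dots> = q \<cdot>\<^sub>v (A *\<^sub>v v)"
      unfolding MM[OF v] Av[OF v] using M v by (intro eq_vecI) (auto simp: algebra_simps)
    finally show ?thesis unfolding Pr using A v by auto
  qed
  then obtain A' where A': "A' \<in> carrier_mat a d" "A = P * A'"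
    by (rule factor_through_range[OF P(1) A])
  have "B *\<^sub>v v \<in> (\<lambda>v. Q *\<^sub>v v) ` carrier_vec b" if v: "v \<in> carrier_vec d" for v
  proof -
    have "M *\<^sub>v (B *\<^sub>v v) = inverse (q + 1) \<cdot>\<^sub>v (q \<cdot>\<^sub>v (M *\<^sub>v v) - M *\<^sub>v (M *\<^sub>v v))"
      unfolding Bv[OF v] using M v by (simp add: mult_mat_vec mult_minus_distrib_mat_vec)
    also have "\<dots> = (-1) \<cdot>\<^sub>v (B *\<^sub>v v)"
      unfolding MM[OF v] Bv[OF v] using M v by (intro eq_vecI) (auto simp: algebra_simps)
    finally show ?thesis unfolding Qr using B v by auto
  qed
  then obtain B' where B': "B' \<in> carrier_mat b d" "B = Q * B'"
    by (rule factor_through_range[OF Q(1) B])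
  have dec: "v = P *\<^sub>v (A' *\<^sub>v v) + Q *\<^sub>v (B' *\<^sub>v v)" if v: "v \<in> carrier_vec d" for v
  proof -
    have "A *\<^sub>v v + B *\<^sub>v v = v"
      unfolding Av[OF v] Bv[OF v]
    proof (intro eq_vecI)
      fix i assume "i < dim_vec v"
      hence i: "i < d" using v by simp
      have "inverse (q + 1) * (x + y) + inverse (q + 1) * (q * y - x) = y" for x y
      proof -
        have "inverse (q + 1) * (x + y) + inverse (q + 1) * (q * y - x) = inverse (q + 1) * (q + 1) * y"
          by (simp add: algebra_simps)
        thus ?thesis using q by simp
      qed
      thus "(inverse (q + 1) \<cdot>\<^sub>v (M *\<^sub>v v + v) + inverse (q + 1) \<cdot>\<^sub>v (q \<cdot>\<^sub>v v - M *\<^sub>v v)) $ i = v $ i"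
        using M v i by simp
    qed (use M v in auto)
    thus ?thesis using A' B' P Q v by simp
  qed
  have PM: "M *\<^sub>v (P *\<^sub>v v) = q \<cdot>\<^sub>v (P *\<^sub>v v)" if "v \<in> carrier_vec a" for v
    using Pr that by blast
  have QM: "M *\<^sub>v (Q *\<^sub>v v) = (-1) \<cdot>\<^sub>v (Q *\<^sub>v v)" if "v \<in> carrier_vec b" for v
    using Qr that by blast
  have ge: "d \<le> a + b"
  proof -
    have "v = 0\<^sub>v d" if v: "v \<in> carrier_vec d" and z: "(A' @\<^sub>r B') *\<^sub>v v = 0\<^sub>v (a + b)" for v
    proof -
      have "A' *\<^sub>v v @\<^sub>v B' *\<^sub>v v = 0\<^sub>v a @\<^sub>v 0\<^sub>v b"
        using z mat_mult_append[OF A'(1) B'(1) v] by (auto intro!: eq_vecI)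
      hence "A' *\<^sub>v v = 0\<^sub>v a" "B' *\<^sub>v v = 0\<^sub>v b"
        using A' B' v append_vec_eq[of "A' *\<^sub>v v" a "0\<^sub>v a"] by auto
      hence "v = P *\<^sub>v 0\<^sub>v a + Q *\<^sub>v 0\<^sub>v b" using dec[OF v] by simp
      thus ?thesis using P Q by (simp add: mult_mat_zero_vec)
    qed
    hence "injective_mat (A' @\<^sub>r B')" 
      by (intro injective_matI[OF carrier_append_rows[OF A'(1) B'(1)]])
    thus ?thesis using injective_mat_dim_le[OF carrier_append_rows[OF A'(1) B'(1)]] by simp
  qed
  define S where "S = four_block_mat P Q (0\<^sub>m 0 a) (0\<^sub>m 0 b)"
  have S: "S \<in> carrier_mat d (a + b)" 
    unfolding S_def using four_block_carrier_mat[OF P(1), of "0\<^sub>m 0 b" 0 b] by simp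
  have Sv: "S *\<^sub>v (u @\<^sub>v v) = P *\<^sub>v u + Q *\<^sub>v v" if "u \<in> carrier_vec a" "v \<in> carrier_vec b" for u v
    unfolding S_def using four_block_mat_mult_vec[OF P(1) Q(1) zero_carrier_mat zero_carrier_mat that]
      P Q that by (auto intro!: eq_vecI)
  have inj: "injective_mat S"
  proof (rule injective_matI[OF S])
    fix w assume w: "w \<in> carrier_vec (a + b)" and z: "S *\<^sub>v w = 0\<^sub>v d"
    define u v where "u = vec_first w a" and "v = vec_last w b"
    have uv: "u \<in> carrier_vec a" "v \<in> carrier_vec b" "w = u @\<^sub>v v"
      using w S by (auto simp: u_def v_def)
    have eq: "P *\<^sub>v u + Q *\<^sub>v v = 0\<^sub>v d" using z Sv[OF uv(1,2)] uv(3) S by simp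
    have "0\<^sub>v d = M *\<^sub>v (P *\<^sub>v u + Q *\<^sub>v v)" using eq M by (simp add: mult_mat_zero_vec)
    also have "\<dots> = q \<cdot>\<^sub>v (P *\<^sub>v u) + (-1) \<cdot>\<^sub>v (Q *\<^sub>v v)"
      using M P Q uv PM QM by (simp add: mult_add_distrib_mat_vec)
    finally have eq2: "q \<cdot>\<^sub>v (P *\<^sub>v u) + (-1) \<cdot>\<^sub>v (Q *\<^sub>v v) = 0\<^sub>v d" by simp
    have ent: "(P *\<^sub>v u) $ i = 0 \<and> (Q *\<^sub>v v) $ i = 0" if i: "i < d" for i
    proof -
      have "(P *\<^sub>v u + Q *\<^sub>v v) $ i = 0" "(q \<cdot>\<^sub>v (P *\<^sub>v u) + (-1) \<cdot>\<^sub>v (Q *\<^sub>v v)) $ i = 0"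
        using eq eq2 i by simp_all
      hence e: "(P *\<^sub>v u) $ i + (Q *\<^sub>v v) $ i = 0" "q * (P *\<^sub>v u) $ i - (Q *\<^sub>v v) $ i = 0"
        using i P Q by simp_all
      have "(q + 1) * (P *\<^sub>v u) $ i = ((P *\<^sub>v u) $ i + (Q *\<^sub>v v) $ i) + (q * (P *\<^sub>v u) $ i - (Q *\<^sub>v v) $ i)"
        by (simp add: algebra_simps)
      hence "(q + 1) * (P *\<^sub>v u) $ i = 0" using e by simp
      thus ?thesis using q e by simp
    qed
    have "P *\<^sub>v u = 0\<^sub>v d" "Q *\<^sub>v v = 0\<^sub>v d" using ent P Q by (auto intro!: eq_vecI)
    hence "u = 0\<^sub>v a" "v = 0\<^sub>v b" using P Q uv unfolding injective_mat_def by auto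
    thus "w = 0\<^sub>v (a + b)" using uv(3) by (auto intro!: eq_vecI)
  qed
  have ab: "a + b = d" using ge injective_mat_dim_le[OF S inj] by simp
  have S': "S \<in> carrier_mat d d" using S ab by simp
  define D where "D = four_block_mat (q \<cdot>\<^sub>m 1\<^sub>m a) (0\<^sub>m a b) (0\<^sub>m b a) ((-1) \<cdot>\<^sub>m 1\<^sub>m b :: 'a mat)"
  have D: "D \<in> carrier_mat d d" unfolding D_def ab[symmetric] by (intro four_block_carrier_mat) auto
  have "M * S = S * D"
  proof (rule mat_eq_by_vec)
    fix w :: "'a vec" assume w: "w \<in> carrier_vec d"
    define u v where "u = vec_first w a" and "v = vec_last w b"
    have uv: "u \<in> carrier_vec a" "v \<in> carrier_vec b" "w = u @\<^sub>v v"
      using w ab by (auto simp: u_def v_def)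
    have "D *\<^sub>v w = (q \<cdot>\<^sub>m 1\<^sub>m a) *\<^sub>v u @\<^sub>v ((-1) \<cdot>\<^sub>m 1\<^sub>m b) *\<^sub>v v"
      unfolding D_def uv(3) by (rule mult_mat_vec_split) (use uv in auto)
    also have "(q \<cdot>\<^sub>m 1\<^sub>m a) *\<^sub>v u = q \<cdot>\<^sub>v u" using uv by (intro eq_vecI) auto
    also have "((-1) \<cdot>\<^sub>m 1\<^sub>m b) *\<^sub>v v = (-1) \<cdot>\<^sub>v v" using uv by (intro eq_vecI) auto
    finally have "S *\<^sub>v (D *\<^sub>v w) = q \<cdot>\<^sub>v (P *\<^sub>v u) + (-1) \<cdot>\<^sub>v (Q *\<^sub>v v)"
      using Sv[of "q \<cdot>\<^sub>v u" "(-1) \<cdot>\<^sub>v v"] uv mult_mat_vec[OF P(1) uv(1)] mult_mat_vec[OF Q(1) uv(2)]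
        by simp
    moreover have "M *\<^sub>v (S *\<^sub>v w) = q \<cdot>\<^sub>v (P *\<^sub>v u) + (-1) \<cdot>\<^sub>v (Q *\<^sub>v v)"
      unfolding uv(3) Sv[OF uv(1,2)] using M P Q uv PM QM by (simp add: mult_add_distrib_mat_vec)
    ultimately show "(M * S) *\<^sub>v w = (S * D) *\<^sub>v w"
      using assoc_mult_mat_vec[OF M S' w] assoc_mult_mat_vec[OF S' D w] by simp
  qed (use M S' D in auto)
  hence "det S * det M = det S * det D" using det_mult[OF M S'] det_mult[OF S' D] by (metis mult.commute)
  moreover have "det S \<noteq> 0" using inj S' det_0_iff_vec_prod_zero[OF S'] unfolding injective_mat_def
    by auto
  ultimately have "det M = det D" by simp
  also have "\<dots> = det (q \<cdot>\<^sub>m 1\<^sub>m a) * det ((-1) \<cdot>\<^sub>m 1\<^sub>m b :: 'a mat)"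
    unfolding D_def by (rule det_four_block_mat_lower_left_zero) auto
  also have "\<dots> = q ^ a * (-1) ^ b" by simp
  finally have "det M = q ^ (d - b) * (-1) ^ b" using ab by auto
  moreover have "M *\<^sub>v v = q \<cdot>\<^sub>v v" if v: "v \<in> carrier_vec d" and z: "B' *\<^sub>v v = 0\<^sub>v b" for v
  proof -
    have "v = P *\<^sub>v (A' *\<^sub>v v) + Q *\<^sub>v 0\<^sub>v b" using dec[OF v] z by simp
    hence "v = P *\<^sub>v (A' *\<^sub>v v)" using P Q A' v by (simp add: mult_mat_zero_vec)
    thus ?thesis using PM[of "A' *\<^sub>v v"] A' v by simp
  qed
  ultimately show ?thesis using that[of b B'] B' ab by auto
qed

section \<open>Words in the generators of the Iwahori--Hecke algebra\<close>

primrec desc_word :: "nat \<Rightarrow> (nat \<Rightarrow> 'b::comm_ring_1 mat) \<Rightarrow> nat \<Rightarrow> 'b mat" where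
  "desc_word m T 0 = 1\<^sub>m m"
| "desc_word m T (Suc k) = T (Suc k) * desc_word m T k"

text \<open>
The product of the descending words for \<open>1, \<dots>, k\<close>. Its \<open>k (k + 1) / 2\<close> letters form a reduced
word of the longest element of \<open>Sym(k+1)\<close>, and it grows with \<open>k\<close> by one descending word, which
makes it accessible to induction.
\<close>

primrec long_word :: "nat \<Rightarrow> (nat \<Rightarrow> 'b::comm_ring_1 mat) \<Rightarrow> nat \<Rightarrow> 'b mat" where
  "long_word m T 0 = 1\<^sub>m m"
| "long_word m T (Suc k) = long_word m T k * desc_word m T (Suc k)"

locale hecke_generators =
  fixes m n :: nat and q :: "'b::field" and T :: "nat \<Rightarrow> 'b mat"
  assumes carrier: "i \<in> {1..n} \<Longrightarrow> T i \<in> carrier_mat m m"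
    and quadratic: "i \<in> {1..n} \<Longrightarrow> T i * T i = (q - 1) \<cdot>\<^sub>m T i + q \<cdot>\<^sub>m 1\<^sub>m m"
    and braid: "i \<in> {1..<n} \<Longrightarrow> T i * T (Suc i) * T i = T (Suc i) * T i * T (Suc i)"
    and far_commute: "i \<in> {1..n} \<Longrightarrow> j \<in> {1..n} \<Longrightarrow> i + 1 < j \<Longrightarrow> T i * T j = T j * T i"
begin

lemma desc_word_carrier: "k \<le> n \<Longrightarrow> desc_word m T k \<in> carrier_mat m m"
proof (induction k)
  case (Suc k)
  thus ?case using carrier[of "Suc k"] by auto
qed auto

lemma long_word_carrier: "k \<le> n \<Longrightarrow> long_word m T k \<in> carrier_mat m m"
proof (induction k)
  case (Suc k)
  thus ?case using desc_word_carrier[of "Suc k"] by auto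
qed auto

lemma desc_word_commute: "k + 1 < j \<Longrightarrow> j \<le> n \<Longrightarrow> desc_word m T k * T j = T j * desc_word m T k"
proof (induction k)
  case 0
  thus ?case using carrier[of j] by simp
next
  case (Suc k)
  have c: "T (Suc k) \<in> carrier_mat m m" "T j \<in> carrier_mat m m" "desc_word m T k \<in> carrier_mat m m"
    using Suc.prems carrier desc_word_carrier by auto
  have "desc_word m T (Suc k) * T j = T (Suc k) * (desc_word m T k * T j)"
    using c by simp
  also have "\<dots> = T (Suc k) * T j * desc_word m T k" using Suc c by simp
  also have "\<dots> = T j * desc_word m T (Suc k)" using Suc.prems far_commute[of "Suc k" j] c by simp
  finally show ?case .
qed

text \<open>
The factor \<open>T\<^bsub>i+1\<^esub>\<close> passes through \<open>T\<^sub>1, \<dots>, T\<^bsub>i-1\<^esub>\<close>, the braid relation then produces a factor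
\<open>T\<^sub>i\<close> on the left of \<open>T\<^bsub>i+1\<^esub> T\<^sub>i\<close>, and this factor passes through \<open>T\<^bsub>i+2\<^esub>, \<dots>, T\<^sub>k\<close>.
\<close>

lemma desc_word_shift: "1 \<le> i \<Longrightarrow> i < k \<Longrightarrow> k \<le> n \<Longrightarrow> desc_word m T k * T (Suc i) = T i * desc_word m T k"
proof (induction k)
  case (Suc k)
  have c: "T (Suc k) \<in> carrier_mat m m" "T i \<in> carrier_mat m m" "T (Suc i) \<in> carrier_mat m m" 
      "desc_word m T k \<in> carrier_mat m m"
    using Suc.prems carrier desc_word_carrier by auto
  show ?case
  proof (cases "i < k")
    case True
    have "desc_word m T (Suc k) * T (Suc i) = T (Suc k) * (desc_word m T k * T (Suc i))" using c by simp
    also have "\<dots> = (T (Suc k) * T i) * desc_word m T k" using Suc True c by simp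
    also have "T (Suc k) * T i = T i * T (Suc k)" using far_commute[of i "Suc k"] True Suc.prems by simp
    also have "\<dots> * desc_word m T k = T i * desc_word m T (Suc k)" using c by simp
    finally show ?thesis .
  next
    case False
    then obtain j where j: "i = Suc j" "k = Suc j" using Suc.prems
      by (metis One_nat_def Suc_le_D less_Suc_eq)
    have "desc_word m T j \<in> carrier_mat m m" using desc_word_carrier Suc.prems j by simp
    hence cj: "desc_word m T j \<in> carrier_mat m m" "T i * desc_word m T j \<in> carrier_mat m m"
      "T (Suc i) * T i \<in> carrier_mat m m" "T i * T (Suc i) \<in> carrier_mat m m" using c by auto
    have T: "T i * T (Suc i) * T i = T (Suc i) * T i * T (Suc i)" using braid[of i] Suc.prems j by simp
    have e: "desc_word m T j * T (Suc i) = T (Suc i) * desc_word m T j"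
      using desc_word_commute[of j "Suc i"] j Suc.prems by simp
    have dk: "desc_word m T (Suc k) = T (Suc i) * T i * desc_word m T j"
      using assoc_mult_mat[OF c(3,2) cj(1)] j by simp
    have "desc_word m T (Suc k) * T (Suc i) = T (Suc i) * T i * (desc_word m T j * T (Suc i))"
      unfolding dk by (rule assoc_mult_mat[OF cj(3,1) c(3)])
    also have "\<dots> = (T (Suc i) * T i * T (Suc i)) * desc_word m T j"
      unfolding e by (rule assoc_mult_mat[symmetric, OF cj(3) c(3) cj(1)])
    also have "\<dots> = T i * desc_word m T (Suc k)"
      unfolding T[symmetric] dk assoc_mult_mat[OF c(2,3,2)] by (rule assoc_mult_mat[OF c(2) cj(3,1)])
    finally show ?thesis .
  qed
qed simp

text \<open>
Conjugation by the longest element exchanges \<open>s\<^sub>i\<close> and \<open>s\<^bsub>k+1-i\<^esub>\<close>. For \<open>i \<ge> 2\<close> the last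
descending word lowers the index by one and the induction hypothesis applies. The case \<open>i = 1\<close>
is the transpose of the case \<open>i = k\<close>.
\<close>

lemma long_word_flip:
  assumes sym: "\<And>k. k \<le> n \<Longrightarrow> (long_word m T k)\<^sup>T = long_word m T k"
    and symT: "\<And>i. i \<in> {1..n} \<Longrightarrow> (T i)\<^sup>T = T i"
  shows "k \<le> n \<Longrightarrow> i \<in> {1..k} \<Longrightarrow> long_word m T k * T i = T (Suc k - i) * long_word m T k"
proof (induction k arbitrary: i)
  case (Suc k)
  have c: "long_word m T k \<in> carrier_mat m m" "desc_word m T (Suc k) \<in> carrier_mat m m"
    "long_word m T (Suc k) \<in> carrier_mat m m" using Suc.prems
    by (auto intro!: desc_word_carrier long_word_carrier simp del: desc_word.simps long_word.simps)
  have *: "long_word m T (Suc k) * T i = T (Suc (Suc k) - i) * long_word m T (Suc k)"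
    if i: "2 \<le> i" "i \<le> Suc k" for i
  proof -
    have ci: "T i \<in> carrier_mat m m" "T (i - 1) \<in> carrier_mat m m" "T (Suc k - (i - 1)) \<in> carrier_mat m m" 
      using i Suc.prems by (auto intro!: carrier)
    have "long_word m T (Suc k) * T i = long_word m T k * (desc_word m T (Suc k) * T i)"
      using c ci by (simp del: desc_word.simps)
    also have "desc_word m T (Suc k) * T i = T (i - 1) * desc_word m T (Suc k)"
      using desc_word_shift[of "i - 1" "Suc k"] i Suc.prems by (simp del: desc_word.simps)
    also have "long_word m T k * \<dots> = (long_word m T k * T (i - 1)) * desc_word m T (Suc k)"
      using c ci by (simp del: desc_word.simps)
    also have "long_word m T k * T (i - 1) = T (Suc k - (i - 1)) * long_word m T k"
    proof (rule Suc.IH)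
      show "i - 1 \<in> {1..k}" using i by auto
    qed (use Suc.prems in simp)
    also have "\<dots> * desc_word m T (Suc k) = T (Suc k - (i - 1)) * long_word m T (Suc k)"
      using c ci by (simp del: desc_word.simps)
    finally show ?thesis using i by (simp add: Suc_diff_le del: desc_word.simps long_word.simps)
  qed
  show ?case
  proof (cases "i = 1")
    case False
    thus ?thesis using *[of i] Suc.prems by simp
  next
    case True
    show ?thesis
    proof (cases "k = 0")
      case True
      thus ?thesis using \<open>i = 1\<close> carrier[of 1] Suc.prems by simp
    next
      case False
      have cT: "T 1 \<in> carrier_mat m m" "T (Suc k) \<in> carrier_mat m m" using carrier Suc.prems by auto
      have "(long_word m T (Suc k) * T (Suc k))\<^sup>T = (T 1 * long_word m T (Suc k))\<^sup>T"
        using *[of "Suc k"] False by (simp del: desc_word.simps long_word.simps)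
      hence "T (Suc k) * long_word m T (Suc k) = long_word m T (Suc k) * T 1"
        using transpose_mult[OF c(3) cT(2)] transpose_mult[OF cT(1) c(3)] sym[OF Suc.prems(1)]
          symT[of 1] symT[of "Suc k"] Suc.prems by (simp del: desc_word.simps long_word.simps)
      thus ?thesis using True by simp
    qed
  qed
qed simp

lemma long_word_sq_central:
  assumes sym: "\<And>k. k \<le> n \<Longrightarrow> (long_word m T k)\<^sup>T = long_word m T k"
    and symT: "\<And>i. i \<in> {1..n} \<Longrightarrow> (T i)\<^sup>T = T i" and i: "i \<in> {1..n}"
  shows "(long_word m T n * long_word m T n) * T i = T i * (long_word m T n * long_word m T n)"
proof -
  define A where "A = long_word m T n"
  define j where "j = Suc n - i"
  have j: "j \<in> {1..n}" "Suc n - j = i" using i by (auto simp: j_def)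
  have c: "A \<in> carrier_mat m m" "T i \<in> carrier_mat m m" "T j \<in> carrier_mat m m" 
    using carrier i j long_word_carrier by (auto simp: A_def)
  have "A * A * T i = A * (A * T i)" using c by simp
  also have "A * T i = T j * A" unfolding A_def j_def
    by (rule long_word_flip[OF sym symT]) (use i in auto)
  also have "A * (T j * A) = (A * T j) * A" using c by simp
  also have "A * T j = T i * A" 
    using long_word_flip[OF sym symT, of n j] j unfolding A_def by simp
  also have "T i * A * A = T i * (A * A)" using c by simp
  finally show ?thesis unfolding A_def .
qed

end

text \<open>
If the range of \<open>P\<close> is invariant under all \<open>T\<^sub>i\<close> and \<open>M\<^sub>i\<close> is the matrix of the restriction,
then words in the \<open>T\<^sub>i\<close> restrict to the same words in the \<open>M\<^sub>i\<close>.
\<close>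

lemma desc_word_intertwine:
  assumes P: "P \<in> carrier_mat m d" and k: "k \<le> n"
    and T: "\<And>i. i \<in> {1..n} \<Longrightarrow> T i \<in> carrier_mat m m" and M: "\<And>i. i \<in> {1..n} \<Longrightarrow> M i \<in> carrier_mat d d"
    and TP: "\<And>i. i \<in> {1..n} \<Longrightarrow> T i * P = P * M i"
  shows "desc_word m T k \<in> carrier_mat m m \<and> desc_word d M k \<in> carrier_mat d d \<and> desc_word m T k * P = P * desc_word d M k"
  using k
proof (induction k)
  case 0
  thus ?case using P by simp
next
  case (Suc k)
  hence c: "desc_word m T k \<in> carrier_mat m m" "desc_word d M k \<in> carrier_mat d d"
    "desc_word m T k * P = P * desc_word d M k"
    "T (Suc k) \<in> carrier_mat m m" "M (Suc k) \<in> carrier_mat d d" "T (Suc k) * P = P * M (Suc k)"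
    using T M TP by auto
  have "desc_word m T (Suc k) * P = T (Suc k) * (desc_word m T k * P)" using c P by simp
  also have "\<dots> = (T (Suc k) * P) * desc_word d M k" unfolding c(3) using c(1,2,4,5) P by simp
  also have "\<dots> = P * desc_word d M (Suc k)" unfolding c(6) using c(1,2,4,5) P by simp
  finally show ?case using c by simp
qed

lemma long_word_intertwine:
  assumes P: "P \<in> carrier_mat m d" and k: "k \<le> n"
    and T: "\<And>i. i \<in> {1..n} \<Longrightarrow> T i \<in> carrier_mat m m" and M: "\<And>i. i \<in> {1..n} \<Longrightarrow> M i \<in> carrier_mat d d"
    and TP: "\<And>i. i \<in> {1..n} \<Longrightarrow> T i * P = P * M i"
  shows "long_word m T k \<in> carrier_mat m m \<and> long_word d M k \<in> carrier_mat d d \<and> long_word m T k * P = P * long_word d M k"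
  using k
proof (induction k)
  case 0
  thus ?case using P by simp
next
  case (Suc k)
  define A B where "A = desc_word m T (Suc k)" and "B = desc_word d M (Suc k)"
  have AB: "A \<in> carrier_mat m m" "B \<in> carrier_mat d d" "A * P = P * B"
    using desc_word_intertwine[of P m d "Suc k" n T M] P Suc.prems T M TP unfolding A_def B_def by auto
  have c: "long_word m T k \<in> carrier_mat m m" "long_word d M k \<in> carrier_mat d d" "long_word m T k * P = P * long_word d M k"
    using Suc by auto
  have eq: "long_word m T (Suc k) = long_word m T k * A" "long_word d M (Suc k) = long_word d M k * B"
    by (simp_all add: A_def B_def)
  have "long_word m T (Suc k) * P = long_word m T k * (A * P)" unfolding eq using c AB P by simp
  also have "\<dots> = (long_word m T k * P) * B" unfolding AB(3) using c(1,2) AB(1,2) P by simp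
  also have "\<dots> = P * long_word d M (Suc k)" unfolding eq c(3) using c(1,2) AB(1,2) P by simp
  finally show ?case unfolding eq using c AB by simp
qed

text \<open>
The word has \<open>k (k + 1) / 2\<close> letters; the square avoids the division by two.
\<close>

lemma det_long_word:
  fixes M :: "nat \<Rightarrow> complex mat"
  assumes M: "\<And>i. i \<in> {1..n} \<Longrightarrow> M i \<in> carrier_mat d d" and det: "\<And>i. i \<in> {1..n} \<Longrightarrow> cmod (det (M i)) = c"
    and k: "k \<le> n"
  shows "cmod (det (long_word d M k)) ^ 2 = c ^ (k * (k + 1))"
proof -
  have d: "desc_word d M k \<in> carrier_mat d d \<and> cmod (det (desc_word d M k)) = c ^ k" if "k \<le> n" for k
    using that
  proof (induction k)
    case (Suc k)
    thus ?case using M[of "Suc k"] det[of "Suc k"] det_mult[of "M (Suc k)" d "desc_word d M k"]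
      by (auto simp: norm_mult)
  qed auto
  have "long_word d M k \<in> carrier_mat d d \<and> cmod (det (long_word d M k)) ^ 2 = c ^ (k * (k + 1))"
    using k
  proof (induction k)
    case (Suc k)
    have "Suc k * (Suc k + 1) = k * (k + 1) + Suc k * 2" by simp
    hence "c ^ (Suc k * (Suc k + 1)) = c ^ (k * (k + 1)) * (c ^ Suc k) ^ 2"
      by (simp only: power_add power_mult)
    thus ?case using Suc d[of "Suc k"] det_mult[of "long_word d M k" d "desc_word d M (Suc k)"]
      by (auto simp: norm_mult power_mult_distrib simp del: desc_word.simps)
  qed auto
  thus ?thesis ..
qed

section \<open>Eigenvalues of the square of the longest word\<close>

text \<open>
The determinant argument: on \<open>E\<close> the longest word \<open>A\<close> satisfies \<open>A\<^sup>2 = \<mu>\<close>, so the determinant of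
its restriction determines the absolute value of \<open>\<mu>\<close>, while the same determinant is a product of
\<open>n (n + 1) / 2\<close> determinants that all have absolute value \<open>q\<close> to the power \<open>d - b\<close>. The absence
of common eigenvectors for \<open>q\<close> forces \<open>d \<le> n b\<close>.
\<close>

theorem central_eigenvalue_bound:
  fixes q :: real and \<mu> :: complex
  assumes H: "hecke_generators m n (complex_of_real q) T" and n: "n \<ge> 1" and q: "q > 1"
    and E: "lin_sub m E" "E \<noteq> {0\<^sub>v m}"
    and inv: "\<And>i v. i \<in> {1..n} \<Longrightarrow> v \<in> E \<Longrightarrow> T i *\<^sub>v v \<in> E"
    and eig: "\<And>v. v \<in> E \<Longrightarrow> long_word m T n *\<^sub>v (long_word m T n *\<^sub>v v) = \<mu> \<cdot>\<^sub>v v"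
    and nofix: "\<And>v. v \<in> E \<Longrightarrow> (\<And>i. i \<in> {1..n} \<Longrightarrow> T i *\<^sub>v v = complex_of_real q \<cdot>\<^sub>v v) \<Longrightarrow> v = 0\<^sub>v m"
  shows "cmod \<mu> \<le> q ^ ((n - 1) * (n + 1))"
proof -
  interpret hecke_generators m n "complex_of_real q" T by (rule H)
  obtain d P where P: "P \<in> carrier_mat m d" "injective_mat P" and PE: "(\<lambda>v. P *\<^sub>v v) ` carrier_vec d = E"
    by (rule lin_sub_range[OF E(1)])
  have PvE: "P *\<^sub>v v \<in> E" if "v \<in> carrier_vec d" for v using PE that by blast
  have d: "d > 0"
  proof (rule ccontr)
    assume "\<not> d > 0"
    hence "v = 0\<^sub>v d" if "v \<in> carrier_vec d" for v :: "complex vec" using that by (intro eq_vecI) auto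
    hence "E \<subseteq> {0\<^sub>v m}" unfolding PE[symmetric] using mult_mat_zero_vec[OF P(1)] by auto
    thus False using E unfolding lin_sub_def by blast
  qed
  have "\<exists>M. M \<in> carrier_mat d d \<and> T i * P = P * M" if i: "i \<in> {1..n}" for i
  proof -
    have "T i * P \<in> carrier_mat m d" using carrier[OF i] P by simp
    moreover have "(T i * P) *\<^sub>v v \<in> (\<lambda>v. P *\<^sub>v v) ` carrier_vec d" if "v \<in> carrier_vec d" for v
      unfolding PE assoc_mult_mat_vec[OF carrier[OF i] P(1) that] by (rule inv[OF i PvE[OF that]])
    ultimately show ?thesis using factor_through_range[OF P(1)] by metis
  qed
  then obtain M where M: "\<And>i. i \<in> {1..n} \<Longrightarrow> M i \<in> carrier_mat d d"
    and TP: "\<And>i. i \<in> {1..n} \<Longrightarrow> T i * P = P * M i"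
    by metis
  have TTP: "T i * T j * P = P * (M i * M j)" if i: "i \<in> {1..n}" and j: "j \<in> {1..n}" for i j
  proof -
    have "T i * T j * P = T i * (T j * P)" by (rule assoc_mult_mat[OF carrier[OF i] carrier[OF j] P(1)])
    also have "\<dots> = (T i * P) * M j" unfolding TP[OF j]
      by (rule assoc_mult_mat[symmetric, OF carrier[OF i] P(1) M[OF j]])
    also have "\<dots> = P * (M i * M j)" unfolding TP[OF i] by (rule assoc_mult_mat[OF P(1) M[OF i] M[OF j]])
    finally show ?thesis .
  qed
  have TTTP: "T i * T j * T k * P = P * (M i * M j * M k)" if i: "i \<in> {1..n}" and j: "j \<in> {1..n}"
    and k: "k \<in> {1..n}" for i j k
  proof -
    have c: "T i * T j \<in> carrier_mat m m" "M i * M j \<in> carrier_mat d d" 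
      using mult_carrier_mat[OF carrier[OF i] carrier[OF j]] mult_carrier_mat[OF M[OF i] M[OF j]]
        by simp_all
    have "T i * T j * T k * P = T i * T j * (T k * P)"
      by (rule assoc_mult_mat[OF c(1) carrier[OF k] P(1)])
    also have "\<dots> = (T i * T j * P) * M k" unfolding TP[OF k]
      by (rule assoc_mult_mat[symmetric, OF c(1) P(1) M[OF k]])
    also have "\<dots> = P * (M i * M j * M k)" unfolding TTP[OF i j]
      by (rule assoc_mult_mat[OF P(1) c(2) M[OF k]])
    finally show ?thesis .
  qed
  have quadM: "M i * M i = (complex_of_real q - 1) \<cdot>\<^sub>m M i + complex_of_real q \<cdot>\<^sub>m 1\<^sub>m d"
    if i: "i \<in> {1..n}" for i
  proof (rule injective_mat_cancel_mat[OF P])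
    have "P * (M i * M i) = ((complex_of_real q - 1) \<cdot>\<^sub>m T i + complex_of_real q \<cdot>\<^sub>m 1\<^sub>m m) * P"
      unfolding TTP[OF i i, symmetric] quadratic[OF i] ..
    also have "\<dots> = (complex_of_real q - 1) \<cdot>\<^sub>m (T i * P) + complex_of_real q \<cdot>\<^sub>m P"
      using carrier[OF i] P
        by (simp add: add_mult_distrib_mat[of _ m m] mult_smult_assoc_mat[of _ m m P d])
    also have "\<dots> = P * ((complex_of_real q - 1) \<cdot>\<^sub>m M i + complex_of_real q \<cdot>\<^sub>m 1\<^sub>m d)"
      unfolding TP[OF i] using M[OF i] P
        by (simp add: mult_add_distrib_mat[of P m d _ d] mult_smult_distrib[of P m d _ d])
    finally show "P * (M i * M i) = P * ((complex_of_real q - 1) \<cdot>\<^sub>m M i + complex_of_real q \<cdot>\<^sub>m 1\<^sub>m d)" .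
  qed (use M[OF i] in auto)
  have "complex_of_real (q + 1) \<noteq> 0" using q unfolding of_real_eq_0_iff by simp
  hence q1: "complex_of_real q + 1 \<noteq> 0" by simp
  have "\<exists>b R. b \<le> d \<and> det (M i) = complex_of_real q ^ (d - b) * (-1) ^ b \<and> R \<in> carrier_mat b d \<and>
     (\<forall>v\<in>carrier_vec d. R *\<^sub>v v = 0\<^sub>v b \<longrightarrow> M i *\<^sub>v v = complex_of_real q \<cdot>\<^sub>v v)" if i: "i \<in> {1..n}" for i
    by (rule quadratic_mat_det[OF M[OF i] quadM[OF i] q1]) blast
  then obtain b R where bd: "\<And>i. i \<in> {1..n} \<Longrightarrow> b i \<le> d"
    and detM: "\<And>i. i \<in> {1..n} \<Longrightarrow> det (M i) = complex_of_real q ^ (d - b i) * (-1) ^ b i"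
    and R: "\<And>i. i \<in> {1..n} \<Longrightarrow> R i \<in> carrier_mat (b i) d"
    and RM: "\<And>i v. i \<in> {1..n} \<Longrightarrow> v \<in> carrier_vec d \<Longrightarrow> R i *\<^sub>v v = 0\<^sub>v (b i) \<Longrightarrow> M i *\<^sub>v v = complex_of_real q \<cdot>\<^sub>v v"
    by metis
  have cdet: "cmod (det (M i)) = q ^ (d - b i)" if "i \<in> {1..n}" for i
    using detM[OF that] q by (simp add: norm_mult norm_power)
  \<comment> \<open>The braid relation makes the determinants of neighbouring generators equal.\<close>
  have b_Suc: "b (Suc i) = b i" if i: "i \<in> {1..<n}" for i
  proof -
    have i': "i \<in> {1..n}" "Suc i \<in> {1..n}" using i by auto
    note c = M[OF i'(1)] M[OF i'(2)]
    have "M i * M (Suc i) * M i = M (Suc i) * M i * M (Suc i)"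
    proof (rule injective_mat_cancel_mat[OF P])
      show "P * (M i * M (Suc i) * M i) = P * (M (Suc i) * M i * M (Suc i))"
        using TTTP[OF i'(1,2,1)] TTTP[OF i'(2,1,2)] braid[OF i] by simp
    qed (use c in auto)
    hence "det (M i) * det (M (Suc i)) * det (M i) = det (M (Suc i)) * det (M i) * det (M (Suc i))"
      using c by (metis mult_carrier_mat det_mult)
    moreover have "det (M i) \<noteq> 0" "det (M (Suc i)) \<noteq> 0" using cdet[OF i'(1)] cdet[OF i'(2)] q by auto
    ultimately have "det (M i) = det (M (Suc i))" by simp
    hence "q ^ (d - b i) = q ^ (d - b (Suc i))" using cdet i' by metis
    hence "d - b i = d - b (Suc i)" using q by simp
    thus ?thesis using bd[OF i'(1)] bd[OF i'(2)] by simp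
  qed
  have b1: "b i = b 1" if "1 \<le> i" "i \<le> n" for i
    using that
  proof (induction i rule: dec_induct)
    case (step i)
    thus ?case using b_Suc[of i] by simp
  qed simp
  have "d \<le> (\<Sum>i = 1..n. b i)"
  proof (rule common_kernel_dim[where R = R])
    fix v :: "complex vec" assume v: "v \<in> carrier_vec d" and z: "\<And>i. i \<in> {1..n} \<Longrightarrow> R i *\<^sub>v v = 0\<^sub>v (b i)"
    have "T i *\<^sub>v (P *\<^sub>v v) = complex_of_real q \<cdot>\<^sub>v (P *\<^sub>v v)" if i: "i \<in> {1..n}" for i
    proof -
      have "T i *\<^sub>v (P *\<^sub>v v) = P *\<^sub>v (M i *\<^sub>v v)"
        using assoc_mult_mat_vec[OF carrier[OF i] P(1) v] assoc_mult_mat_vec[OF P(1) M[OF i] v]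
          TP[OF i] by simp
      thus ?thesis using RM[OF i v z[OF i]] mult_mat_vec[OF P(1) v] by simp
    qed
    hence "P *\<^sub>v v = 0\<^sub>v m" by (rule nofix[OF PvE[OF v]])
    thus "v = 0\<^sub>v d" using P v unfolding injective_mat_def by auto
  qed (use R in auto)
  also have "(\<Sum>i = 1..n. b i) = (\<Sum>i = 1..n. b 1)" by (intro sum.cong refl b1) auto
  finally have db: "d \<le> n * b 1" by simp
  define L where "L = long_word d M n"
  have L: "L \<in> carrier_mat d d" "long_word m T n * P = P * L" "long_word m T n \<in> carrier_mat m m"
    using long_word_intertwine[of P m d n n T M] P carrier M TP unfolding L_def by auto
  have "L * L = \<mu> \<cdot>\<^sub>m 1\<^sub>m d"
  proof (rule mat_eq_by_vec)
    fix v :: "complex vec" assume v: "v \<in> carrier_vec d"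
    have AP: "long_word m T n *\<^sub>v (P *\<^sub>v u) = P *\<^sub>v (L *\<^sub>v u)" if "u \<in> carrier_vec d" for u
      using assoc_mult_mat_vec[OF L(3) P(1) that] assoc_mult_mat_vec[OF P(1) L(1) that] L(2) by simp
    have "P *\<^sub>v (L *\<^sub>v (L *\<^sub>v v)) = P *\<^sub>v (\<mu> \<cdot>\<^sub>v v)"
      using eig[OF PvE[OF v]] AP[OF v] AP[of "L *\<^sub>v v"] L(1) v mult_mat_vec[OF P(1) v] by simp
    hence "L *\<^sub>v (L *\<^sub>v v) = \<mu> \<cdot>\<^sub>v v" by (rule injective_mat_cancel[OF P, rotated 2]) (use L v in auto)
    thus "(L * L) *\<^sub>v v = (\<mu> \<cdot>\<^sub>m 1\<^sub>m d) *\<^sub>v v" using L v by (auto intro!: eq_vecI)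
  qed (use L in auto)
  hence "det L * det L = \<mu> ^ d" using det_mult[OF L(1) L(1)] by simp
  hence "cmod \<mu> ^ d = cmod (det L) ^ 2" by (metis norm_mult norm_power power2_eq_square)
  also have "\<dots> = (q ^ (d - b 1)) ^ (n * (n + 1))"
    unfolding L_def
  proof (rule det_long_word[where n = n])
    fix i assume i: "i \<in> {1..n}"
    hence "b i = b 1" by (intro b1) auto
    thus "cmod (det (M i)) = q ^ (d - b 1)" using cdet[OF i] by metis
  qed (use M in auto)
  also have "\<dots> = q ^ ((d - b 1) * n * (n + 1))" by (simp only: power_mult[symmetric] mult.assoc)
  also have "\<dots> \<le> q ^ ((n - 1) * (n + 1) * d)"
  proof (rule power_increasing)
    have "(d - b 1) * n \<le> (n - 1) * d" using db by (simp add: algebra_simps)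
    thus "(d - b 1) * n * (n + 1) \<le> (n - 1) * (n + 1) * d" 
      by (metis mult.assoc mult.commute mult_le_mono1)
  qed (use q in simp)
  also have "\<dots> = (q ^ ((n - 1) * (n + 1))) ^ d" by (simp only: power_mult)
  finally show ?thesis using d q by (simp add: power_mono_iff)
qed

section \<open>Quadratic forms and eigenvalues\<close>

lemma scalar_prod_transpose:
  fixes A :: "'b::comm_ring_1 mat"
  assumes A: "A \<in> carrier_mat r d" and u: "u \<in> carrier_vec r" and w: "w \<in> carrier_vec d"
  shows "u \<bullet> (A *\<^sub>v w) = (A\<^sup>T *\<^sub>v u) \<bullet> w"
proof -
  have "u \<bullet> (A *\<^sub>v w) = (\<Sum>i<r. \<Sum>j<d. u $ i * A $$ (i,j) * w $ j)"
    using assms by (simp add: scalar_prod_def sum_distrib_left mult.assoc atLeast0LessThan)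
  also have "\<dots> = (\<Sum>j<d. \<Sum>i<r. u $ i * A $$ (i,j) * w $ j)" by (rule sum.swap)
  also have "\<dots> = (A\<^sup>T *\<^sub>v u) \<bullet> w"
    using assms by (simp add: scalar_prod_def sum_distrib_left sum_distrib_right mult.commute mult.left_commute atLeast0LessThan)
  finally show ?thesis .
qed

lemma Cauchy_Schwarz_real_vec:
  fixes u w :: "real vec"
  assumes "u \<in> carrier_vec m" "w \<in> carrier_vec m"
  shows "(u \<bullet> w)\<^sup>2 \<le> (u \<bullet> u) * (w \<bullet> w)"
proof -
  have "0 \<le> (\<Sum>i<m. \<Sum>j<m. (u $ i * w $ j - u $ j * w $ i)\<^sup>2)" by (intro sum_nonneg) auto
  also have "\<dots> = (\<Sum>i<m. \<Sum>j<m. (u $ i * u $ i) * (w $ j * w $ j)) + (\<Sum>i<m. \<Sum>j<m. (w $ i * w $ i) * (u $ j * u $ j))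
      - 2 * (\<Sum>i<m. \<Sum>j<m. (u $ i * w $ i) * (u $ j * w $ j))"
    unfolding sum_distrib_left sum.distrib[symmetric] sum_subtractf[symmetric]
    by (intro sum.cong refl) (simp add: power2_eq_square algebra_simps)
  also have "\<dots> = 2 * ((u \<bullet> u) * (w \<bullet> w)) - 2 * (u \<bullet> w)\<^sup>2"
    unfolding sum_product[symmetric] using assms
    by (simp add: scalar_prod_def power2_eq_square atLeast0LessThan)
  finally show ?thesis by simp
qed

text \<open>
Power iteration in place of a spectral theorem. If the inequality fails, rescale \<open>C\<close> to a matrix
\<open>D\<close> of spectral radius less than one that still violates it with constant one. For symmetric \<open>D\<close>
the squared norms of \<open>v, D v, D\<^sup>2 v, \<dots>\<close> form a log-convex sequence; it increases in the first
step, hence grows geometrically. But the powers of \<open>D\<close> are bounded.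
\<close>

lemma symmetric_form_bound:
  fixes C :: "real mat"
  assumes C: "C \<in> carrier_mat m m" "C\<^sup>T = C" and \<rho>: "\<rho> > 0"
    and ev: "\<And>\<mu>. eigenvalue (map_mat complex_of_real C) \<mu> \<Longrightarrow> cmod \<mu> \<le> \<rho>"
    and v: "v \<in> carrier_vec m"
  shows "- (v \<bullet> (C *\<^sub>v v)) \<le> \<rho> * (v \<bullet> v)"
proof (rule ccontr)
  assume neg: "\<not> ?thesis"
  have vv: "v \<bullet> v > 0"
  proof (rule ccontr)
    assume "\<not> v \<bullet> v > 0"
    moreover have "v \<bullet> v = (\<Sum>i = 0..<m. (v $ i)\<^sup>2)" using v
      by (simp add: scalar_prod_def power2_eq_square)
    ultimately have "(\<Sum>i = 0..<m. (v $ i)\<^sup>2) = 0" using sum_nonneg[of "{0..<m}" "\<lambda>i. (v $ i)\<^sup>2"] by simp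
    hence "v = 0\<^sub>v m" using v by (intro eq_vecI) (auto simp: sum_nonneg_eq_0_iff)
    thus False using neg C v by (simp add: mult_mat_zero_vec)
  qed
  have m: "m > 0" using vv v by (cases m) (auto simp: scalar_prod_def)
  define s where "s = - (v \<bullet> (C *\<^sub>v v)) / (v \<bullet> v)"
  have s: "s > \<rho>" using neg vv by (simp add: s_def field_simps)
  define r where "r = (\<rho> + s) / 2"
  have r: "\<rho> < r" "r < s" "r > 0" using s \<rho> by (auto simp: r_def)
  \<comment> \<open>\<open>r\<close> lies strictly between the bound on the eigenvalues and the value of the form.\<close>
  define D where "D = inverse r \<cdot>\<^sub>m C"
  have "D\<^sup>T = inverse r \<cdot>\<^sub>m C\<^sup>T" using C(1) by (intro eq_matI) (auto simp: D_def)
  hence D: "D \<in> carrier_mat m m" "D\<^sup>T = D" using C by (auto simp: D_def)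
  let ?D = "map_mat complex_of_real D"
  have D': "?D \<in> carrier_mat m m" using D by simp
  have "cmod \<mu> < 1" if ev': "eigenvalue ?D \<mu>" for \<mu>
  proof -
    obtain w where w: "w \<in> carrier_vec m" "w \<noteq> 0\<^sub>v m" "?D *\<^sub>v w = \<mu> \<cdot>\<^sub>v w"
      using ev' D' unfolding eigenvalue_def eigenvector_def by auto
    have "map_mat complex_of_real C = complex_of_real r \<cdot>\<^sub>m ?D"
      using r C by (intro eq_matI) (auto simp: D_def)
    hence "map_mat complex_of_real C *\<^sub>v w = complex_of_real r \<cdot>\<^sub>v (?D *\<^sub>v w)"
      using D' w(1) by (auto intro!: eq_vecI)
    also have "\<dots> = (complex_of_real r * \<mu>) \<cdot>\<^sub>v w" using w by (simp add: smult_smult_assoc)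
    finally have "eigenvalue (map_mat complex_of_real C) (complex_of_real r * \<mu>)"
      using w C unfolding eigenvalue_def eigenvector_def by auto
    hence "r * cmod \<mu> \<le> \<rho>" using ev r by (fastforce simp: norm_mult)
    also have "\<dots> < r * 1" using r by simp
    finally show ?thesis using r by (simp only: mult_less_cancel_left_pos)
  qed
  hence "spectral_radius ?D < 1"
    using spectral_radius_mem_max(1)[OF D' m] unfolding spectrum_def by auto
  then obtain c where c: "\<And>k. norm_bound (?D ^\<^sub>m k) c"
    using spectral_radius_jnf_norm_bound_less_1_upper_triangular[OF D'] by blast
  define w where "w k = (D ^\<^sub>m k) *\<^sub>v v" for k
  have wc: "w k \<in> carrier_vec m" for k
    unfolding w_def by (rule mult_mat_vec_carrier[OF pow_carrier_mat[OF D(1)] v])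
  have wS: "w (Suc k) = D *\<^sub>v w k" for k
  proof -
    have "D ^\<^sub>m k * D = D * D ^\<^sub>m k"
    proof (induction k)
      case (Suc k)
      have "D ^\<^sub>m Suc k * D = D * D ^\<^sub>m k * D" using Suc by simp
      also have "\<dots> = D * D ^\<^sub>m Suc k" using assoc_mult_mat[OF D(1) pow_carrier_mat[OF D(1)] D(1)] by simp
      finally show ?case .
    qed (use D in simp)
    thus ?thesis using assoc_mult_mat_vec[OF pow_carrier_mat[OF D(1)] D(1) v, of k]
        assoc_mult_mat_vec[OF D(1) pow_carrier_mat[OF D(1)] v, of k] by (simp add: w_def)
  qed
  define x where "x k = w k \<bullet> w k" for k
  have sw: "w a \<bullet> w (Suc b) = w (Suc a) \<bullet> w b" for a b
    unfolding wS using scalar_prod_transpose[OF D(1) wc wc] D(2) by simp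
  have conv: "(x (Suc k))\<^sup>2 \<le> x k * x (Suc (Suc k))" for k
    using Cauchy_Schwarz_real_vec[OF wc[of k] wc[of "Suc (Suc k)"]] sw[of k "Suc k"] by (simp add: x_def)
  have w0: "w 0 = v" using v D by (simp add: w_def)
  have x0: "x 0 > 0" using vv by (simp add: x_def w0)
  have vDv: "- (v \<bullet> (D *\<^sub>v v)) = s / r * x 0"
  proof -
    have "D *\<^sub>v v = inverse r \<cdot>\<^sub>v (C *\<^sub>v v)" using C v by (auto simp: D_def intro!: eq_vecI)
    thus ?thesis using C v vv r by (simp add: s_def x_def w0 field_simps)
  qed
  have "1 * x 0 < s / r * x 0" using r x0 by (intro mult_strict_right_mono) auto
  hence "x 0 < - (v \<bullet> (D *\<^sub>v v))" unfolding vDv by simp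
  hence "(x 0)\<^sup>2 < (- (v \<bullet> (D *\<^sub>v v)))\<^sup>2" using x0 by (intro power_strict_mono) auto
  also have "\<dots> \<le> x 0 * x 1" using Cauchy_Schwarz_real_vec[OF wc[of 0] wc[of 1]] wS[of 0]
    by (simp add: x_def w0)
  finally have x1: "x 0 < x 1" using x0 by (simp add: power2_eq_square)
  define t where "t = x 1 / x 0"
  have t: "t > 1" using x1 x0 by (simp add: t_def)
  have grow: "x k > 0 \<and> x (Suc k) \<ge> t * x k" for k
  proof (induction k)
    case 0
    show ?case using x0 by (simp add: t_def)
  next
    case (Suc k)
    have "0 < t * x k" using Suc t by simp
    hence p: "x (Suc k) > 0" using Suc by linarith
    have "t * x (Suc k) * x k \<le> x (Suc k) * x (Suc k)" using Suc p
      by (simp add: mult.assoc mult.left_commute mult_left_mono)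
    also have "\<dots> \<le> x (Suc (Suc k)) * x k" using conv[of k] by (simp add: power2_eq_square mult.commute)
    finally show ?case using p Suc by (simp add: mult_le_cancel_right)
  qed
  have pow: "x k \<ge> t ^ k * x 0" for k
  proof (induction k)
    case (Suc k)
    have "t ^ Suc k * x 0 = t * (t ^ k * x 0)" by simp
    also have "\<dots> \<le> t * x k" using Suc t by (intro mult_left_mono) auto
    finally show ?case using grow[of k] by simp
  qed simp
  define B where "B = c * (\<Sum>j = 0..<m. \<bar>v $ j\<bar>)"
  have bnd: "\<bar>w k $ i\<bar> \<le> B" if i: "i < m" for i k
  proof -
    have hom: "map_mat complex_of_real (D ^\<^sub>m k) = ?D ^\<^sub>m k" by (rule of_real_hom.mat_hom_pow[OF D(1)])
    have Dk: "D ^\<^sub>m k \<in> carrier_mat m m" using D by simp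
    have ent: "\<bar>(D ^\<^sub>m k) $$ (i,j)\<bar> \<le> c" if j: "j < m" for j
    proof -
      have "cmod (map_mat complex_of_real (D ^\<^sub>m k) $$ (i,j)) \<le> c"
        unfolding hom using c[of k] i j D' unfolding norm_bound_def by simp
      thus ?thesis using i j D by simp
    qed
    have "\<bar>w k $ i\<bar> = \<bar>\<Sum>j = 0..<m. (D ^\<^sub>m k) $$ (i,j) * v $ j\<bar>"
      using i D v Dk by (simp add: w_def scalar_prod_def)
    also have "\<dots> \<le> (\<Sum>j = 0..<m. \<bar>(D ^\<^sub>m k) $$ (i,j) * v $ j\<bar>)" by (rule sum_abs)
    also have "\<dots> \<le> (\<Sum>j = 0..<m. c * \<bar>v $ j\<bar>)"
      using ent by (intro sum_mono) (auto simp: abs_mult intro!: mult_right_mono)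
    finally show ?thesis by (simp add: B_def sum_distrib_left)
  qed
  have upper: "x k \<le> real m * B\<^sup>2" for k
  proof -
    have "x k = (\<Sum>i = 0..<m. (w k $ i)\<^sup>2)" using wc[of k]
      by (simp add: x_def scalar_prod_def power2_eq_square)
    also have "\<dots> \<le> (\<Sum>i = 0..<m. B\<^sup>2)" 
    proof (intro sum_mono)
      fix i assume "i \<in> {0..<m}"
      hence "\<bar>w k $ i\<bar> \<le> \<bar>B\<bar>" using bnd[of i k] by simp
      thus "(w k $ i)\<^sup>2 \<le> B\<^sup>2" by (simp only: abs_le_square_iff)
    qed
    finally show ?thesis by simp
  qed
  obtain k where "real m * B\<^sup>2 / x 0 < t ^ k" using real_arch_pow[OF t] by blast
  hence "real m * B\<^sup>2 < t ^ k * x 0" using x0 by (simp add: field_simps)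
  thus False using pow[of k] upper[of k] by simp
qed

section \<open>The ratio bound\<close>

abbreviation cmat :: "real mat \<Rightarrow> complex mat" where "cmat \<equiv> map_mat complex_of_real"

definition ones :: "nat \<Rightarrow> 'b::one vec" where "ones m = vec m (\<lambda>_. 1)"

lemma ones_carrier [simp]: "ones m \<in> carrier_vec m" by (simp add: ones_def)

lemma cmat_desc_word:
  assumes "\<And>i. i \<in> {1..n} \<Longrightarrow> T i \<in> carrier_mat m m" "k \<le> n"
  shows "desc_word m T k \<in> carrier_mat m m \<and> cmat (desc_word m T k) = desc_word m (\<lambda>i. cmat (T i)) k"
  using assms(2)
proof (induction k)
  case (Suc k)
  thus ?case using assms(1)[of "Suc k"] of_real_hom.mat_hom_mult[of "T (Suc k)" m m "desc_word m T k" m, where 'a = complex] by auto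
qed (auto intro: of_real_hom.mat_hom_one)

lemma cmat_long_word:
  assumes "\<And>i. i \<in> {1..n} \<Longrightarrow> T i \<in> carrier_mat m m" "k \<le> n"
  shows "long_word m T k \<in> carrier_mat m m \<and> cmat (long_word m T k) = long_word m (\<lambda>i. cmat (T i)) k"
  using assms(2)
proof (induction k)
  case (Suc k)
  have "desc_word m T (Suc k) \<in> carrier_mat m m \<and> cmat (desc_word m T (Suc k)) = desc_word m (\<lambda>i. cmat (T i)) (Suc k)"
    using cmat_desc_word[of n T m "Suc k"] assms(1) Suc.prems by simp
  thus ?case using Suc of_real_hom.mat_hom_mult[of "long_word m T k" m m "desc_word m T (Suc k)" m, where 'a = complex]
    by (auto simp del: desc_word.simps)
qed (auto intro: of_real_hom.mat_hom_one)

lemma hecke_generators_cmat: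
  assumes "hecke_generators m n q T"
  shows "hecke_generators m n (complex_of_real q) (\<lambda>i. cmat (T i))"
proof -
  interpret hecke_generators m n q T by fact
  note hm = of_real_hom.mat_hom_mult[where 'a = complex, symmetric]
  show ?thesis
  proof
    fix i assume i: "i \<in> {1..n}"
    show "cmat (T i) \<in> carrier_mat m m" using carrier[OF i] by simp
    have "cmat (T i) * cmat (T i) = cmat (T i * T i)" by (rule hm) (use carrier[OF i] in auto)
    also have "\<dots> = (complex_of_real q - 1) \<cdot>\<^sub>m cmat (T i) + complex_of_real q \<cdot>\<^sub>m 1\<^sub>m m"
      unfolding quadratic[OF i] using carrier[OF i] by (intro eq_matI) auto
    finally show "cmat (T i) * cmat (T i) = (complex_of_real q - 1) \<cdot>\<^sub>m cmat (T i) + complex_of_real q \<cdot>\<^sub>m 1\<^sub>m m" .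
  next
    fix i assume i: "i \<in> {1..<n}"
    hence c: "T i \<in> carrier_mat m m" "T (Suc i) \<in> carrier_mat m m" using carrier by auto
    have 3: "cmat A * cmat B * cmat D = cmat (A * B * D)" 
      if "A \<in> carrier_mat m m" "B \<in> carrier_mat m m" "D \<in> carrier_mat m m" for A B D
      using hm[OF that(1,2)] hm[OF mult_carrier_mat[OF that(1,2)] that(3)] by simp
    show "cmat (T i) * cmat (T (Suc i)) * cmat (T i) = cmat (T (Suc i)) * cmat (T i) * cmat (T (Suc i))"
      unfolding 3[OF c(1,2,1)] 3[OF c(2,1,2)] braid[OF i] ..
  next
    fix i j assume ij: "i \<in> {1..n}" "j \<in> {1..n}" "i + 1 < j"
    show "cmat (T i) * cmat (T j) = cmat (T j) * cmat (T i)"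
      using hm[OF carrier[OF ij(1)] carrier[OF ij(2)]] hm[OF carrier[OF ij(2)] carrier[OF ij(1)]]
        far_commute[OF ij] by simp
  qed
qed

lemma long_word_ones:
  fixes T :: "nat \<Rightarrow> real mat"
  assumes T: "\<And>i. i \<in> {1..n} \<Longrightarrow> T i \<in> carrier_mat m m"
    and one: "\<And>i. i \<in> {1..n} \<Longrightarrow> T i *\<^sub>v ones m = q \<cdot>\<^sub>v ones m"
    and q: "q > 0" and k: "k \<le> n"
  shows "\<exists>\<kappa>>0. long_word m T k *\<^sub>v ones m = \<kappa> \<cdot>\<^sub>v ones m \<and> \<kappa>\<^sup>2 = q ^ (k * (k + 1))"
proof -
  have d: "desc_word m T k *\<^sub>v ones m = q ^ k \<cdot>\<^sub>v ones m" if "k \<le> n" for k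
    using that
  proof (induction k)
    case (Suc k)
    have c: "T (Suc k) \<in> carrier_mat m m" "desc_word m T k \<in> carrier_mat m m"
      using T cmat_desc_word[of n T m k] T Suc.prems by auto
    show ?case using Suc c one[of "Suc k"] 
      by (simp add: assoc_mult_mat_vec[OF c] mult_mat_vec[OF c(1)] smult_smult_assoc mult.commute)
  qed simp
  show ?thesis using k
  proof (induction k)
    case 0
    show ?case by (intro exI[of _ 1]) simp
  next
    case (Suc k)
    then obtain \<kappa> where \<kappa>: "\<kappa> > 0" "long_word m T k *\<^sub>v ones m = \<kappa> \<cdot>\<^sub>v ones m" "\<kappa>\<^sup>2 = q ^ (k * (k + 1))" by auto
    have c: "long_word m T k \<in> carrier_mat m m" "desc_word m T (Suc k) \<in> carrier_mat m m"
      using cmat_long_word[of n T m k] cmat_desc_word[of n T m "Suc k"] T Suc.prems by auto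
    have "long_word m T (Suc k) *\<^sub>v ones m = (q ^ Suc k * \<kappa>) \<cdot>\<^sub>v ones m"
      using c d[OF Suc.prems] \<kappa>(2)
      by (simp add: assoc_mult_mat_vec[OF c] mult_mat_vec[OF c(1)] smult_smult_assoc mult.commute del: desc_word.simps)
    moreover have "Suc k * (Suc k + 1) = Suc k * 2 + k * (k + 1)" by simp
    hence "(q ^ Suc k * \<kappa>)\<^sup>2 = q ^ (Suc k * (Suc k + 1))"
      unfolding power_mult_distrib \<kappa>(3) by (simp only: power_add power_mult)
    ultimately show ?case using \<kappa>(1) q by (intro exI[of _ "q ^ Suc k * \<kappa>"]) auto
  qed
qed

text \<open>
Subtracting \<open>\<kappa> / m\<close> from all entries of \<open>A\<close> gives a symmetric matrix \<open>C\<close> that kills the all-one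
vector and agrees with \<open>A\<close> on its orthogonal complement, so \<open>central_eigenvalue_bound\<close> bounds
all nonzero eigenvalues of \<open>C\<close>. The ratio bound follows by applying the quadratic form of \<open>C\<close> to
the projection \<open>f\<close> of the characteristic vector \<open>x\<close> of \<open>S\<close>: on the one hand it is at least \<open>-\<rho>\<close>
times the squared norm of \<open>f\<close>, on the other hand the form of \<open>A\<close> vanishes at \<open>x\<close>.
\<close>

theorem hecke_coclique_bound:
  fixes T :: "nat \<Rightarrow> real mat" and q :: real
  assumes H: "hecke_generators m n q T" and n: "n \<ge> 1" and q: "q > 1"
    and symT: "\<And>i. i \<in> {1..n} \<Longrightarrow> (T i)\<^sup>T = T i"
    and sym: "\<And>k. k \<le> n \<Longrightarrow> (long_word m T k)\<^sup>T = long_word m T k"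
    and one: "\<And>i. i \<in> {1..n} \<Longrightarrow> T i *\<^sub>v ones m = q \<cdot>\<^sub>v ones m"
    and conn: "\<And>v. v \<in> carrier_vec m \<Longrightarrow> (\<And>i. i \<in> {1..n} \<Longrightarrow> cmat (T i) *\<^sub>v v = complex_of_real q \<cdot>\<^sub>v v)
        \<Longrightarrow> \<exists>c. v = c \<cdot>\<^sub>v ones m"
    and S: "S \<subseteq> {0..<m}" "\<And>i j. i \<in> S \<Longrightarrow> j \<in> S \<Longrightarrow> long_word m T n $$ (i,j) = 0"
  shows "real (card S) \<le> real m / (1 + q powr ((real n + 1) / 2))"
proof (cases "m = 0")
  case True
  thus ?thesis using S by simp
next
  case False
  interpret hecke_generators m n q T by (rule H)
  interpret cx: hecke_generators m n "complex_of_real q" "\<lambda>i. cmat (T i)"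
    by (rule hecke_generators_cmat[OF H])
  define A where "A = long_word m T n"
  have A: "A \<in> carrier_mat m m" "A\<^sup>T = A" using long_word_carrier sym by (auto simp: A_def)
  have cA: "cmat A = long_word m (\<lambda>i. cmat (T i)) n" using cmat_long_word[of n T m n] carrier
    by (simp add: A_def)
  obtain \<kappa> where \<kappa>: "\<kappa> > 0" "A *\<^sub>v ones m = \<kappa> \<cdot>\<^sub>v ones m" "\<kappa>\<^sup>2 = q ^ (n * (n + 1))"
    using long_word_ones[of n T m q n] carrier one q unfolding A_def by auto
  define \<rho> where "\<rho> = sqrt (q ^ ((n - 1) * (n + 1)))"
  have \<rho>: "\<rho> > 0" "\<rho>\<^sup>2 = q ^ ((n - 1) * (n + 1))" using q by (auto simp: \<rho>_def)
  \<comment> \<open>\<open>\<kappa>\<close> is the eigenvalue of \<open>A\<close> at the all-one vector.\<close>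
  define C where "C = A - mat m m (\<lambda>_. \<kappa> / real m)"
  have C: "C \<in> carrier_mat m m" unfolding C_def by (rule minus_carrier_mat) simp
  have "C $$ (j,i) = C $$ (i,j)" if "i < m" "j < m" for i j
    using arg_cong[OF A(2), of "\<lambda>M. M $$ (i,j)"] A(1) that by (simp add: C_def)
  hence CT: "C\<^sup>T = C" using C by (intro eq_matI) auto
  have Cv: "C *\<^sub>v v = A *\<^sub>v v - (\<kappa> / real m * (ones m \<bullet> v)) \<cdot>\<^sub>v ones m" if v: "v \<in> carrier_vec m" for v
    using A v by (intro eq_vecI)
      (auto simp: C_def scalar_prod_def ones_def sum_subtractf left_diff_distrib sum_distrib_left)
  have cCv: "cmat C *\<^sub>v v = cmat A *\<^sub>v v - (complex_of_real (\<kappa> / real m) * (ones m \<bullet> v)) \<cdot>\<^sub>v ones m"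
    if v: "v \<in> carrier_vec m" for v
    using A v by (intro eq_vecI)
      (auto simp: C_def scalar_prod_def ones_def sum_subtractf left_diff_distrib sum_distrib_left)
  have oo: "ones m \<bullet> (ones m :: 'c::comm_ring_1 vec) = of_nat m" for m
    by (simp add: scalar_prod_def ones_def)
  have Cone: "C *\<^sub>v ones m = 0\<^sub>v m"
    unfolding Cv[OF ones_carrier] \<kappa>(2) oo using False by (intro eq_vecI) (auto simp: ones_def)
  have map_ones: "map_vec complex_of_real (ones m) = ones m" by (intro eq_vecI) (auto simp: ones_def)
  have orth_T: "ones m \<bullet> (cmat (T i) *\<^sub>v v) = complex_of_real q * (ones m \<bullet> v)" 
    if i: "i \<in> {1..n}" and v: "v \<in> carrier_vec m" for i v
  proof -
    have "(cmat (T i))\<^sup>T = cmat (T i)" using symT[OF i] by (metis map_mat_transpose)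
    moreover have "cmat (T i) *\<^sub>v ones m = complex_of_real q \<cdot>\<^sub>v ones m"
    proof -
      have "cmat (T i) *\<^sub>v map_vec complex_of_real (ones m) = map_vec complex_of_real (T i *\<^sub>v ones m)"
        by (rule of_real_hom.mult_mat_vec_hom[symmetric, OF carrier[OF i]]) simp
      moreover have "map_vec complex_of_real (q \<cdot>\<^sub>v ones m) = complex_of_real q \<cdot>\<^sub>v ones m"
        by (intro eq_vecI) (auto simp: ones_def)
      ultimately show ?thesis unfolding one[OF i] map_ones by simp
    qed
    ultimately show ?thesis
      using scalar_prod_transpose[OF cx.carrier[OF i] ones_carrier v] v by simp
  qed
  have ev: "cmod \<mu> \<le> \<rho>" if ev': "eigenvalue (cmat C) \<mu>" for \<mu>
  proof (cases "\<mu> = 0")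
    case True
    thus ?thesis using \<rho> by simp
  next
    case \<mu>0: False
    obtain v where v: "v \<in> carrier_vec m" "v \<noteq> 0\<^sub>v m" "cmat C *\<^sub>v v = \<mu> \<cdot>\<^sub>v v"
      using ev' C unfolding eigenvalue_def eigenvector_def by auto
    have cAc: "cmat A \<in> carrier_mat m m" using A by simp
    have orth: "ones m \<bullet> v = 0"
    proof -
      have cC: "cmat C \<in> carrier_mat m m" using C by simp
      have "cmat C *\<^sub>v map_vec complex_of_real (ones m) = map_vec complex_of_real (C *\<^sub>v ones m)"
        by (rule of_real_hom.mult_mat_vec_hom[symmetric, OF C]) simp
      hence "cmat C *\<^sub>v ones m = 0\<^sub>v m" unfolding Cone map_ones by (auto intro!: eq_vecI)
      moreover have "(cmat C)\<^sup>T = cmat C" using CT by (metis map_mat_transpose)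
      ultimately have "ones m \<bullet> (cmat C *\<^sub>v v) = 0"
        using scalar_prod_transpose[OF cC ones_carrier v(1)] v(1) by simp
      thus ?thesis using v \<mu>0 by simp
    qed
    have Av: "cmat A *\<^sub>v v = \<mu> \<cdot>\<^sub>v v" 
    proof -
      have "cmat A *\<^sub>v v - 0 \<cdot>\<^sub>v ones m = cmat A *\<^sub>v v" using cAc
        by (intro eq_vecI) (auto simp: ones_def)
      thus ?thesis using cCv[OF v(1)] v(3) orth by simp
    qed
    \<comment> \<open>\<open>A\<close> itself does not commute with the generators, so \<open>E\<close> is an eigenspace of its square.\<close>
    define E where "E = {u \<in> carrier_vec m. ones m \<bullet> u = 0 \<and> cmat A *\<^sub>v (cmat A *\<^sub>v u) = \<mu>\<^sup>2 \<cdot>\<^sub>v u}"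
    have "cmod (\<mu>\<^sup>2) \<le> q ^ ((n - 1) * (n + 1))"
    proof (rule central_eigenvalue_bound[OF cx.hecke_generators_axioms n q, where E = E])
      show "lin_sub m E"
        unfolding lin_sub_def
      proof (intro conjI ballI allI)
        show "0\<^sub>v m \<in> E"
          using cAc by (auto simp: E_def mult_mat_zero_vec)
      next
        fix u w assume "u \<in> E"
          "w \<in> E"
        thus "u + w \<in> E"
          using cAc by (auto simp: E_def mult_add_distrib_mat_vec[of _ m m] smult_add_distrib_vec[of _ m] scalar_prod_add_distrib[of _ m])
      next
        fix c u assume "u \<in> E"
        thus "c \<cdot>\<^sub>v u \<in> E"
          using cAc by (auto simp: E_def mult_mat_vec[of _ m m] smult_smult_assoc mult.commute)
      qed (auto simp: E_def)
      have "v \<in> E" unfolding E_def using v orth Av cAc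
        by (simp add: mult_mat_vec[of _ m m] smult_smult_assoc power2_eq_square)
      thus "E \<noteq> {0\<^sub>v m}" using v(2) by blast
    next
      fix i u assume i: "i \<in> {1..n}" and u: "u \<in> E"
      have uc: "u \<in> carrier_vec m" and AAu: "(cmat A * cmat A) *\<^sub>v u = \<mu>\<^sup>2 \<cdot>\<^sub>v u" using u cAc
        by (auto simp: E_def)
      have c: "cmat (T i) \<in> carrier_mat m m" "cmat A * cmat A \<in> carrier_mat m m"
        using cx.carrier[OF i] cAc by auto
      have "(cmat A * cmat A) * cmat (T i) = cmat (T i) * (cmat A * cmat A)"
        unfolding cA
      proof (rule cx.long_word_sq_central)
        fix k assume k: "k \<le> n"
        have "cmat (long_word m T k) = long_word m (\<lambda>i. cmat (T i)) k"
          using cmat_long_word[of n T m k] carrier k by simp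
        thus "(long_word m (\<lambda>i. cmat (T i)) k)\<^sup>T = long_word m (\<lambda>i. cmat (T i)) k" using sym[OF k]
          by (metis map_mat_transpose)
      next
        fix j assume "j \<in> {1..n}"
        thus "(cmat (T j))\<^sup>T = cmat (T j)" using symT by (metis map_mat_transpose)
      qed (rule i)
      hence "(cmat A * cmat A) *\<^sub>v (cmat (T i) *\<^sub>v u) = cmat (T i) *\<^sub>v ((cmat A * cmat A) *\<^sub>v u)"
        using assoc_mult_mat_vec[OF c(2,1) uc] assoc_mult_mat_vec[OF c(1,2) uc] by simp
      also have "\<dots> = \<mu>\<^sup>2 \<cdot>\<^sub>v (cmat (T i) *\<^sub>v u)" unfolding AAu by (rule mult_mat_vec[OF c(1) uc])
      finally show "cmat (T i) *\<^sub>v u \<in> E" using orth_T[OF i uc] u c uc cAc by (simp add: E_def)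
    next
      fix u assume "u \<in> E"
      thus "long_word m (\<lambda>i. cmat (T i)) n *\<^sub>v (long_word m (\<lambda>i. cmat (T i)) n *\<^sub>v u) = \<mu>\<^sup>2 \<cdot>\<^sub>v u"
        unfolding E_def cA by simp
    next
      fix u assume u: "u \<in> E" and fx: "\<And>i. i \<in> {1..n} \<Longrightarrow> cmat (T i) *\<^sub>v u = complex_of_real q \<cdot>\<^sub>v u"
      obtain c where c: "u = c \<cdot>\<^sub>v ones m" using conn[OF _ fx] u by (auto simp: E_def)
      have "c * of_nat m = 0" using u unfolding E_def c by (simp add: oo)
      hence "c = 0" using False by simp
      thus "u = 0\<^sub>v m" unfolding c by (intro eq_vecI) (auto simp: ones_def)
    qed
    hence "(cmod \<mu>)\<^sup>2 \<le> \<rho>\<^sup>2" unfolding \<rho>(2) by (simp add: norm_power)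
    thus ?thesis using \<rho>(1) by (simp add: power2_le_iff_abs_le)
  qed
  define s where "s = real (card S)"
  define x :: "real vec" where "x = vec m (\<lambda>i. of_bool (i \<in> S))"
  have x: "x \<in> carrier_vec m" by (simp add: x_def)
  have fin: "finite S" using S finite_subset by blast
  have sumS: "(\<Sum>i = 0..<m. of_bool (i \<in> S) * f i) = (\<Sum>i\<in>S. f i)" for f :: "nat \<Rightarrow> real"
    using S(1) by (intro sum.mono_neutral_cong_right) auto
  have ox: "ones m \<bullet> x = s" using sumS[of "\<lambda>_. 1"] by (simp add: scalar_prod_def ones_def x_def s_def)
  have xx: "x \<bullet> x = s" using sumS[of "\<lambda>i. of_bool (i \<in> S)"] by (simp add: scalar_prod_def x_def s_def)
  have xAx: "x \<bullet> (A *\<^sub>v x) = 0"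
  proof -
    have "(A *\<^sub>v x) $ i = 0" if i: "i \<in> S" for i
    proof -
      have "i < m" using i S(1) by auto
      hence "(A *\<^sub>v x) $ i = (\<Sum>j = 0..<m. of_bool (j \<in> S) * A $$ (i,j))"
        using A(1) by (simp add: scalar_prod_def x_def mult.commute)
      also have "\<dots> = 0" unfolding sumS using S(2)[OF i] by (simp add: A_def)
      finally show ?thesis .
    qed
    hence "(\<Sum>i = 0..<m. of_bool (i \<in> S) * (A *\<^sub>v x) $ i) = 0" unfolding sumS by simp
    thus ?thesis using A(1) x by (simp add: scalar_prod_def x_def)
  qed
  define f where "f = x - (s / real m) \<cdot>\<^sub>v ones m"
  have f: "f \<in> carrier_vec m" using x by (simp add: f_def)
  have xo: "x \<bullet> ones m = s" using comm_scalar_prod[OF x ones_carrier] ox by simp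
  have "(s / real m) \<cdot>\<^sub>v 0\<^sub>v m = (0\<^sub>v m :: real vec)" by (intro eq_vecI) auto
  hence Cf: "C *\<^sub>v f = C *\<^sub>v x"
    unfolding f_def using C x Cone mult_mat_vec_carrier[OF C x]
    by (simp add: mult_minus_distrib_mat_vec mult_mat_vec[OF C])
  have oCx: "ones m \<bullet> (C *\<^sub>v x) = 0"
    using scalar_prod_transpose[OF C ones_carrier x] x by (simp add: CT Cone)
  have "f \<bullet> (C *\<^sub>v f) = x \<bullet> (C *\<^sub>v x)"
    unfolding Cf unfolding f_def using x C oCx by (simp add: minus_scalar_prod_distrib[of _ m])
  also have "\<dots> = - (\<kappa> / real m * s) * s"
    unfolding Cv[OF x] using A x xAx ox xo by (simp add: scalar_prod_minus_distrib[of _ m])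
  finally have fCf: "f \<bullet> (C *\<^sub>v f) = - (\<kappa> / real m * s) * s" .
  have ff: "f \<bullet> f = s - s * s / real m"
    unfolding f_def using x xx ox xo False
    by (simp add: minus_scalar_prod_distrib[of _ m] scalar_prod_minus_distrib[of _ m] oo field_simps)
  have "\<kappa> / real m * s * s \<le> \<rho> * (s - s * s / real m)"
    using symmetric_form_bound[OF C CT \<rho>(1) ev f] unfolding fCf ff by simp
  hence "s * (\<kappa> + \<rho>) * s \<le> \<rho> * real m * s" using False by (simp add: field_simps)
  hence main: "s * (\<kappa> + \<rho>) \<le> \<rho> * real m" 
  proof (cases "s = 0")
    case False
    hence "s > 0" by (simp add: s_def)
    thus ?thesis using \<open>s * (\<kappa> + \<rho>) * s \<le> \<rho> * real m * s\<close> by (simp only: mult_le_cancel_right_pos)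
  qed (use \<rho> in simp)
  define g where "g = q powr ((real n + 1) / 2)"
  have g: "g > 0" "g\<^sup>2 = q ^ (n + 1)"
  proof -
    have "g\<^sup>2 = q powr (real (n + 1))" unfolding g_def power2_eq_square powr_add[symmetric]
      by (simp add: add_divide_distrib add.commute)
    thus "g\<^sup>2 = q ^ (n + 1)" using q by (simp only: powr_realpow)
  qed (use q in \<open>simp add: g_def\<close>)
  have "n * (n + 1) = (n - 1) * (n + 1) + (n + 1)" using n by (cases n) auto
  hence "\<kappa>\<^sup>2 = (\<rho> * g)\<^sup>2" unfolding \<kappa>(3) power_mult_distrib \<rho>(2) g(2) by (simp only: power_add)
  hence "\<kappa> = \<rho> * g" using \<kappa>(1) \<rho>(1) g(1) by (simp add: power2_eq_iff_nonneg)
  hence "\<rho> * (s * (1 + g)) \<le> \<rho> * real m" using main by (simp add: algebra_simps)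
  hence "s * (1 + g) \<le> real m" using \<rho>(1) by simp
  hence "s \<le> real m / (1 + g)" using g(1) pos_le_divide_eq[of "1 + g" s "real m"] by simp
  thus ?thesis by (simp only: s_def g_def)
qed

section \<open>Subspaces over a finite field\<close>

definition vsum :: "'a::field vec set \<Rightarrow> 'a vec set \<Rightarrow> 'a vec set" (infixl "\<uplus>" 65) where
  "U \<uplus> W = (\<lambda>(u, w). u + w) ` (U \<times> W)"

lemma vsumI: "u \<in> U \<Longrightarrow> w \<in> W \<Longrightarrow> u + w \<in> U \<uplus> W"
  unfolding vsum_def by force

lemma vsumE:
  assumes "x \<in> U \<uplus> W"
  obtains u w where "u \<in> U" "w \<in> W" "x = u + w"
  using assms unfolding vsum_def by auto

lemma CARD_field_ge_2: "2 \<le> CARD('a::{field,finite})"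
proof -
  have "card {0::'a, 1} \<le> CARD('a)" by (intro card_mono) auto
  thus ?thesis by simp
qed

lemma card_carrier_vec: "finite (carrier_vec N :: 'a::{field,finite} vec set) \<and> card (carrier_vec N :: 'a vec set) = CARD('a) ^ N"
proof -
  have bij: "bij_betw vec_of_list {xs :: 'a list. set xs \<subseteq> UNIV \<and> length xs = N} (carrier_vec N)"
  proof (rule bij_betw_byWitness[where f' = list_of_vec])
    show "\<forall>xs\<in>{xs :: 'a list. set xs \<subseteq> UNIV \<and> length xs = N}. list_of_vec (vec_of_list xs) = xs"
      by (simp add: list_vec)
    show "\<forall>v\<in>carrier_vec N. vec_of_list (list_of_vec v) = (v :: 'a vec)" by (simp add: vec_list)
    show "vec_of_list ` {xs :: 'a list. set xs \<subseteq> UNIV \<and> length xs = N} \<subseteq> carrier_vec N"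
      by (rule image_subsetI, rule carrier_vecI) simp
    show "list_of_vec ` carrier_vec N \<subseteq> {xs :: 'a list. set xs \<subseteq> UNIV \<and> length xs = N}"
      by (rule image_subsetI) simp
  qed
  have "finite {xs :: 'a list. set xs \<subseteq> UNIV \<and> length xs = N}" by (rule finite_lists_length_eq) simp
  thus ?thesis using bij_betw_finite[OF bij] bij_betw_same_card[OF bij]
      card_lists_length_eq[of "UNIV :: 'a set" N] by simp
qed

lemma lin_sub_carrier: "lin_sub N (carrier_vec N)"
  by (auto simp: lin_sub_def)

lemma lin_sub_zero: "lin_sub N {0\<^sub>v N}"
  by (auto simp: lin_sub_def intro!: eq_vecI)

lemma lin_sub_Int: "lin_sub N U \<Longrightarrow> lin_sub N W \<Longrightarrow> lin_sub N (U \<inter> W)"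
  by (auto simp: lin_sub_def)

lemma lin_sub_vecD: "lin_sub N U \<Longrightarrow> u \<in> U \<Longrightarrow> u \<in> carrier_vec N"
  by (auto simp: lin_sub_def)

lemma lin_sub_zeroD: "lin_sub N U \<Longrightarrow> 0\<^sub>v N \<in> U"
  by (auto simp: lin_sub_def)

lemma lin_sub_add: "lin_sub N U \<Longrightarrow> u \<in> U \<Longrightarrow> v \<in> U \<Longrightarrow> u + v \<in> U"
  by (auto simp: lin_sub_def)

lemma lin_sub_smult: "lin_sub N U \<Longrightarrow> u \<in> U \<Longrightarrow> c \<cdot>\<^sub>v u \<in> U"
  by (auto simp: lin_sub_def)

lemma lin_sub_diff:
  assumes "lin_sub N U" "u \<in> U" "v \<in> U"
  shows "u - v \<in> U"
proof -
  have c: "u \<in> carrier_vec N" "v \<in> carrier_vec N" using assms lin_sub_vecD by blast+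
  have "u - v = u + (-1) \<cdot>\<^sub>v v" using c by (intro eq_vecI) auto
  thus ?thesis using assms lin_sub_add lin_sub_smult by metis
qed

lemma lin_sub_finite: "lin_sub N (U :: 'a::{field,finite} vec set) \<Longrightarrow> finite U"
  using card_carrier_vec[where 'a = 'a and N = N] finite_subset[of U "carrier_vec N"]
    by (simp add: lin_sub_def)

lemma lin_sub_vsum:
  assumes U: "lin_sub N U" and W: "lin_sub N W"
  shows "lin_sub N (U \<uplus> W)"
  unfolding lin_sub_def
proof (intro conjI ballI allI)
  show "U \<uplus> W \<subseteq> carrier_vec N" using U W
    by (auto elim!: vsumE intro!: add_carrier_vec dest: lin_sub_vecD)
  have "0\<^sub>v N = 0\<^sub>v N + (0\<^sub>v N :: 'a vec)" by simp
  thus "0\<^sub>v N \<in> U \<uplus> W" using vsumI[OF lin_sub_zeroD[OF U] lin_sub_zeroD[OF W]] by simp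
next
  fix x y assume "x \<in> U \<uplus> W" "y \<in> U \<uplus> W"
  then obtain u w u' w' where x: "x = u + w" "u \<in> U" "w \<in> W" and y: "y = u' + w'" "u' \<in> U" "w' \<in> W"
    unfolding vsum_def by auto
  have c: "u \<in> carrier_vec N" "w \<in> carrier_vec N" "u' \<in> carrier_vec N" "w' \<in> carrier_vec N"
    using x y U W lin_sub_vecD by auto
  have "x + y = (u + u') + (w + w')" unfolding x y using c by (intro eq_vecI) auto
  moreover have "u + u' \<in> U" "w + w' \<in> W" using x y U W lin_sub_add by auto
  ultimately show "x + y \<in> U \<uplus> W" by (metis vsumI)
next
  fix a x assume "x \<in> U \<uplus> W"
  then obtain u w where x: "x = u + w" "u \<in> U" "w \<in> W" unfolding vsum_def by auto
  have c: "u \<in> carrier_vec N" "w \<in> carrier_vec N" using x U W lin_sub_vecD by auto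
  have "a \<cdot>\<^sub>v x = a \<cdot>\<^sub>v u + a \<cdot>\<^sub>v w" unfolding x using c by (simp add: smult_add_distrib_vec)
  moreover have "a \<cdot>\<^sub>v u \<in> U" "a \<cdot>\<^sub>v w \<in> W" using x U W lin_sub_smult by auto
  ultimately show "a \<cdot>\<^sub>v x \<in> U \<uplus> W" by (metis vsumI)
qed

lemma vsum_upper1:
  assumes "lin_sub N U" "lin_sub N W"
  shows "U \<subseteq> U \<uplus> W"
proof
  fix u assume u: "u \<in> U"
  have "u + 0\<^sub>v N \<in> U \<uplus> W" by (rule vsumI[OF u lin_sub_zeroD[OF assms(2)]])
  thus "u \<in> U \<uplus> W" using lin_sub_vecD[OF assms(1) u] by simp
qed

lemma vsum_upper2:
  assumes "lin_sub N U" "lin_sub N W"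
  shows "W \<subseteq> U \<uplus> W"
proof
  fix w assume w: "w \<in> W"
  have "0\<^sub>v N + w \<in> U \<uplus> W" by (rule vsumI[OF lin_sub_zeroD[OF assms(1)] w])
  thus "w \<in> U \<uplus> W" using lin_sub_vecD[OF assms(2) w] by simp
qed

lemma vsum_least:
  assumes "lin_sub N S" "U \<subseteq> S" "W \<subseteq> S"
  shows "U \<uplus> W \<subseteq> S"
proof
  fix x assume "x \<in> U \<uplus> W"
  then obtain u w where "u \<in> U" "w \<in> W" "x = u + w" by (rule vsumE)
  thus "x \<in> S" using lin_sub_add[OF assms(1)] assms(2,3) by auto
qed

text \<open>
The fibres of the addition map on \<open>U \<times> W\<close> are translates of \<open>U \<inter> W\<close>, embedded by \<open>t \<mapsto> (t, -t)\<close>.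
\<close>

lemma card_vsum:
  fixes U W :: "'a::{field,finite} vec set"
  assumes U: "lin_sub N U" and W: "lin_sub N W"
  shows "card (U \<uplus> W) * card (U \<inter> W) = card U * card W"
proof -
  define add :: "'a vec \<times> 'a vec \<Rightarrow> 'a vec" where "add = (\<lambda>(u, w). u + w)"
  have fin: "finite U" "finite W" using lin_sub_finite U W by auto
  have fib: "card {p \<in> U \<times> W. add p = x} = card (U \<inter> W)" if xx: "x \<in> add ` (U \<times> W)" for x
  proof -
    obtain u w where uw: "u \<in> U" "w \<in> W" "x = u + w" using xx by (auto simp: add_def)
    have c: "u \<in> carrier_vec N" "w \<in> carrier_vec N" using uw U W lin_sub_vecD by auto
    have "bij_betw (\<lambda>t. (u + t, w - t)) (U \<inter> W) {p \<in> U \<times> W. add p = x}"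
    proof (rule bij_betw_byWitness[where f' = "\<lambda>p. fst p - u"])
      show "\<forall>t\<in>U \<inter> W. fst (u + t, w - t) - u = t"
        using c U by (auto intro!: eq_vecI dest: lin_sub_vecD)
      show "\<forall>p\<in>{p \<in> U \<times> W. add p = x}. (u + (fst p - u), w - (fst p - u)) = p"
      proof
        fix p assume "p \<in> {p \<in> U \<times> W. add p = x}"
        then obtain a b where p: "p = (a, b)" "a \<in> U" "b \<in> W" "a + b = u + w" using uw(3)
          by (auto simp: add_def)
        have ab: "a \<in> carrier_vec N" "b \<in> carrier_vec N" using p U W lin_sub_vecD by auto
        have e: "a $ i + b $ i = u $ i + w $ i" if "i < N" for i
          using arg_cong[OF p(4), of "\<lambda>v. v $ i"] ab c that by simp
        have "u + (a - u) = a" using ab c by (intro eq_vecI) auto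
        moreover have "w - (a - u) = b" using ab c e by (intro eq_vecI) (auto simp: algebra_simps)
        ultimately show "(u + (fst p - u), w - (fst p - u)) = p" by (simp add: p)
      qed
      show "(\<lambda>t. (u + t, w - t)) ` (U \<inter> W) \<subseteq> {p \<in> U \<times> W. add p = x}"
      proof
        fix p assume "p \<in> (\<lambda>t. (u + t, w - t)) ` (U \<inter> W)"
        then obtain t where t: "t \<in> U" "t \<in> W" "p = (u + t, w - t)" by auto
        have "t \<in> carrier_vec N" using t U lin_sub_vecD by auto
        hence "(u + t) + (w - t) = u + w" using c by (intro eq_vecI) auto
        thus "p \<in> {p \<in> U \<times> W. add p = x}"
          using t uw U W lin_sub_add lin_sub_diff by (auto simp: add_def)
      qed
      show "(\<lambda>p. fst p - u) ` {p \<in> U \<times> W. add p = x} \<subseteq> U \<inter> W"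
      proof
        fix t assume "t \<in> (\<lambda>p. fst p - u) ` {p \<in> U \<times> W. add p = x}"
        then obtain a b where p: "t = a - u" "a \<in> U" "b \<in> W" "a + b = u + w" using uw(3)
          by (auto simp: add_def)
        have ab: "a \<in> carrier_vec N" "b \<in> carrier_vec N" using p U W lin_sub_vecD by auto
        have e: "a $ i + b $ i = u $ i + w $ i" if "i < N" for i
          using arg_cong[OF p(4), of "\<lambda>v. v $ i"] ab c that by simp
        have "t = w - b" unfolding p using ab c e by (intro eq_vecI) (auto simp: algebra_simps)
        moreover have "w - b \<in> W" by (rule lin_sub_diff[OF W uw(2) p(3)])
        moreover have "a - u \<in> U" by (rule lin_sub_diff[OF U p(2) uw(1)])
        ultimately show "t \<in> U \<inter> W" using p(1) by simp
      qed
    qed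
    from bij_betw_same_card[OF this] show ?thesis by simp
  qed
  have "card (U \<times> W) = (\<Sum>x\<in>add ` (U \<times> W). card {p \<in> U \<times> W. add p = x})"
    using fin sum.group[of "U \<times> W" "add ` (U \<times> W)" add "\<lambda>_. 1 :: nat"]
    by (simp only: card_eq_sum finite_SigmaI finite_imageI subset_refl)
  also have "\<dots> = card (U \<uplus> W) * card (U \<inter> W)" using fib by (simp add: vsum_def add_def)
  finally show ?thesis using fin by (simp add: card_cartesian_product)
qed

text \<open>
Over a finite field the number of vectors determines the dimension. In this form the dimension
formula and the counting of subspaces need no bases.
\<close>

definition sdim :: "'a::{field,finite} vec set \<Rightarrow> nat" where
  "sdim U = (SOME k. card U = CARD('a) ^ k)"

lemma sdim_eqI: "card (U :: 'a::{field,finite} vec set) = CARD('a) ^ k \<Longrightarrow> sdim U = k"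
proof -
  assume a: "card U = CARD('a) ^ k"
  hence "card U = CARD('a) ^ sdim U" unfolding sdim_def by (rule someI)
  hence "CARD('a) ^ k = CARD('a) ^ sdim U" using a by simp
  thus "sdim U = k" using CARD_field_ge_2[where 'a = 'a] by simp
qed

lemma lin_sub_extend:
  fixes U :: "'a::{field,finite} vec set"
  assumes U: "lin_sub N U" and z: "z \<in> carrier_vec N" "z \<notin> U"
  defines "L \<equiv> range (\<lambda>c. c \<cdot>\<^sub>v z)"
  shows "lin_sub N (U \<uplus> L)" "card (U \<uplus> L) = CARD('a) * card U" "U \<subseteq> U \<uplus> L"
    "lin_sub N S \<Longrightarrow> U \<subseteq> S \<Longrightarrow> z \<in> S \<Longrightarrow> U \<uplus> L \<subseteq> S"
proof -
  have L: "lin_sub N L"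
    unfolding lin_sub_def
  proof (intro conjI ballI allI)
    show "L \<subseteq> carrier_vec N" using z by (auto simp: L_def)
    have "0\<^sub>v N = 0 \<cdot>\<^sub>v z" using z by (intro eq_vecI) auto
    thus "0\<^sub>v N \<in> L" unfolding L_def by blast
  next
    fix u v assume "u \<in> L" "v \<in> L"
    then obtain a b where "u = a \<cdot>\<^sub>v z" "v = b \<cdot>\<^sub>v z" by (auto simp: L_def)
    hence "u + v = (a + b) \<cdot>\<^sub>v z" using z by (simp add: add_smult_distrib_vec)
    thus "u + v \<in> L" unfolding L_def by blast
  qed (auto simp: L_def smult_smult_assoc)
  show "lin_sub N (U \<uplus> L)" by (rule lin_sub_vsum[OF U L])
  show "U \<subseteq> U \<uplus> L" by (rule vsum_upper1[OF U L])
  show "lin_sub N S \<Longrightarrow> U \<subseteq> S \<Longrightarrow> z \<in> S \<Longrightarrow> U \<uplus> L \<subseteq> S"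
    using lin_sub_smult unfolding L_def by (intro vsum_least) auto
  have cz: "c \<cdot>\<^sub>v z \<in> U \<Longrightarrow> c = 0" for c
  proof (rule ccontr)
    assume c: "c \<cdot>\<^sub>v z \<in> U" "c \<noteq> 0"
    hence "inverse c \<cdot>\<^sub>v (c \<cdot>\<^sub>v z) \<in> U" using lin_sub_smult[OF U] by blast
    thus False using c z by (simp add: smult_smult_assoc)
  qed
  have "inj (\<lambda>c. c \<cdot>\<^sub>v z)"
  proof (rule injI)
    fix a b assume "a \<cdot>\<^sub>v z = b \<cdot>\<^sub>v z"
    moreover have "(a - b) \<cdot>\<^sub>v z = a \<cdot>\<^sub>v z - b \<cdot>\<^sub>v z" by (intro eq_vecI) (auto simp: left_diff_distrib)
    ultimately have "(a - b) \<cdot>\<^sub>v z = 0\<^sub>v N" using z by simp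
    hence "(a - b) \<cdot>\<^sub>v z \<in> U" using lin_sub_zeroD[OF U] by simp
    thus "a = b" using cz[of "a - b"] by simp
  qed
  hence "card L = CARD('a)" unfolding L_def by (rule card_image)
  moreover have "U \<inter> L = {0\<^sub>v N}"
  proof
    have "c \<cdot>\<^sub>v z = 0\<^sub>v N" if "c \<cdot>\<^sub>v z \<in> U" for c using cz[OF that] z by (auto intro!: eq_vecI)
    thus "U \<inter> L \<subseteq> {0\<^sub>v N}" unfolding L_def by auto
  qed (use lin_sub_zeroD U L in auto)
  ultimately show "card (U \<uplus> L) = CARD('a) * card U" using card_vsum[OF U L] by (simp add: mult.commute)
qed

text \<open>
Take a longest chain in \<open>U\<close> that starts with the zero space and whose members have \<open>1, q, q\<^sup>2,
\<dots>\<close> elements. It ends with \<open>U\<close>, as otherwise one more vector extends it. So the number of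
elements of \<open>U\<close> is a power of \<open>q\<close>, and the chain is a full flag of \<open>U\<close>.
\<close>

lemma lin_sub_full_chain:
  fixes U :: "'a::{field,finite} vec set"
  assumes U: "lin_sub N U"
  obtains k F where "F 0 = {0\<^sub>v N}" "F k = U" "\<And>i. i \<le> k \<Longrightarrow> lin_sub N (F i)"
    "\<And>i. i \<le> k \<Longrightarrow> card (F i) = CARD('a) ^ i" "\<And>i. i < k \<Longrightarrow> F i \<subseteq> F (Suc i)"
proof -
  define ok :: "nat \<Rightarrow> (nat \<Rightarrow> 'a vec set) \<Rightarrow> bool" where
    "ok k F \<longleftrightarrow> F 0 = {0\<^sub>v N} \<and> (\<forall>i\<le>k. lin_sub N (F i) \<and> card (F i) = CARD('a) ^ i \<and> F i \<subseteq> U) \<and> (\<forall>i<k. F i \<subseteq> F (Suc i))" for k F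
  define K where "K = {k. \<exists>F. ok k F}"
  have "k \<le> card U" if "k \<in> K" for k
  proof -
    obtain F where "ok k F" using \<open>k \<in> K\<close> K_def by auto
    hence "CARD('a) ^ k \<le> card U" using card_mono[OF lin_sub_finite[OF U], of "F k"]
      by (auto simp: ok_def)
    moreover have "k < CARD('a) ^ k" using CARD_field_ge_2[where 'a = 'a] by (intro power_gt_expt) auto
    ultimately show ?thesis by simp
  qed
  hence fin: "finite K" by (meson finite_nat_set_iff_bounded_le)
  have "ok 0 (\<lambda>_. {0\<^sub>v N})" using lin_sub_zeroD[OF U] lin_sub_zero by (auto simp: ok_def)
  hence "Max K \<in> K" using fin by (intro Max_in) (auto simp: K_def)
  then obtain F where F: "ok (Max K) F" by (auto simp: K_def)
  define k where "k = Max K"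
  have "F k = U"
  proof (rule ccontr)
    assume "F k \<noteq> U"
    then obtain z where z: "z \<in> U" "z \<notin> F k" using F by (auto simp: ok_def k_def)
    define W where "W = F k \<uplus> range (\<lambda>c. c \<cdot>\<^sub>v z)"
    have Fk: "lin_sub N (F k)" "card (F k) = CARD('a) ^ k" "F k \<subseteq> U" using F by (auto simp: ok_def k_def)
    note W = lin_sub_extend[OF Fk(1) lin_sub_vecD[OF U z(1)] z(2), folded W_def]
    have "ok (Suc k) (F(Suc k := W))"
      using F W(1,2,3) W(4)[OF U Fk(3) z(1)] Fk(2) unfolding ok_def k_def[symmetric]
      by (auto simp: le_Suc_eq less_Suc_eq)
    hence "Suc k \<in> K" by (auto simp: K_def)
    thus False using Max_ge[OF fin, of "Suc k"] by (simp add: k_def)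
  qed
  thus ?thesis using that[of F k] F by (auto simp: ok_def k_def)
qed

lemma card_lin_sub: "lin_sub N (U :: 'a::{field,finite} vec set) \<Longrightarrow> card U = CARD('a) ^ sdim U"
proof -
  assume U: "lin_sub N U"
  obtain k F where "F k = U" "card (F k) = CARD('a) ^ k" by (rule lin_sub_full_chain[OF U]) auto
  hence "card U = CARD('a) ^ k" by simp
  thus ?thesis using sdim_eqI by metis
qed

lemma sdim_mono:
  fixes U W :: "'a::{field,finite} vec set"
  assumes "lin_sub N U" "lin_sub N W" "U \<subseteq> W"
  shows "sdim U \<le> sdim W"
proof -
  have "CARD('a) ^ sdim U \<le> CARD('a) ^ sdim W"
    using card_mono[OF lin_sub_finite[OF assms(2)] assms(3)] card_lin_sub assms by metis
  thus ?thesis using CARD_field_ge_2[where 'a = 'a] by (simp add: power_increasing_iff)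
qed

lemma sdim_eq_imp_eq:
  fixes U W :: "'a::{field,finite} vec set"
  assumes "lin_sub N U" "lin_sub N W" "U \<subseteq> W" "sdim U = sdim W"
  shows "U = W"
  using card_subset_eq[OF lin_sub_finite[OF assms(2)] assms(3)] card_lin_sub assms by metis

lemma sdim_strict_mono:
  fixes U W :: "'a::{field,finite} vec set"
  assumes "lin_sub N U" "lin_sub N W" "U \<subseteq> W" "U \<noteq> W"
  shows "sdim U < sdim W"
  using sdim_mono[OF assms(1-3)] sdim_eq_imp_eq[OF assms(1-3)] assms(4) by fastforce

lemma sdim_vsum:
  fixes U W :: "'a::{field,finite} vec set"
  assumes "lin_sub N U" "lin_sub N W"
  shows "sdim (U \<uplus> W) + sdim (U \<inter> W) = sdim U + sdim W"
proof -
  have "CARD('a) ^ (sdim (U \<uplus> W) + sdim (U \<inter> W)) = CARD('a) ^ (sdim U + sdim W)"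
    unfolding power_add using card_vsum[OF assms] card_lin_sub[OF lin_sub_vsum[OF assms]]
      card_lin_sub[OF lin_sub_Int[OF assms]] card_lin_sub[OF assms(1)] card_lin_sub[OF assms(2)] by simp
  thus ?thesis using CARD_field_ge_2[where 'a = 'a] by (simp add: power_inject_exp)
qed

lemma sdim_zero: "sdim {0\<^sub>v N :: 'a::{field,finite} vec} = 0"
  by (rule sdim_eqI) simp

lemma sdim_carrier: "sdim (carrier_vec N :: 'a::{field,finite} vec set) = N"
  using card_carrier_vec by (intro sdim_eqI) blast

lemma sdim_0D:
  fixes U :: "'a::{field,finite} vec set"
  assumes "lin_sub N U" "sdim U = 0"
  shows "U = {0\<^sub>v N}"
  using sdim_eq_imp_eq[OF lin_sub_zero assms(1)] lin_sub_zeroD[OF assms(1)] assms(2)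
    sdim_zero[where 'a = 'a and N = N] by auto

text \<open>
Two distinct points of a residue of rank two span a line.
\<close>

lemma distinct_over_common:
  fixes U W A :: "'a::{field,finite} vec set"
  assumes U: "lin_sub N U" "sdim U = k" and W: "lin_sub N W" "sdim W = k" and "U \<noteq> W"
    and A: "lin_sub N A" "A \<subseteq> U" "A \<subseteq> W" "Suc (sdim A) = k"
  shows "U \<inter> W = A" "sdim (U \<uplus> W) = Suc k"
proof -
  have I: "lin_sub N (U \<inter> W)" by (rule lin_sub_Int[OF U(1) W(1)])
  have "U \<inter> W \<noteq> U"
  proof
    assume "U \<inter> W = U"
    hence "U \<subseteq> W" by blast
    thus False using sdim_eq_imp_eq[OF U(1) W(1)] U W \<open>U \<noteq> W\<close> by simp
  qed
  hence "sdim (U \<inter> W) < k" using sdim_strict_mono[OF I U(1)] U by auto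
  moreover have "sdim A \<le> sdim (U \<inter> W)" using sdim_mono[OF A(1) I] A by auto
  ultimately have d: "sdim A = sdim (U \<inter> W)" using A by simp
  show "U \<inter> W = A" using sdim_eq_imp_eq[OF A(1) I _ d] A by auto
  show "sdim (U \<uplus> W) = Suc k" using sdim_vsum[OF U(1) W(1)] d A U W by simp
qed

text \<open>
Two distinct lines of a residue of rank two meet in a point.
\<close>

lemma distinct_in_common:
  fixes U W S :: "'a::{field,finite} vec set"
  assumes U: "lin_sub N U" "sdim U = k" and W: "lin_sub N W" "sdim W = k" and "U \<noteq> W"
    and S: "lin_sub N S" "U \<subseteq> S" "W \<subseteq> S" "sdim S = Suc k"
  shows "Suc (sdim (U \<inter> W)) = k" "U \<uplus> W = S"
proof -
  have V: "lin_sub N (U \<uplus> W)" by (rule lin_sub_vsum[OF U(1) W(1)])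
  have "U \<noteq> U \<uplus> W"
  proof
    assume "U = U \<uplus> W"
    hence "W \<subseteq> U" using vsum_upper2[OF U(1) W(1)] by simp
    thus False using sdim_eq_imp_eq[OF W(1) U(1)] U W \<open>U \<noteq> W\<close> by simp
  qed
  hence "k < sdim (U \<uplus> W)" using sdim_strict_mono[OF U(1) V vsum_upper1[OF U(1) W(1)]] U by auto
  moreover have "sdim (U \<uplus> W) \<le> sdim S" using sdim_mono[OF V S(1) vsum_least[OF S(1-3)]] .
  ultimately have d: "sdim (U \<uplus> W) = sdim S" using S by simp
  show "U \<uplus> W = S" by (rule sdim_eq_imp_eq[OF V S(1) vsum_least[OF S(1-3)] d])
  show "Suc (sdim (U \<inter> W)) = k" using sdim_vsum[OF U(1) W(1)] d S U W by simp
qed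

lemma finite_lin_subs: "finite {W :: 'a::{field,finite} vec set. lin_sub N W \<and> P W}"
proof (rule finite_subset)
  show "{W :: 'a vec set. lin_sub N W \<and> P W} \<subseteq> Pow (carrier_vec N)" by (auto simp: lin_sub_def)
qed (use card_carrier_vec in blast)

text \<open>
The differences \<open>W - A\<close> partition \<open>S - A\<close>.
\<close>

lemma card_covers_between:
  fixes A S :: "'a::{field,finite} vec set"
  assumes A: "lin_sub N A" and S: "lin_sub N S" and AS: "A \<subseteq> S"
  defines "q \<equiv> CARD('a)" and "a \<equiv> sdim A"
  shows "card {W. lin_sub N W \<and> A \<subseteq> W \<and> W \<subseteq> S \<and> sdim W = Suc a} * (q ^ Suc a - q ^ a) = q ^ sdim S - q ^ a"
proof -
  define B where "B = {W. lin_sub N W \<and> A \<subseteq> W \<and> W \<subseteq> S \<and> sdim W = Suc a}"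
  have finS: "finite S" "finite A" using lin_sub_finite A S by auto
  have finB: "finite B" unfolding B_def by (rule finite_lin_subs)
  have cW: "card (W - A) = q ^ Suc a - q ^ a" if "W \<in> B" for W
  proof -
    have W: "lin_sub N W" "A \<subseteq> W" "sdim W = Suc a" using that by (auto simp: B_def)
    show ?thesis using card_Diff_subset[OF finS(2) W(2)] card_lin_sub[OF W(1)] card_lin_sub[OF A] W(3)
      by (simp add: q_def a_def)
  qed
  have "S - A = (\<Union>W\<in>B. W - A)"
  proof
    show "S - A \<subseteq> (\<Union>W\<in>B. W - A)"
    proof
      fix z assume z: "z \<in> S - A"
      define W where "W = A \<uplus> range (\<lambda>c. c \<cdot>\<^sub>v z)"
      note W = lin_sub_extend[OF A lin_sub_vecD[OF S, of z], folded W_def]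
      have "card W = q ^ Suc a" using W(2) z card_lin_sub[OF A] by (simp add: q_def a_def)
      hence "sdim W = Suc a" unfolding q_def by (rule sdim_eqI)
      hence "W \<in> B" using W(1,3) W(4)[OF _ _ S AS] z by (auto simp: B_def)
      moreover have "z \<in> W"
      proof -
        have zc: "z \<in> carrier_vec N" using z lin_sub_vecD[OF S] by blast
        have "0\<^sub>v N + 1 \<cdot>\<^sub>v z \<in> W" unfolding W_def by (intro vsumI lin_sub_zeroD[OF A] rangeI)
        thus ?thesis using zc by simp
      qed
      ultimately show "z \<in> (\<Union>W\<in>B. W - A)" using z by blast
    qed
  qed (auto simp: B_def)
  also have "card \<dots> = (\<Sum>W\<in>B. card (W - A))"
  proof (rule card_UN_disjoint[OF finB])
    show "\<forall>W\<in>B. finite (W - A)" using finS by (auto simp: B_def intro: finite_subset)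
    show "\<forall>U\<in>B. \<forall>W\<in>B. U \<noteq> W \<longrightarrow> (U - A) \<inter> (W - A) = {}"
    proof (intro ballI impI)
      fix U W assume UW: "U \<in> B" "W \<in> B" "U \<noteq> W"
      have "U \<inter> W = A"
        by (rule distinct_over_common(1)[of N U "Suc a" W A])
          (use UW(1,2) in \<open>simp_all only: B_def a_def mem_Collect_eq A UW(3) not_False_eq_True\<close>)
      thus "(U - A) \<inter> (W - A) = {}" by blast
    qed
  qed
  also have "\<dots> = card B * (q ^ Suc a - q ^ a)" using cW by simp
  finally have "card (S - A) = card B * (q ^ Suc a - q ^ a)" .
  moreover have "card (S - A) = q ^ sdim S - q ^ a"
    using card_Diff_subset[OF finS(2) AS] card_lin_sub[OF S] card_lin_sub[OF A]
      by (simp add: q_def a_def)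
  ultimately show ?thesis by (simp add: B_def)
qed

lemma card_panel:
  fixes A S :: "'a::{field,finite} vec set"
  assumes A: "lin_sub N A" and S: "lin_sub N S" and AS: "A \<subseteq> S" and d: "sdim S = Suc (Suc (sdim A))"
  shows "card {W. lin_sub N W \<and> A \<subseteq> W \<and> W \<subseteq> S \<and> sdim W = Suc (sdim A)} = CARD('a) + 1"
proof -
  define q where "q = CARD('a)"
  define a where "a = sdim A"
  have q: "q \<ge> 2" using CARD_field_ge_2[where 'a = 'a] by (simp add: q_def)
  define c where "c = card {W. lin_sub N W \<and> A \<subseteq> W \<and> W \<subseteq> S \<and> sdim W = Suc a}"
  have "c * (q ^ Suc a - q ^ a) = q ^ Suc (Suc a) - q ^ a"
    using card_covers_between[OF A S AS] d by (simp add: q_def a_def c_def)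
  also have "q ^ Suc (Suc a) - q ^ a = (q + 1) * (q ^ Suc a - q ^ a)"
    using q by (simp add: algebra_simps)
  finally have "c * (q ^ Suc a - q ^ a) = (q + 1) * (q ^ Suc a - q ^ a)" .
  moreover have "q ^ a < q ^ Suc a" using q by (intro power_strict_increasing) auto
  ultimately have "c = q + 1" by (metis mult_cancel2 zero_less_diff less_numeral_extra(3))
  thus ?thesis by (simp add: c_def a_def q_def)
qed

section \<open>Counting maximal flags\<close>

text \<open>
The subspaces of dimension at most \<open>k\<close> of a flag, indexed by dimension. The function also takes
the value zero space at \<open>0\<close> and is constantly the whole space beyond \<open>k\<close>: flags are then equal
iff the functions are, and the two neighbours of each member of a maximal flag exist.
\<close>

definition partial_flags :: "nat \<Rightarrow> nat \<Rightarrow> (nat \<Rightarrow> 'a::{field,finite} vec set) set" where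
  "partial_flags n k = {U. U 0 = {0\<^sub>v (n + 1)} \<and> (\<forall>i\<le>k. lin_sub (n + 1) (U i) \<and> sdim (U i) = i) \<and>
     (\<forall>i<k. U i \<subseteq> U (Suc i)) \<and> (\<forall>i>k. U i = carrier_vec (n + 1))}"

abbreviation flags :: "nat \<Rightarrow> (nat \<Rightarrow> 'a::{field,finite} vec set) set" where
  "flags n \<equiv> partial_flags n n"

lemma flag_0: "U \<in> flags n \<Longrightarrow> U 0 = {0\<^sub>v (n + 1)}"
  by (simp add: partial_flags_def)

lemma flag_top: "U \<in> flags n \<Longrightarrow> n < i \<Longrightarrow> U i = carrier_vec (n + 1)"
  by (simp add: partial_flags_def)

lemma flag_lin_sub: "U \<in> flags n \<Longrightarrow> lin_sub (n + 1) (U i)"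
  by (cases "i \<le> n") (auto simp: partial_flags_def lin_sub_carrier)

lemma flag_dim: "U \<in> flags n \<Longrightarrow> i \<le> n + 1 \<Longrightarrow> sdim (U i) = i"
  using sdim_carrier[where 'a = 'a and N = "n + 1"]
    by (cases "i \<le> n") (auto simp: partial_flags_def le_Suc_eq)

lemma flag_Suc:
  assumes "U \<in> flags n"
  shows "U i \<subseteq> U (Suc i)"
proof (cases "i < n")
  case False
  hence "U (Suc i) = carrier_vec (n + 1)" using assms by (intro flag_top) auto
  thus ?thesis using flag_lin_sub[OF assms, of i] by (simp add: lin_sub_def)
qed (use assms in \<open>simp add: partial_flags_def\<close>)

lemma flag_mono: "U \<in> flags n \<Longrightarrow> i \<le> j \<Longrightarrow> U i \<subseteq> U j"
  by (rule lift_Suc_mono_le[of U, OF flag_Suc])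

lemma flagI:
  assumes "U 0 = {0\<^sub>v (n + 1)}" "\<And>i. i \<in> {1..n} \<Longrightarrow> lin_sub (n + 1) (U i)" "\<And>i. i \<in> {1..n} \<Longrightarrow> sdim (U i) = i"
    "\<And>i. i \<in> {1..<n} \<Longrightarrow> U i \<subseteq> U (Suc i)" "\<And>i. i > n \<Longrightarrow> U i = carrier_vec (n + 1)"
  shows "U \<in> flags n"
proof -
  have "lin_sub (n + 1) (U i) \<and> sdim (U i) = i" if "i \<le> n" for i
    using that assms(1-3) lin_sub_zero sdim_zero by (cases "i = 0") auto
  moreover have "U i \<subseteq> U (Suc i)" if "i < n" for i
    using that assms(1,4) lin_sub_zeroD[OF assms(2)[of 1]] by (cases "i = 0") auto
  ultimately show ?thesis using assms(1,5) by (simp add: partial_flags_def)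
qed

lemma flag_eqI:
  assumes "U \<in> flags n" "V \<in> flags n" "\<And>i. i \<in> {1..n} \<Longrightarrow> U i = V i"
  shows "U = V"
proof
  fix i
  consider "i = 0" | "i \<in> {1..n}" | "i > n" by fastforce
  thus "U i = V i"
    by cases (simp_all add: assms(3) flag_0[OF assms(1)] flag_0[OF assms(2)] flag_top[OF assms(1)] flag_top[OF assms(2)])
qed

lemma flag_update:
  assumes U: "U \<in> flags n" and i: "i \<in> {1..n}" and W: "lin_sub (n + 1) W" "sdim W = i"
    and le: "U (i - 1) \<subseteq> W" "W \<subseteq> U (Suc i)"
  shows "U(i := W) \<in> flags n"
proof (rule flagI)
  fix j
  have "Suc j = i \<Longrightarrow> U j \<subseteq> W" using le(1) by auto
  thus "(U(i := W)) j \<subseteq> (U(i := W)) (Suc j)" using flag_Suc[OF U, of j] le(2) by auto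
qed (use i W flag_0[OF U] flag_lin_sub[OF U] flag_dim[OF U] flag_top[OF U] in auto)

text \<open>
A partial flag is continued by a subspace of dimension \<open>k + 1\<close> over its last member. By
\<open>card_covers_between\<close> there are \<open>(q\<^bsup>n+1\<^esup> - q\<^sup>k) / (q\<^bsup>k+1\<^esup> - q\<^sup>k)\<close> of them, which is a Gaussian
number.
\<close>

lemma card_partial_flags_Suc:
  assumes k: "k < n" and fin: "finite (partial_flags n k :: (nat \<Rightarrow> 'a::{field,finite} vec set) set)"
  shows "finite (partial_flags n (Suc k) :: (nat \<Rightarrow> 'a vec set) set)"
    "real (card (partial_flags n (Suc k) :: (nat \<Rightarrow> 'a vec set) set)) =
      real (card (partial_flags n k :: (nat \<Rightarrow> 'a vec set) set)) * gauss_num CARD('a) (n + 1 - k)"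
proof -
  define q where "q = CARD('a)"
  have q: "q \<ge> 2" using CARD_field_ge_2[where 'a = 'a] by (simp add: q_def)
  define V where "V = (carrier_vec (n + 1) :: 'a vec set)"
  define ext where "ext U = {W. lin_sub (n + 1) W \<and> U k \<subseteq> W \<and> W \<subseteq> V \<and> sdim W = Suc k}"
    for U :: "nat \<Rightarrow> 'a vec set"
  define P where "P = (partial_flags n k :: (nat \<Rightarrow> 'a vec set) set)"
  have bij: "bij_betw (\<lambda>(U, W). U(Suc k := W)) (Sigma P ext) (partial_flags n (Suc k))"
  proof (rule bij_betw_byWitness[where f' = "\<lambda>U. (U(Suc k := V), U (Suc k))"])
    show "\<forall>p\<in>Sigma P ext. (\<lambda>U. (U(Suc k := V), U (Suc k))) ((\<lambda>(U, W). U(Suc k := W)) p) = p"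
      by (auto simp: P_def partial_flags_def V_def fun_eq_iff)
    show "\<forall>U\<in>partial_flags n (Suc k). (\<lambda>(U, W). U(Suc k := W)) (U(Suc k := V), U (Suc k)) = U" by simp
    show "(\<lambda>(U, W). U(Suc k := W)) ` Sigma P ext \<subseteq> partial_flags n (Suc k)"
    proof
      fix p assume "p \<in> (\<lambda>(U, W). U(Suc k := W)) ` Sigma P ext"
      then obtain U W where U: "U \<in> P" and W: "W \<in> ext U" and p: "p = U(Suc k := W)" by auto
      have "(U(Suc k := W)) i \<subseteq> (U(Suc k := W)) (Suc i)" if "i < Suc k" for i
        using that U W unfolding P_def partial_flags_def ext_def by (cases "i = k") auto
      thus "p \<in> partial_flags n (Suc k)"
        using U W unfolding p P_def partial_flags_def ext_def by (auto simp: le_Suc_eq)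
    qed
    show "(\<lambda>U. (U(Suc k := V), U (Suc k))) ` partial_flags n (Suc k) \<subseteq> Sigma P ext"
    proof
      fix p assume "p \<in> (\<lambda>U. (U(Suc k := V), U (Suc k))) ` partial_flags n (Suc k)"
      then obtain U where U: "U \<in> partial_flags n (Suc k)" and p: "p = (U(Suc k := V), U (Suc k))"
        by blast
      have "U(Suc k := V) \<in> P" using U unfolding P_def partial_flags_def V_def by auto
      moreover have "U (Suc k) \<in> ext (U(Suc k := V))"
        using U unfolding ext_def partial_flags_def V_def by (auto dest: lin_sub_vecD)
      ultimately show "p \<in> Sigma P ext" unfolding p by simp
    qed
  qed
  have finext: "finite (ext U)" for U unfolding ext_def by (rule finite_lin_subs)
  have cext: "real (card (ext U)) = gauss_num q (n + 1 - k)" if U: "U \<in> P" for U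
  proof -
    have Uk: "lin_sub (n + 1) (U k)" "sdim (U k) = k" "U k \<subseteq> V"
      using U by (auto simp: P_def partial_flags_def V_def lin_sub_def)
    have "card (ext U) * (q ^ Suc k - q ^ k) = q ^ (n + 1) - q ^ k"
      using card_covers_between[OF Uk(1) lin_sub_carrier Uk(3)[unfolded V_def]]
      by (simp add: Uk(2) sdim_carrier q_def ext_def V_def)
    moreover have "q ^ k \<le> q ^ Suc k" "q ^ k \<le> q ^ (n + 1)" by (rule power_increasing; use q k in simp)+
    ultimately have "real (card (ext U)) * (real q ^ Suc k - real q ^ k) = real q ^ (n + 1) - real q ^ k"
      by (metis (no_types, lifting) of_nat_diff of_nat_mult of_nat_power)
    moreover have "n + 1 = k + (n + 1 - k)" using k by simp
    hence "real q ^ (n + 1) = real q ^ k * real q ^ (n + 1 - k)" by (metis power_add)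
    ultimately have "real q ^ k * (real (card (ext U)) * (real q - 1)) = real q ^ k * (real q ^ (n + 1 - k) - 1)"
      by (simp add: algebra_simps)
    hence "real (card (ext U)) * (real q - 1) = real q ^ (n + 1 - k) - 1" using q by simp
    thus ?thesis using q by (simp add: gauss_num_def field_simps)
  qed
  show "finite (partial_flags n (Suc k) :: (nat \<Rightarrow> 'a vec set) set)"
    using bij_betw_finite[OF bij] fin finext by (simp add: P_def)
  have "card (partial_flags n (Suc k) :: (nat \<Rightarrow> 'a vec set) set) = (\<Sum>U\<in>P. card (ext U))"
    using bij_betw_same_card[OF bij] fin finext by (simp add: P_def)
  hence "real (card (partial_flags n (Suc k) :: (nat \<Rightarrow> 'a vec set) set)) = (\<Sum>U\<in>P. real (card (ext U)))" by simp
  also have "\<dots> = real (card P) * gauss_num q (n + 1 - k)" using cext by simp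
  finally show "real (card (partial_flags n (Suc k) :: (nat \<Rightarrow> 'a vec set) set)) =
      real (card (partial_flags n k :: (nat \<Rightarrow> 'a vec set) set)) * gauss_num CARD('a) (n + 1 - k)"
    by (simp add: P_def q_def)
qed

lemma card_flags:
  "finite (flags n :: (nat \<Rightarrow> 'a::{field,finite} vec set) set)"
  "real (card (flags n :: (nat \<Rightarrow> 'a vec set) set)) = (\<Prod>k = 1..n + 1. gauss_num CARD('a) k)"
proof -
  have q: "CARD('a) \<ge> 2" by (rule CARD_field_ge_2)
  have *: "finite (partial_flags n k :: (nat \<Rightarrow> 'a vec set) set) \<and>
    real (card (partial_flags n k :: (nat \<Rightarrow> 'a vec set) set)) =
      (\<Prod>j<k. gauss_num CARD('a) (n + 1 - j))" if "k \<le> n" for k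
    using that
  proof (induction k)
    case 0
    have "partial_flags n 0 = {\<lambda>i. if i = 0 then {0\<^sub>v (n + 1)} else carrier_vec (n + 1 :: nat) :: 'a vec set}"
      using lin_sub_zero[of "n + 1"] sdim_zero[where 'a = 'a and N = "n + 1"]
        by (auto simp: partial_flags_def fun_eq_iff)
    thus ?case by simp
  next
    case (Suc k)
    thus ?case using card_partial_flags_Suc[of k n, where 'a = 'a] by simp
  qed
  show "finite (flags n :: (nat \<Rightarrow> 'a vec set) set)" using * by blast
  have "(\<Prod>k = 1..n + 1. gauss_num CARD('a) k) = (\<Prod>j<n + 1. gauss_num CARD('a) (n + 1 - j))"
    by (rule prod.reindex_bij_witness[where i = "\<lambda>j. n + 1 - j" and j = "\<lambda>k. n + 1 - k"]) auto
  also have "\<dots> = (\<Prod>j<n. gauss_num CARD('a) (n + 1 - j))" using q by (simp add: gauss_num_def)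
  finally show "real (card (flags n :: (nat \<Rightarrow> 'a vec set) set)) = (\<Prod>k = 1..n + 1. gauss_num CARD('a) k)"
    using * by simp
qed

section \<open>Adjacent flags\<close>

definition adj :: "nat \<Rightarrow> nat \<Rightarrow> ((nat \<Rightarrow> 'a::{field,finite} vec set) \<times> (nat \<Rightarrow> 'a vec set)) set" where
  "adj n i = {(U, V). U \<in> flags n \<and> V \<in> flags n \<and> (\<forall>j. j \<noteq> i \<longrightarrow> U j = V j) \<and> U i \<noteq> V i}"

text \<open>
The pairs joined by a gallery of type \<open>k, k - 1, \<dots>, 1\<close>: the members of \<open>U\<close> are replaced by those
of \<open>V\<close> one after the other from the top, so at the moment when \<open>U\<^sub>i\<close> is replaced the new member
must contain \<open>U\<^bsub>i-1\<^esub>\<close>.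
\<close>

definition desc_rel :: "nat \<Rightarrow> nat \<Rightarrow> ((nat \<Rightarrow> 'a::{field,finite} vec set) \<times> (nat \<Rightarrow> 'a vec set)) set" where
  "desc_rel n k = {(U, V). U \<in> flags n \<and> V \<in> flags n \<and> (\<forall>j>k. U j = V j) \<and>
     (\<forall>i\<in>{1..k}. U i \<noteq> V i \<and> U (i - 1) \<subseteq> V i)}"

text \<open>
Opposition of the flags induced in the common subspace of dimension \<open>k + 1\<close>. For \<open>k = n\<close> this is
opposition of maximal flags.
\<close>

definition opp_rel :: "nat \<Rightarrow> nat \<Rightarrow> ((nat \<Rightarrow> 'a::{field,finite} vec set) \<times> (nat \<Rightarrow> 'a vec set)) set" where
  "opp_rel n k = {(U, V). U \<in> flags n \<and> V \<in> flags n \<and> (\<forall>j>k. U j = V j) \<and>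
     (\<forall>i\<in>{1..k}. U i \<inter> V (k + 1 - i) = {0\<^sub>v (n + 1)})}"

lemma adjD:
  assumes "(U, V) \<in> adj n i"
  shows "U \<in> flags n" "V \<in> flags n" "j \<noteq> i \<Longrightarrow> U j = V j" "U i \<noteq> V i"
  using assms by (auto simp: adj_def)

lemma adjI: "U \<in> flags n \<Longrightarrow> V \<in> flags n \<Longrightarrow> (\<And>j. j \<noteq> i \<Longrightarrow> U j = V j) \<Longrightarrow> U i \<noteq> V i \<Longrightarrow> (U, V) \<in> adj n i"
  by (simp add: adj_def)

lemma adj_sym: "(U, V) \<in> adj n i \<Longrightarrow> (V, U) \<in> adj n i"
  by (auto simp: adj_def)

lemma adj_adj_unique:
  assumes "i \<noteq> j" "(U, Z) \<in> adj n i" "(Z, V) \<in> adj n j" "(U, Z') \<in> adj n i" "(Z', V) \<in> adj n j"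
  shows "Z = Z'"
proof
  fix k show "Z k = Z' k"
    using adjD(3)[OF assms(2), of k] adjD(3)[OF assms(3), of k] adjD(3)[OF assms(4), of k]
      adjD(3)[OF assms(5), of k] \<open>i \<noteq> j\<close>
    by (cases "k = i") auto
qed

lemma adj_comp_subset:
  assumes i: "i \<in> {1..n}" and j: "j \<in> {1..n}" and ij: "i + 1 < j \<or> j + 1 < i"
  shows "adj n i O adj n j \<subseteq> adj n j O adj n i"
proof (rule subrelI)
  fix U V assume "(U, V) \<in> adj n i O adj n j"
  then obtain Z where Z: "(U, Z) \<in> adj n i" "(Z, V) \<in> adj n j" by blast
  note UZ = adjD[OF Z(1)] and ZV = adjD[OF Z(2)]
  define Y where "Y = U(j := V j)"
  have "U (j - 1) = Z (j - 1)" "U (Suc j) = Z (Suc j)" using UZ(3) ij j by auto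
  moreover have "Z (j - 1) = V (j - 1)" "Z (Suc j) = V (Suc j)" using ZV(3) j by auto
  ultimately have le: "U (j - 1) \<subseteq> V j" "V j \<subseteq> U (Suc j)" 
    using flag_Suc[OF ZV(2), of "j - 1"] flag_Suc[OF ZV(2), of j] j by auto
  have Y: "Y \<in> flags n" unfolding Y_def
    by (rule flag_update[OF UZ(1) j flag_lin_sub[OF ZV(2)] flag_dim[OF ZV(2)] le]) (use j in simp)
  have "(U, Y) \<in> adj n j"
  proof (rule adjI[OF UZ(1) Y])
    have "j \<noteq> i" using ij by auto
    thus "U j \<noteq> Y j" using UZ(3)[of j] ZV(4) by (simp add: Y_def)
  qed (simp add: Y_def)
  moreover have "(Y, V) \<in> adj n i"
  proof (rule adjI[OF Y ZV(2)])
    show "Y k = V k" if "k \<noteq> i" for k using that UZ(3)[of k] ZV(3)[of k] by (auto simp: Y_def)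
    show "Y i \<noteq> V i" using UZ(4) ZV(3)[of i] ij by (auto simp: Y_def)
  qed
  ultimately show "(U, V) \<in> adj n j O adj n i" by blast
qed

lemma adj_comp_commute:
  assumes "i \<in> {1..n}" "j \<in> {1..n}" "i + 1 < j"
  shows "adj n i O adj n j = adj n j O adj n i"
  using adj_comp_subset[OF assms(1,2)] adj_comp_subset[OF assms(2,1)] assms(3) by blast

text \<open>
A gallery of type \<open>i, i + 1, i\<close> from \<open>U\<close> to \<open>V\<close> passes through the subspace \<open>U\<^bsub>i+1\<^esub> \<inter> V\<^bsub>i+1\<^esub>\<close>,
so its flags are determined by \<open>U\<close> and \<open>V\<close>.
\<close>

lemma braid_unique_up:
  assumes i: "i \<in> {1..<n}"
    and 1: "(U, Z) \<in> adj n i O adj n (Suc i)" "(Z, V) \<in> adj n i"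
    and 2: "(U, Z') \<in> adj n i O adj n (Suc i)" "(Z', V) \<in> adj n i"
  shows "Z = Z'"
proof -
  have *: "Z i = U (Suc i) \<inter> V (Suc i)"
    if h: "(U, Z) \<in> adj n i O adj n (Suc i)" "(Z, V) \<in> adj n i" for Z
  proof -
    obtain Y where Y: "(U, Y) \<in> adj n i" "(Y, Z) \<in> adj n (Suc i)" using h by blast
    note UY = adjD[OF Y(1)] and YZ = adjD[OF Y(2)] and ZV = adjD[OF h(2)]
    note sU = flag_lin_sub[OF UY(1)] and dU = flag_dim[OF UY(1)] and sV = flag_lin_sub[OF ZV(2)]
      and dV = flag_dim[OF ZV(2)]
    have "Z i \<subseteq> U (Suc i)" using flag_Suc[OF YZ(1), of i] YZ(3)[of i] UY(3)[of "Suc i"] by simp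
    moreover have "Z i \<subseteq> V (Suc i)" using flag_Suc[OF ZV(1), of i] ZV(3)[of "Suc i"] by simp
    ultimately have sub: "Z i \<subseteq> U (Suc i) \<inter> V (Suc i)" by blast
    have ne: "U (Suc i) \<noteq> V (Suc i)" using YZ(4) UY(3)[of "Suc i"] ZV(3)[of "Suc i"] by simp
    have eq2: "U (Suc (Suc i)) = V (Suc (Suc i))" using UY(3) YZ(3) ZV(3) by simp
    have "Suc (sdim (U (Suc i) \<inter> V (Suc i))) = Suc i"
      by (rule distinct_in_common(1)[OF sU dU sV dV ne
         sU flag_Suc[OF UY(1)] _ dU]) (use i flag_Suc[OF ZV(2), of "Suc i"] eq2 in auto)
    thus ?thesis
      using i by (intro sdim_eq_imp_eq[OF flag_lin_sub[OF ZV(1)] lin_sub_Int[OF sU sV] sub])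
        (simp add: flag_dim[OF ZV(1)])
  qed
  show ?thesis
  proof
    fix k show "Z k = Z' k"
      using *[OF 1] *[OF 2] adjD(3)[OF 1(2), of k] adjD(3)[OF 2(2), of k] by (cases "k = i") auto
  qed
qed

text \<open>
A gallery of type \<open>i + 1, i, i + 1\<close> from \<open>U\<close> to \<open>V\<close> passes through the subspace \<open>U\<^sub>i + V\<^sub>i\<close>.
\<close>

lemma braid_unique_down:
  assumes i: "i \<in> {1..<n}"
    and 1: "(U, Z) \<in> adj n (Suc i) O adj n i" "(Z, V) \<in> adj n (Suc i)"
    and 2: "(U, Z') \<in> adj n (Suc i) O adj n i" "(Z', V) \<in> adj n (Suc i)"
  shows "Z = Z'"
proof -
  have *: "Z (Suc i) = U i \<uplus> V i"
    if h: "(U, Z) \<in> adj n (Suc i) O adj n i" "(Z, V) \<in> adj n (Suc i)" for Z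
  proof -
    obtain Y where Y: "(U, Y) \<in> adj n (Suc i)" "(Y, Z) \<in> adj n i" using h by blast
    note UY = adjD[OF Y(1)] and YZ = adjD[OF Y(2)] and ZV = adjD[OF h(2)]
    note sU = flag_lin_sub[OF UY(1)] and dU = flag_dim[OF UY(1)] and sV = flag_lin_sub[OF ZV(2)]
      and dV = flag_dim[OF ZV(2)]
    have "U i \<subseteq> Z (Suc i)" using flag_Suc[OF YZ(1), of i] YZ(3)[of "Suc i"] UY(3)[of i] by simp
    moreover have "V i \<subseteq> Z (Suc i)" using flag_Suc[OF ZV(1), of i] ZV(3)[of i] by simp
    moreover have "U i \<noteq> V i" using YZ(4) UY(3)[of i] ZV(3)[of i] by simp
    ultimately show ?thesis
      using i by (intro distinct_in_common(2)[symmetric, OF sU dU sV dV _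
         flag_lin_sub[OF ZV(1)] _ _ flag_dim[OF ZV(1)]]) auto
  qed
  show ?thesis
  proof
    fix k show "Z k = Z' k"
      using *[OF 1] *[OF 2] adjD(3)[OF 1(2), of k] adjD(3)[OF 2(2), of k] by (cases "k = Suc i") auto
  qed
qed

text \<open>
Both kinds of galleries exist iff the flags are opposite in their residue of rank two, that is
\<open>U\<^sub>i\<close> does not lie in \<open>V\<^bsub>i+1\<^esub>\<close> and \<open>V\<^sub>i\<close> does not lie in \<open>U\<^bsub>i+1\<^esub>\<close>. The galleries are then found
with the subspace \<open>U\<^sub>i + V\<^sub>i\<close> and with the subspace \<open>U\<^bsub>i+1\<^esub> \<inter> V\<^bsub>i+1\<^esub>\<close>.
\<close>

lemma adj_braid_rel:
  assumes i: "i \<in> {1..<n}"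
  shows "adj n i O adj n (Suc i) O adj n i = adj n (Suc i) O adj n i O adj n (Suc i)"
proof
  show "adj n i O adj n (Suc i) O adj n i \<subseteq> adj n (Suc i) O adj n i O adj n (Suc i)"
  proof (rule subrelI)
    fix U V assume "(U, V) \<in> adj n i O adj n (Suc i) O adj n i"
    then obtain Y Z where Y: "(U, Y) \<in> adj n i" "(Y, Z) \<in> adj n (Suc i)" "(Z, V) \<in> adj n i" by blast
    note UY = adjD[OF Y(1)] and YZ = adjD[OF Y(2)] and ZV = adjD[OF Y(3)]
    note sU = flag_lin_sub[OF UY(1)] and dU = flag_dim[OF UY(1)] and sV = flag_lin_sub[OF ZV(2)]
      and dV = flag_dim[OF ZV(2)]
    have si: "Suc i \<in> {1..n}" "i \<in> {1..n}" using i by auto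
    have off: "U k = V k" if "k \<noteq> i" "k \<noteq> Suc i" for k
      using that UY(3)[of k] YZ(3)[of k] ZV(3)[of k] by simp
    have lU: "Y i \<subseteq> U (Suc i)" using flag_Suc[OF UY(2), of i] UY(3)[of "Suc i"] by simp
    have lV: "Y i \<subseteq> V (Suc i)" using flag_Suc[OF ZV(1), of i] YZ(3)[of i] ZV(3)[of "Suc i"] by simp
    have ne: "U (Suc i) \<noteq> V (Suc i)" using YZ(4) UY(3)[of "Suc i"] ZV(3)[of "Suc i"] by simp
    have VS: "V (Suc i) \<subseteq> U (Suc (Suc i))"
      using flag_Suc[OF ZV(2), of "Suc i"] off[of "Suc (Suc i)"] by simp
    have dI: "sdim (U (Suc i) \<inter> V (Suc i)) = i"
      using distinct_in_common(1)[OF sU dU sV dV ne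
         sU flag_Suc[OF UY(1)] VS dU] i by simp
    have I: "lin_sub (n + 1) (U (Suc i) \<inter> V (Suc i))" by (rule lin_sub_Int[OF sU sV])
    have YI: "W = Y i" if W: "lin_sub (n + 1) W" "sdim W = i" "W \<subseteq> U (Suc i)" "W \<subseteq> V (Suc i)" for W
    proof -
      have "W = U (Suc i) \<inter> V (Suc i)" using sdim_eq_imp_eq[OF W(1) I] W dI by simp
      moreover have "Y i = U (Suc i) \<inter> V (Suc i)"
        using sdim_eq_imp_eq[OF flag_lin_sub[OF UY(2)] I] lU lV dI flag_dim[OF UY(2), of i] i by auto
      ultimately show ?thesis by simp
    qed
    have UnV: "\<not> U i \<subseteq> V (Suc i)"
      using YI[OF sU dU flag_Suc[OF UY(1)]] UY(4) i by auto
    have VnU: "\<not> V i \<subseteq> U (Suc i)"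
      using YI[OF sV dV _ flag_Suc[OF ZV(2)]] YZ(3)[of i] ZV(4) i by auto
    have ne': "U i \<noteq> V i" using UnV flag_Suc[OF ZV(2), of i] by auto
    define L where "L = U i \<uplus> V i"
    have L: "lin_sub (n + 1) L" unfolding L_def by (rule lin_sub_vsum[OF sU sV])
    have UL: "U i \<subseteq> L" and VL: "V i \<subseteq> L" unfolding L_def
      using vsum_upper1[OF sU sV] vsum_upper2[OF sU sV] by auto
    have UA: "U (i - 1) \<subseteq> U i" and VA: "U (i - 1) \<subseteq> V i"
      using flag_Suc[OF UY(1), of "i - 1"] flag_Suc[OF ZV(2), of "i - 1"] off[of "i - 1"] i by auto
    have dL: "sdim L = Suc i" unfolding L_def
      by (rule distinct_over_common(2)[OF sU dU sV dV ne' sU UA VA])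
        (use i flag_dim[OF UY(1), of "i - 1"] in auto)
    have VS': "V i \<subseteq> U (Suc (Suc i))" using flag_Suc[OF ZV(2), of i] VS by blast
    have LS: "L \<subseteq> U (Suc (Suc i))" unfolding L_def
      by (rule vsum_least[OF sU _ VS']) (use flag_mono[OF UY(1), of i "Suc (Suc i)"] in simp)
    define P where "P = U(Suc i := L)"
    define R where "R = V(Suc i := L)"
    have P: "P \<in> flags n" unfolding P_def
      by (rule flag_update[OF UY(1) si(1) L dL]) (use UL LS in auto)
    have R: "R \<in> flags n" unfolding R_def
      by (rule flag_update[OF ZV(2) si(1) L dL]) (use VL LS off[of "Suc (Suc i)"] in auto)
    have "(U, P) \<in> adj n (Suc i)"
      by (rule adjI[OF UY(1) P]) (use VnU VL in \<open>auto simp: P_def\<close>)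
    moreover have "(P, R) \<in> adj n i"
      by (rule adjI[OF P R]) (use off ne' in \<open>auto simp: P_def R_def\<close>)
    moreover have "(R, V) \<in> adj n (Suc i)"
      by (rule adjI[OF R ZV(2)]) (use UnV UL in \<open>auto simp: R_def\<close>)
    ultimately show "(U, V) \<in> adj n (Suc i) O adj n i O adj n (Suc i)" by blast
  qed
  show "adj n (Suc i) O adj n i O adj n (Suc i) \<subseteq> adj n i O adj n (Suc i) O adj n i"
  proof (rule subrelI)
    fix U V assume "(U, V) \<in> adj n (Suc i) O adj n i O adj n (Suc i)"
    then obtain Y Z where Y: "(U, Y) \<in> adj n (Suc i)" "(Y, Z) \<in> adj n i" "(Z, V) \<in> adj n (Suc i)"
      by blast
    note UY = adjD[OF Y(1)] and YZ = adjD[OF Y(2)] and ZV = adjD[OF Y(3)]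
    note sU = flag_lin_sub[OF UY(1)] and dU = flag_dim[OF UY(1)] and sV = flag_lin_sub[OF ZV(2)]
      and dV = flag_dim[OF ZV(2)]
    have si: "i \<in> {1..n}" using i by auto
    have off: "U k = V k" if "k \<noteq> i" "k \<noteq> Suc i" for k
      using that UY(3)[of k] YZ(3)[of k] ZV(3)[of k] by simp
    have UL: "U i \<subseteq> Y (Suc i)" using flag_Suc[OF UY(2), of i] UY(3)[of i] by simp
    have VL: "V i \<subseteq> Y (Suc i)" using flag_Suc[OF ZV(1), of i] YZ(3)[of "Suc i"] ZV(3)[of i] by simp
    have ne: "U i \<noteq> V i" using YZ(4) UY(3)[of i] ZV(3)[of i] by simp
    have uniq: "W = Y (Suc i)" if W: "lin_sub (n + 1) W" "sdim W = Suc i" "U i \<subseteq> W" "V i \<subseteq> W" for W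
    proof -
      have "U i \<uplus> V i = W"
        by (rule distinct_in_common(2)[OF sU dU sV dV ne W(1,3,4,2)])
          (use i in auto)
      moreover have "U i \<uplus> V i = Y (Suc i)"
        by (rule distinct_in_common(2)[OF sU dU sV dV ne flag_lin_sub[OF UY(2)] UL VL flag_dim[OF UY(2)]])
          (use i in auto)
      ultimately show ?thesis by simp
    qed
    have VnU: "\<not> V i \<subseteq> U (Suc i)"
      using uniq[OF sU dU flag_Suc[OF UY(1)]] UY(4) i by auto
    have UnV: "\<not> U i \<subseteq> V (Suc i)"
      using uniq[OF sV dV _ flag_Suc[OF ZV(2)]] YZ(3)[of "Suc i"] ZV(4) i by auto
    have ne': "U (Suc i) \<noteq> V (Suc i)" using VnU flag_Suc[OF ZV(2), of i] by auto
    define Q where "Q = U (Suc i) \<inter> V (Suc i)"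
    have Q: "lin_sub (n + 1) Q" unfolding Q_def by (rule lin_sub_Int[OF sU sV])
    have VS: "V (Suc i) \<subseteq> U (Suc (Suc i))"
      using flag_Suc[OF ZV(2), of "Suc i"] off[of "Suc (Suc i)"] by simp
    have dQ: "sdim Q = i"
      using distinct_in_common(1)[OF sU dU sV dV ne'
         sU flag_Suc[OF UY(1)] VS dU] i by (simp add: Q_def)
    have eA: "U (i - 1) = V (i - 1)" using off[of "i - 1"] i by auto
    have AQ: "U (i - 1) \<subseteq> Q"
      using flag_mono[OF UY(1), of "i - 1" "Suc i"] flag_mono[OF ZV(2), of "i - 1" "Suc i"] eA
        by (auto simp: Q_def)
    define P where "P = U(i := Q)"
    define R where "R = V(i := Q)"
    have P: "P \<in> flags n" unfolding P_def
      by (rule flag_update[OF UY(1) si Q dQ AQ]) (auto simp: Q_def)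
    have R: "R \<in> flags n" unfolding R_def
      by (rule flag_update[OF ZV(2) si Q dQ]) (use AQ eA in \<open>auto simp: Q_def\<close>)
    have "(U, P) \<in> adj n i"
      by (rule adjI[OF UY(1) P]) (use UnV in \<open>auto simp: P_def Q_def\<close>)
    moreover have "(P, R) \<in> adj n (Suc i)"
      by (rule adjI[OF P R]) (use off ne' in \<open>auto simp: P_def R_def\<close>)
    moreover have "(R, V) \<in> adj n i"
      by (rule adjI[OF R ZV(2)]) (use VnU in \<open>auto simp: R_def Q_def\<close>)
    ultimately show "(U, V) \<in> adj n i O adj n (Suc i) O adj n i" by blast
  qed
qed

section \<open>Galleries and opposite flags\<close>

text \<open>
The first step of the gallery leads to the flag that differs from \<open>U\<close> in the member \<open>V\<^bsub>k+1\<^esub>\<close>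
only.
\<close>

lemma adj_desc_rel:
  assumes k: "k < n"
  shows "adj n (Suc k) O desc_rel n k = desc_rel n (Suc k)"
    and "(U, Z) \<in> adj n (Suc k) \<Longrightarrow> (Z, V) \<in> desc_rel n k \<Longrightarrow> (U, Z') \<in> adj n (Suc k) \<Longrightarrow> (Z', V) \<in> desc_rel n k \<Longrightarrow> Z = Z'"
proof -
  show "adj n (Suc k) O desc_rel n k = desc_rel n (Suc k)"
  proof
    show "adj n (Suc k) O desc_rel n k \<subseteq> desc_rel n (Suc k)"
    proof (rule subrelI)
      fix U V assume "(U, V) \<in> adj n (Suc k) O desc_rel n k"
      then obtain Z where Z: "(U, Z) \<in> adj n (Suc k)" and ZV: "(Z, V) \<in> desc_rel n k" by blast
      note UZ = adjD[OF Z]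
      have V: "V \<in> flags n" and agree: "\<And>j. j > k \<Longrightarrow> Z j = V j" 
        and step: "\<And>i. i \<in> {1..k} \<Longrightarrow> Z i \<noteq> V i \<and> Z (i - 1) \<subseteq> V i" using ZV by (auto simp: desc_rel_def)
      have "U i \<noteq> V i \<and> U (i - 1) \<subseteq> V i" if i: "i \<in> {1..Suc k}" for i
      proof (cases "i = Suc k")
        case True
        have "U k = Z k" using UZ(3) by simp
        thus ?thesis using True UZ(4) agree[of "Suc k"] flag_Suc[OF UZ(2), of k] by simp
      next
        case False
        have "U i = Z i" using UZ(3)[of i] False by simp
        moreover have "i - 1 \<noteq> Suc k" using i by auto
        hence "U (i - 1) = Z (i - 1)" by (rule UZ(3))
        ultimately show ?thesis using step[of i] i False by simp
      qed
      moreover have "U j = V j" if "j > Suc k" for j using that UZ(3)[of j] agree[of j] by simp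
      ultimately show "(U, V) \<in> desc_rel n (Suc k)" using UZ(1) V by (simp add: desc_rel_def)
    qed
    show "desc_rel n (Suc k) \<subseteq> adj n (Suc k) O desc_rel n k"
    proof (rule subrelI)
      fix U V assume UV: "(U, V) \<in> desc_rel n (Suc k)"
      have U: "U \<in> flags n" and V: "V \<in> flags n" and agree: "\<And>j. j > Suc k \<Longrightarrow> U j = V j"
        and step: "\<And>i. i \<in> {1..Suc k} \<Longrightarrow> U i \<noteq> V i \<and> U (i - 1) \<subseteq> V i" using UV
          by (auto simp: desc_rel_def)
      define Z where "Z = U(Suc k := V (Suc k))"
      have Z: "Z \<in> flags n" unfolding Z_def
      proof (rule flag_update[OF U _ flag_lin_sub[OF V] flag_dim[OF V]])
        show "U (Suc k - 1) \<subseteq> V (Suc k)" using step[of "Suc k"] by simp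
        show "V (Suc k) \<subseteq> U (Suc (Suc k))" using flag_Suc[OF V, of "Suc k"] agree[of "Suc (Suc k)"]
          by simp
      qed (use k in auto)
      have "(U, Z) \<in> adj n (Suc k)"
        by (rule adjI[OF U Z]) (use step[of "Suc k"] in \<open>simp_all add: Z_def\<close>)
      moreover have "Z i \<noteq> V i \<and> Z (i - 1) \<subseteq> V i" if i: "i \<in> {1..k}" for i
      proof -
        have "i \<noteq> Suc k" "i - 1 \<noteq> Suc k" using i by auto
        thus ?thesis using step[of i] i by (simp add: Z_def)
      qed
      hence "(Z, V) \<in> desc_rel n k" using Z V agree by (simp add: desc_rel_def Z_def)
      ultimately show "(U, V) \<in> adj n (Suc k) O desc_rel n k" by blast
    qed
  qed
  assume 1: "(U, Z) \<in> adj n (Suc k)" "(Z, V) \<in> desc_rel n k"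
    and 2: "(U, Z') \<in> adj n (Suc k)" "(Z', V) \<in> desc_rel n k"
  show "Z = Z'"
  proof
    fix j
    have "Z (Suc k) = V (Suc k)" "Z' (Suc k) = V (Suc k)" using 1(2) 2(2) by (simp_all add: desc_rel_def)
    thus "Z j = Z' j" using adjD(3)[OF 1(1), of j] adjD(3)[OF 2(1), of j] by (cases "j = Suc k") auto
  qed
qed

text \<open>
By dimensions \<open>V\<^sub>i \<inter> H\<^sub>i = H\<^bsub>i-1\<^esub>\<close>; descending induction on \<open>i\<close> replaces \<open>H\<^sub>i\<close> by \<open>H\<^sub>k\<close>.
\<close>

lemma desc_rel_Int:
  assumes HV: "(H, V) \<in> desc_rel n k" and kn: "k \<le> n" and i: "i \<in> {1..k}"
  shows "V i \<inter> H k = H (i - 1)"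
proof -
  have H: "H \<in> flags n" and V: "V \<in> flags n"
    and step: "\<And>i. i \<in> {1..k} \<Longrightarrow> H i \<noteq> V i \<and> H (i - 1) \<subseteq> V i" using HV by (auto simp: desc_rel_def)
  have meet: "V i \<inter> H i = H (i - 1)" if i: "i \<in> {1..k}" for i
  proof (rule distinct_over_common(1)[OF flag_lin_sub[OF V] flag_dim[OF V] flag_lin_sub[OF H] flag_dim[OF H] _ flag_lin_sub[OF H]])
    show "V i \<noteq> H i" "H (i - 1) \<subseteq> V i" using step[OF i] by auto
    show "H (i - 1) \<subseteq> H i" by (rule flag_mono[OF H]) simp
    show "Suc (sdim (H (i - 1))) = i" using flag_dim[OF H, of "i - 1"] i kn by auto
  qed (use i kn in auto)
  from i have "i \<le> k" "1 \<le> i" by auto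
  thus ?thesis
  proof (induction rule: inc_induct)
    case base
    thus ?case using meet[of k] by simp
  next
    case (step i)
    have "V i \<inter> H k \<subseteq> V (Suc i) \<inter> H k" using flag_Suc[OF V, of i] by blast
    hence "V i \<inter> H k \<subseteq> H i" using step by simp
    hence "V i \<inter> H k \<subseteq> H (i - 1)" using meet[of i] step by auto
    moreover have "H (i - 1) \<subseteq> V i" using meet[of i] step by auto
    moreover have "H (i - 1) \<subseteq> H k" using flag_mono[OF H, of "i - 1" k] step by simp
    ultimately show ?case by blast
  qed
qed

text \<open>
This step corresponds to the last descending word in \<open>long_word\<close>. The intermediate flag \<open>H\<close> is
recovered from \<open>U\<close> and \<open>V\<close>: it agrees with \<open>U\<close> from \<open>k + 1\<close> on, and \<open>H\<^sub>j = V\<^bsub>j+1\<^esub> \<inter> U\<^bsub>k+1\<^esub>\<close> for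
\<open>j \<le> k\<close> by \<open>desc_rel_Int\<close>. As \<open>U\<^sub>i\<close> lies in \<open>U\<^bsub>k+1\<^esub>\<close>, it meets \<open>H\<^sub>j\<close> and \<open>V\<^bsub>j+1\<^esub>\<close> in the same
subspace.
\<close>

lemma opp_desc_rel:
  assumes k: "k < n"
  shows "opp_rel n k O desc_rel n (Suc k) = opp_rel n (Suc k)"
    and "(U, Z) \<in> opp_rel n k \<Longrightarrow> (Z, V) \<in> desc_rel n (Suc k) \<Longrightarrow> (U, Z') \<in> opp_rel n k \<Longrightarrow> (Z', V) \<in> desc_rel n (Suc k) \<Longrightarrow> Z = Z'"
proof -
  show "opp_rel n k O desc_rel n (Suc k) = opp_rel n (Suc k)"
  proof
    show "opp_rel n k O desc_rel n (Suc k) \<subseteq> opp_rel n (Suc k)"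
    proof (rule subrelI)
      fix U V assume "(U, V) \<in> opp_rel n k O desc_rel n (Suc k)"
      then obtain H where UH: "(U, H) \<in> opp_rel n k" and HV: "(H, V) \<in> desc_rel n (Suc k)" by blast
      have U: "U \<in> flags n" and H: "H \<in> flags n" and V: "V \<in> flags n" and a1: "\<And>j. j > k \<Longrightarrow> U j = H j"
        and a2: "\<And>j. j > Suc k \<Longrightarrow> H j = V j" and o: "\<And>i. i \<in> {1..k} \<Longrightarrow> U i \<inter> H (k + 1 - i) = {0\<^sub>v (n + 1)}"
        using UH HV by (auto simp: opp_rel_def desc_rel_def)
      have "U i \<inter> V (Suc k + 1 - i) = {0\<^sub>v (n + 1)}" if i: "i \<in> {1..Suc k}" for i
      proof -
        define j where "j = Suc k + 1 - i"
        have j: "j \<in> {1..Suc k}" "j - 1 = k + 1 - i" using i by (auto simp: j_def)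
        have "U i \<subseteq> H (Suc k)" using flag_mono[OF U, of i "Suc k"] a1[of "Suc k"] i by simp
        hence "U i \<inter> V j = U i \<inter> (V j \<inter> H (Suc k))" by blast
        also have "\<dots> = U i \<inter> H (k + 1 - i)" using desc_rel_Int[OF HV _ j(1)] k j(2) by simp
        also have "\<dots> = {0\<^sub>v (n + 1)}"
        proof (cases "i = Suc k")
          case True
          thus ?thesis using flag_0[OF H] lin_sub_zeroD[OF flag_lin_sub[OF U]] by simp
        qed (use o[of i] i in auto)
        finally show ?thesis unfolding j_def .
      qed
      thus "(U, V) \<in> opp_rel n (Suc k)" using U V a1 a2 by (simp add: opp_rel_def)
    qed
    show "opp_rel n (Suc k) \<subseteq> opp_rel n k O desc_rel n (Suc k)"
    proof (rule subrelI)
      fix U V assume UV: "(U, V) \<in> opp_rel n (Suc k)"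
      have U: "U \<in> flags n" and V: "V \<in> flags n" and a: "\<And>j. j > Suc k \<Longrightarrow> U j = V j"
        and o: "\<And>i. i \<in> {1..Suc k} \<Longrightarrow> U i \<inter> V (Suc k + 1 - i) = {0\<^sub>v (n + 1)}"
        using UV by (auto simp: opp_rel_def)
      \<comment> \<open>Only this flag can be the intermediate one, by \<open>desc_rel_Int\<close>.\<close>
      define H where "H j = (if j \<le> k then V (Suc j) \<inter> U (Suc k) else U j)" for j
      have VnU: "\<not> V 1 \<subseteq> U (Suc k)"
      proof
        assume "V 1 \<subseteq> U (Suc k)"
        hence "V 1 = {0\<^sub>v (n + 1)}" using o[of "Suc k"] lin_sub_zeroD[OF flag_lin_sub[OF V, of 1]]
          by auto
        hence "sdim (V 1) = 0" by (simp only: sdim_zero)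
        thus False using flag_dim[OF V, of 1] by simp
      qed
      have I: "lin_sub (n + 1) (V (Suc j) \<inter> U (Suc k))" for j
        by (rule lin_sub_Int[OF flag_lin_sub[OF V] flag_lin_sub[OF U]])
      have dI: "sdim (V (Suc j) \<inter> U (Suc k)) = j" if j: "j \<le> k" for j
      proof -
        have S: "lin_sub (n + 1) (V (Suc j) \<uplus> U (Suc k))"
          by (rule lin_sub_vsum[OF flag_lin_sub[OF V] flag_lin_sub[OF U]])
        have "V (Suc j) \<subseteq> U (Suc (Suc k))"
          using flag_mono[OF V, of "Suc j" "Suc (Suc k)"] a[of "Suc (Suc k)"] j by simp
        hence le: "V (Suc j) \<uplus> U (Suc k) \<subseteq> U (Suc (Suc k))" 
          by (rule vsum_least[OF flag_lin_sub[OF U] _ flag_Suc[OF U]])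
        have "U (Suc k) \<noteq> V (Suc j) \<uplus> U (Suc k)"
          using VnU vsum_upper1[OF flag_lin_sub[OF V, of "Suc j"] flag_lin_sub[OF U, of "Suc k"]]
            flag_mono[OF V, of 1 "Suc j"] by auto
        hence "Suc k < sdim (V (Suc j) \<uplus> U (Suc k))"
          using sdim_strict_mono[OF flag_lin_sub[OF U] S vsum_upper2[OF flag_lin_sub[OF V] flag_lin_sub[OF U]]] flag_dim[OF U, of "Suc k"] k by simp
        moreover have "sdim (V (Suc j) \<uplus> U (Suc k)) \<le> Suc (Suc k)"
          using sdim_mono[OF S flag_lin_sub[OF U] le] flag_dim[OF U, of "Suc (Suc k)"] k by simp
        ultimately show ?thesis
          using sdim_vsum[OF flag_lin_sub[OF V, of "Suc j"] flag_lin_sub[OF U, of "Suc k"]]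
            flag_dim[OF U, of "Suc k"] flag_dim[OF V, of "Suc j"] j k by simp
      qed
      have H: "H \<in> flags n"
      proof (rule flagI)
        show "H 0 = {0\<^sub>v (n + 1)}" using o[of "Suc k"] by (simp add: H_def Int_commute)
        show "lin_sub (n + 1) (H i)" for i using I flag_lin_sub[OF U] by (simp add: H_def)
        show "sdim (H i) = i" if "i \<in> {1..n}" for i using dI flag_dim[OF U] that by (simp add: H_def)
        show "H i \<subseteq> H (Suc i)" for i
          using flag_Suc[OF U, of i] flag_Suc[OF V, of "Suc i"]
            by (auto simp: H_def not_le less_Suc_eq_le le_antisym)
        show "H i = carrier_vec (n + 1)" if "i > n" for i using that k flag_top[OF U]
          by (simp add: H_def)
      qed
      have "(U, H) \<in> opp_rel n k"
      proof -
        have "U i \<inter> H (k + 1 - i) = {0\<^sub>v (n + 1)}" if i: "i \<in> {1..k}" for i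
        proof -
          have "U i \<subseteq> U (Suc k)" using flag_mono[OF U, of i "Suc k"] i by simp
          moreover have "k + 1 - i \<le> k" "Suc (k + 1 - i) = Suc k + 1 - i" using i by auto
          hence "H (k + 1 - i) = V (Suc k + 1 - i) \<inter> U (Suc k)" by (simp only: H_def if_True)
          ultimately show ?thesis using o[of i] i by auto
        qed
        thus ?thesis using U H by (simp add: opp_rel_def H_def)
      qed
      moreover have "(H, V) \<in> desc_rel n (Suc k)"
      proof -
        have "H i \<noteq> V i \<and> H (i - 1) \<subseteq> V i" if i: "i \<in> {1..Suc k}" for i
        proof -
          have "H i \<subseteq> U (Suc k)" using flag_mono[OF H, of i "Suc k"] i by (simp add: H_def)
          hence "H i \<noteq> V i" using VnU flag_mono[OF V, of 1 i] i by auto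
          moreover have "i - 1 \<le> k" "Suc (i - 1) = i" using i by auto
          ultimately show ?thesis by (simp add: H_def)
        qed
        thus ?thesis using H V a by (simp add: desc_rel_def H_def)
      qed
      ultimately show "(U, V) \<in> opp_rel n k O desc_rel n (Suc k)" by blast
    qed
  qed
  assume 1: "(U, Z) \<in> opp_rel n k" "(Z, V) \<in> desc_rel n (Suc k)"
    and 2: "(U, Z') \<in> opp_rel n k" "(Z', V) \<in> desc_rel n (Suc k)"
  have *: "Y j = (if j \<le> k then V (Suc j) \<inter> U (Suc k) else U j)"
    if "(U, Y) \<in> opp_rel n k" "(Y, V) \<in> desc_rel n (Suc k)" for Y j
  proof -
    have a: "\<And>j. j > k \<Longrightarrow> U j = Y j" using that by (auto simp: opp_rel_def)
    show ?thesis
    proof (cases "j \<le> k")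
      case True
      have "V (Suc j) \<inter> Y (Suc k) = Y j" using desc_rel_Int[OF that(2), of "Suc j"] k True by simp
      thus ?thesis using a[of "Suc k"] True by simp
    qed (use a[of j] in simp)
  qed
  show "Z = Z'" by (rule ext) (simp only: *[OF 1] *[OF 2])
qed

lemma opp_rel_sym:
  assumes "(U, V) \<in> opp_rel n k"
  shows "(V, U) \<in> opp_rel n k"
proof -
  have o: "\<And>i. i \<in> {1..k} \<Longrightarrow> U i \<inter> V (k + 1 - i) = {0\<^sub>v (n + 1)}" using assms by (auto simp: opp_rel_def)
  have "V i \<inter> U (k + 1 - i) = {0\<^sub>v (n + 1)}" if i: "i \<in> {1..k}" for i
  proof -
    have "k + 1 - i \<in> {1..k}" "k + 1 - (k + 1 - i) = i" using i by auto
    thus ?thesis using o[of "k + 1 - i"] by (metis Int_commute)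
  qed
  thus ?thesis using assms by (simp add: opp_rel_def)
qed

lemma opp_rel_0: "opp_rel n 0 = Id_on (flags n)"
proof -
  have "U = V" if "U \<in> flags n" "V \<in> flags n" "\<forall>j>0. U j = V j" for U V :: "nat \<Rightarrow> 'a vec set"
    using that by (intro flag_eqI) auto
  thus ?thesis by (auto simp: opp_rel_def)
qed

lemma desc_rel_0: "desc_rel n 0 = Id_on (flags n)"
proof -
  have "U = V" if "U \<in> flags n" "V \<in> flags n" "\<forall>j>0. U j = V j" for U V :: "nat \<Rightarrow> 'a vec set"
    using that by (intro flag_eqI) auto
  thus ?thesis by (auto simp: desc_rel_def)
qed

text \<open>
Induction on the largest dimension \<open>k\<close> in which the flags differ: change the members below \<open>k\<close>
in both flags into the same full flag of \<open>U\<^sub>k \<inter> V\<^sub>k\<close>, which leaves adjacent flags.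
\<close>

lemma flags_connected:
  fixes U V :: "nat \<Rightarrow> 'a::{field,finite} vec set"
  assumes const: "\<And>U V :: nat \<Rightarrow> 'a vec set. \<And>i. i \<in> {1..n} \<Longrightarrow> (U, V) \<in> adj n i \<Longrightarrow> \<phi> U = \<phi> V"
    and U: "U \<in> flags n" and V: "V \<in> flags n"
  shows "\<phi> U = \<phi> V"
proof -
  have "\<phi> U = \<phi> V" if "k \<le> n" "U \<in> flags n" "V \<in> flags n" "\<And>j. j > k \<Longrightarrow> U j = V j" for k
    and U V :: "nat \<Rightarrow> 'a vec set"
    using that
  proof (induction k arbitrary: U V)
    case 0
    have "U = V" by (rule flag_eqI[OF 0(2,3)]) (use 0(4) in auto)
    thus ?case by simp
  next
    case (Suc k)
    note U = Suc.prems(2) and V = Suc.prems(3) and agree = Suc.prems(4)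
    show ?case
    proof (cases "U (Suc k) = V (Suc k)")
      case True
      show ?thesis
      proof (rule Suc.IH)
        show "U j = V j" if "j > k" for j using that True agree[of j] by (cases "j = Suc k") auto
      qed (use Suc.prems in auto)
    next
      case False
      define D where "D = U (Suc k) \<inter> V (Suc k)"
      have D: "lin_sub (n + 1) D" unfolding D_def
        by (rule lin_sub_Int[OF flag_lin_sub[OF U] flag_lin_sub[OF V]])
      have VS: "V (Suc k) \<subseteq> U (Suc (Suc k))"
        using flag_Suc[OF V, of "Suc k"] agree[of "Suc (Suc k)"] by simp
      have dD: "sdim D = k"
        using distinct_in_common(1)[OF flag_lin_sub[OF U] flag_dim[OF U] flag_lin_sub[OF V] flag_dim[OF V] False
           flag_lin_sub[OF U] flag_Suc[OF U] VS flag_dim[OF U]] Suc.prems(1) by (simp add: D_def)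
      obtain l F where F: "F 0 = {0\<^sub>v (n + 1)}" "F l = D" "\<And>i. i \<le> l \<Longrightarrow> lin_sub (n + 1) (F i)"
        "\<And>i. i \<le> l \<Longrightarrow> card (F i) = CARD('a) ^ i" "\<And>i. i < l \<Longrightarrow> F i \<subseteq> F (Suc i)"
        by (rule lin_sub_full_chain[OF D]) blast
      have "l = k" using sdim_eqI[OF F(4)[of l]] F(2) dD by simp
      note F = F[unfolded \<open>l = k\<close>]
      have dF: "sdim (F i) = i" if "i \<le> k" for i using sdim_eqI[OF F(4)[OF that]] .
      \<comment> \<open>The full flag of the intersection replaces the members up to dimension \<open>k\<close>.\<close>
      define mix where "mix X = (\<lambda>j. if j \<le> k then F j else X j)" for X :: "nat \<Rightarrow> 'a vec set"
      have mix: "mix X \<in> flags n" if X: "X \<in> flags n" and DX: "D \<subseteq> X (Suc k)" for X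
      proof (rule flagI)
        show "mix X i \<subseteq> mix X (Suc i)" for i
        proof (cases i k rule: linorder_cases)
          case equal
          thus ?thesis using DX F(2) by (simp add: mix_def)
        qed (use F(5)[of i] flag_Suc[OF X, of i] in \<open>simp_all add: mix_def\<close>)
      qed (use F(1,3) dF flag_lin_sub[OF X] flag_dim[OF X] flag_top[OF X] Suc.prems(1) in \<open>auto simp: mix_def\<close>)
      have mU: "mix U \<in> flags n" and mV: "mix V \<in> flags n" using mix U V by (auto simp: D_def)
      have "\<phi> U = \<phi> (mix U)" by (rule Suc.IH[OF _ U mU]) (use Suc.prems(1) in \<open>auto simp: mix_def\<close>)
      also have "\<phi> (mix U) = \<phi> (mix V)"
      proof (rule const[of "Suc k"])
        show "(mix U, mix V) \<in> adj n (Suc k)"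
          by (rule adjI[OF mU mV]) (use agree False in \<open>auto simp: mix_def\<close>)
      qed (use Suc.prems(1) in simp)
      also have "\<phi> (mix V) = \<phi> V" by (rule Suc.IH[OF _ mV V]) (use Suc.prems(1) in \<open>auto simp: mix_def\<close>)
      finally show ?thesis .
    qed
  qed
  from this[of n U V] show ?thesis using U V flag_top[OF U] flag_top[OF V] by auto
qed

lemma card_adj:
  fixes U :: "nat \<Rightarrow> 'a::{field,finite} vec set"
  assumes U: "U \<in> flags n" and i: "i \<in> {1..n}"
  shows "card {V. (U, V) \<in> adj n i} = CARD('a)"
proof -
  define B where "B = {W. lin_sub (n + 1) W \<and> U (i - 1) \<subseteq> W \<and> W \<subseteq> U (Suc i) \<and> sdim W = Suc (sdim (U (i - 1)))}"
  have d: "sdim (U (i - 1)) = i - 1" "sdim (U (Suc i)) = Suc i" "sdim (U i) = i"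
    using flag_dim[OF U] i by auto
  have "card B = CARD('a) + 1" unfolding B_def
    by (rule card_panel[OF flag_lin_sub[OF U] flag_lin_sub[OF U] flag_mono[OF U]]) (use d i in auto)
  moreover have "U i \<in> B" using flag_lin_sub[OF U] flag_mono[OF U, of "i - 1" i] flag_Suc[OF U] d i
    by (auto simp: B_def)
  ultimately have "card (B - {U i}) = CARD('a)" by simp
  moreover have "bij_betw (\<lambda>V. V i) {V. (U, V) \<in> adj n i} (B - {U i})"
  proof (rule bij_betw_byWitness[where f' = "\<lambda>W. U(i := W)"])
    show "\<forall>V\<in>{V. (U, V) \<in> adj n i}. U(i := V i) = V" by (auto simp: adj_def fun_eq_iff)
    show "\<forall>W\<in>B - {U i}. (U(i := W)) i = W" by simp
    show "(\<lambda>V. V i) ` {V. (U, V) \<in> adj n i} \<subseteq> B - {U i}"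
    proof
      fix W assume "W \<in> (\<lambda>V. V i) ` {V. (U, V) \<in> adj n i}"
      then obtain V where V: "(U, V) \<in> adj n i" "W = V i" by blast
      note UV = adjD[OF V(1)]
      have "U (i - 1) = V (i - 1)" "U (Suc i) = V (Suc i)" using UV(3) i by auto
      thus "W \<in> B - {U i}"
        using flag_lin_sub[OF UV(2), of i] flag_mono[OF UV(2), of "i - 1" i]
          flag_Suc[OF UV(2), of i] flag_dim[OF UV(2), of i] UV(4) d i
        by (simp add: B_def V(2))
    qed
    show "(\<lambda>W. U(i := W)) ` (B - {U i}) \<subseteq> {V. (U, V) \<in> adj n i}"
    proof
      fix V assume "V \<in> (\<lambda>W. U(i := W)) ` (B - {U i})"
      then obtain W where W: "W \<in> B" "W \<noteq> U i" "V = U(i := W)" by blast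
      have "V \<in> flags n" unfolding W(3)
        by (rule flag_update[OF U i]) (use W(1) d i in \<open>auto simp: B_def\<close>)
      thus "V \<in> {V. (U, V) \<in> adj n i}" using U W by (simp add: adj_def)
    qed
  qed
  ultimately show ?thesis using bij_betw_same_card by fastforce
qed

section \<open>Adjacency matrices of flags\<close>

definition rel_mat :: "nat \<Rightarrow> (nat \<Rightarrow> 'x) \<Rightarrow> ('x \<times> 'x) set \<Rightarrow> real mat" where
  "rel_mat m e R = mat m m (\<lambda>(a, b). of_bool ((e a, e b) \<in> R))"

lemma rel_mat_carrier [simp]: "rel_mat m e R \<in> carrier_mat m m"
  by (simp add: rel_mat_def)

lemma rel_mat_transpose: "(\<And>x y. (x, y) \<in> R \<Longrightarrow> (y, x) \<in> R) \<Longrightarrow> (rel_mat m e R)\<^sup>T = rel_mat m e R"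
  by (intro eq_matI) (auto simp: rel_mat_def)

lemma rel_mat_Id_on:
  assumes "bij_betw e {0..<m} X"
  shows "rel_mat m e (Id_on X) = 1\<^sub>m m"
proof (rule eq_matI)
  fix a b assume "a < dim_row (1\<^sub>m m :: real mat)" "b < dim_col (1\<^sub>m m :: real mat)"
  hence ab: "a < m" "b < m" by simp_all
  have "e a \<in> X" using assms ab by (auto simp: bij_betw_def)
  moreover have "e a = e b \<longleftrightarrow> a = b" 
    using inj_on_eq_iff[OF bij_betw_imp_inj_on[OF assms], of a b] ab by simp
  ultimately show "rel_mat m e (Id_on X) $$ (a, b) = 1\<^sub>m m $$ (a, b)"
    using ab by (simp add: rel_mat_def Id_on_iff)
qed (simp_all add: rel_mat_def)

lemma rel_mat_mult_entry:
  assumes e: "bij_betw e {0..<m} X" and R: "R \<subseteq> X \<times> X" and ab: "a < m" "b < m"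
  shows "(rel_mat m e R * rel_mat m e S) $$ (a, b) = real (card {x. (e a, x) \<in> R \<and> (x, e b) \<in> S})"
proof -
  have "(rel_mat m e R * rel_mat m e S) $$ (a, b) = (\<Sum>c = 0..<m. of_bool ((e a, e c) \<in> R \<and> (e c, e b) \<in> S))"
    using ab by (simp add: rel_mat_def scalar_prod_def of_bool_conj)
  also have "\<dots> = (\<Sum>x\<in>X. of_bool ((e a, x) \<in> R \<and> (x, e b) \<in> S))"
    by (rule sum.reindex_bij_betw[OF e])
  also have "\<dots> = real (card (X \<inter> {x. (e a, x) \<in> R \<and> (x, e b) \<in> S}))"
    using bij_betw_finite[OF e]
      by (simp add: sum.inter_filter[symmetric] of_bool_def Int_def sum.If_cases)
  also have "X \<inter> {x. (e a, x) \<in> R \<and> (x, e b) \<in> S} = {x. (e a, x) \<in> R \<and> (x, e b) \<in> S}" using R by auto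
  finally show ?thesis .
qed

lemma rel_mat_comp:
  assumes e: "bij_betw e {0..<m} X" and R: "R \<subseteq> X \<times> X"
    and unique: "\<And>x y z z'. (x, z) \<in> R \<Longrightarrow> (z, y) \<in> S \<Longrightarrow> (x, z') \<in> R \<Longrightarrow> (z', y) \<in> S \<Longrightarrow> z = z'"
  shows "rel_mat m e R * rel_mat m e S = rel_mat m e (R O S)"
proof (rule eq_matI)
  fix a b assume "a < dim_row (rel_mat m e (R O S))" "b < dim_col (rel_mat m e (R O S))"
  hence ab: "a < m" "b < m" by (simp_all add: rel_mat_def)
  have "real (card {x. (e a, x) \<in> R \<and> (x, e b) \<in> S}) = of_bool ((e a, e b) \<in> R O S)"
  proof (cases "(e a, e b) \<in> R O S")
    case True
    then obtain z where "(e a, z) \<in> R" "(z, e b) \<in> S" by blast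
    hence "{x. (e a, x) \<in> R \<and> (x, e b) \<in> S} = {z}" using unique by blast
    thus ?thesis using True by simp
  next
    case False
    hence "{x. (e a, x) \<in> R \<and> (x, e b) \<in> S} = {}" by blast
    thus ?thesis using False by (simp only: card.empty) simp
  qed
  thus "(rel_mat m e R * rel_mat m e S) $$ (a, b) = rel_mat m e (R O S) $$ (a, b)"
    using rel_mat_mult_entry[OF e R ab, of S] ab by (simp add: rel_mat_def)
qed (simp_all add: rel_mat_def)

lemma adj_subset: "adj n i \<subseteq> flags n \<times> flags n"
  by (auto simp: adj_def)

lemma opp_rel_subset: "opp_rel n k \<subseteq> flags n \<times> flags n"
  by (auto simp: opp_rel_def)

lemma adj_finite: "finite {V :: nat \<Rightarrow> 'a::{field,finite} vec set. (U, V) \<in> adj n i}"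
  by (rule finite_subset[OF _ card_flags(1)[of n]]) (auto simp: adj_def)

lemma adj_trans:
  assumes "(U, Z) \<in> adj n i" "(Z, V) \<in> adj n i" "U \<noteq> V"
  shows "(U, V) \<in> adj n i"
proof (rule adjI)
  show off: "U j = V j" if "j \<noteq> i" for j using adjD(3)[OF assms(1) that] adjD(3)[OF assms(2) that]
    by simp
  show "U i \<noteq> V i" using off assms(3) by (metis ext)
qed (use assms adjD in blast)+

text \<open>
A panel has \<open>q + 1\<close> flags, any two of them adjacent. So the number of flags adjacent to two
given ones is \<open>q\<close> if they coincide, \<open>q - 1\<close> if they are adjacent, and zero otherwise.
\<close>

lemma adj_mat_quadratic:
  fixes e :: "nat \<Rightarrow> nat \<Rightarrow> 'a::{field,finite} vec set"
  assumes e: "bij_betw e {0..<m} (flags n)" and i: "i \<in> {1..n}"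
  defines "T \<equiv> rel_mat m e (adj n i)"
  shows "T * T = (real CARD('a) - 1) \<cdot>\<^sub>m T + real CARD('a) \<cdot>\<^sub>m 1\<^sub>m m"
proof (rule eq_matI)
  fix a b assume "a < dim_row ((real CARD('a) - 1) \<cdot>\<^sub>m T + real CARD('a) \<cdot>\<^sub>m 1\<^sub>m m)"
    "b < dim_col ((real CARD('a) - 1) \<cdot>\<^sub>m T + real CARD('a) \<cdot>\<^sub>m 1\<^sub>m m)"
  hence ab: "a < m" "b < m" by simp_all
  have ea: "e a \<in> flags n" using e ab by (auto simp: bij_betw_def)
  have inj: "e a = e b \<longleftrightarrow> a = b" using inj_on_eq_iff[OF bij_betw_imp_inj_on[OF e], of a b] ab by simp
  have "real (card {x. (e a, x) \<in> adj n i \<and> (x, e b) \<in> adj n i}) =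
      (real CARD('a) - 1) * of_bool ((e a, e b) \<in> adj n i) + real CARD('a) * of_bool (a = b)"
  proof (cases "a = b")
    case True
    have "{x. (e a, x) \<in> adj n i \<and> (x, e b) \<in> adj n i} = {x. (e a, x) \<in> adj n i}" using True adj_sym
      by blast
    moreover have "(e a, e b) \<notin> adj n i" using True adjD(4) by blast
    ultimately show ?thesis using True card_adj[OF ea i] by simp
  next
    case False
    show ?thesis
    proof (cases "(e a, e b) \<in> adj n i")
      case True
      have "{x. (e a, x) \<in> adj n i \<and> (x, e b) \<in> adj n i} = {x. (e a, x) \<in> adj n i} - {e b}"
      proof -
        have "(x, e b) \<in> adj n i" if "(e a, x) \<in> adj n i" "x \<noteq> e b" for x
          by (rule adj_trans[OF adj_sym[OF that(1)] True that(2)])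
        moreover have "(e b, e b) \<notin> adj n i" using adjD(4) by blast
        ultimately show ?thesis by blast
      qed
      moreover have "CARD('a) \<ge> 1" using CARD_field_ge_2[where 'a = 'a] by simp
      ultimately show ?thesis using True False card_adj[OF ea i] adj_finite[of "e a" n i]
        by (simp add: of_nat_diff)
    next
      case nadj: False
      have "{x. (e a, x) \<in> adj n i \<and> (x, e b) \<in> adj n i} = {}" using nadj adj_trans inj False by blast
      thus ?thesis using False nadj by (simp only: card.empty) simp
    qed
  qed
  thus "(T * T) $$ (a, b) = ((real CARD('a) - 1) \<cdot>\<^sub>m T + real CARD('a) \<cdot>\<^sub>m 1\<^sub>m m) $$ (a, b)"
    using rel_mat_mult_entry[OF e adj_subset ab, of i "adj n i"] ab unfolding T_def
    by (simp add: rel_mat_def)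
qed (simp_all add: T_def rel_mat_def)

lemma adj_mats_hecke:
  fixes e :: "nat \<Rightarrow> nat \<Rightarrow> 'a::{field,finite} vec set"
  assumes e: "bij_betw e {0..<m} (flags n)"
  shows "hecke_generators m n (real CARD('a)) (\<lambda>i. rel_mat m e (adj n i))"
proof
  show "rel_mat m e (adj n i) * rel_mat m e (adj n i) =
      (real CARD('a) - 1) \<cdot>\<^sub>m rel_mat m e (adj n i) + real CARD('a) \<cdot>\<^sub>m 1\<^sub>m m" if "i \<in> {1..n}" for i
    by (rule adj_mat_quadratic[OF e that])
  have AA: "rel_mat m e (adj n i) * rel_mat m e (adj n j) = rel_mat m e (adj n i O adj n j)"
    if "i \<noteq> j" for i j
    by (rule rel_mat_comp[OF e adj_subset]) (rule adj_adj_unique[OF that])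
  have sub: "adj n i O adj n j \<subseteq> flags n \<times> flags n" for i j using adj_subset by blast
  show "rel_mat m e (adj n i) * rel_mat m e (adj n (Suc i)) * rel_mat m e (adj n i) =
      rel_mat m e (adj n (Suc i)) * rel_mat m e (adj n i) * rel_mat m e (adj n (Suc i))" if i: "i \<in>
        {1..<n}" for i
  proof -
    have "rel_mat m e (adj n i O adj n (Suc i)) * rel_mat m e (adj n i) = rel_mat m e ((adj n i O adj n (Suc i)) O adj n i)"
      by (rule rel_mat_comp[OF e sub]) (rule braid_unique_up[OF i])
    moreover have "rel_mat m e (adj n (Suc i) O adj n i) * rel_mat m e (adj n (Suc i)) = rel_mat m e ((adj n (Suc i) O adj n i) O adj n (Suc i))"
      by (rule rel_mat_comp[OF e sub]) (rule braid_unique_down[OF i])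
    ultimately show ?thesis using AA[of i "Suc i"] AA[of "Suc i" i]
      by (simp add: O_assoc adj_braid_rel[OF i])
  qed
  show "rel_mat m e (adj n i) * rel_mat m e (adj n j) = rel_mat m e (adj n j) * rel_mat m e (adj n i)"
    if "i \<in> {1..n}" "j \<in> {1..n}" "i + 1 < j" for i j
    using AA[of i j] AA[of j i] that(3) by (simp add: adj_comp_commute[OF that])
qed simp

lemma desc_word_rel_mat:
  assumes e: "bij_betw e {0..<m} (flags n)" and k: "k \<le> n"
  shows "desc_word m (\<lambda>i. rel_mat m e (adj n i)) k = rel_mat m e (desc_rel n k)"
  using k
proof (induction k)
  case 0
  thus ?case using rel_mat_Id_on[OF e] by (simp add: desc_rel_0)
next
  case (Suc k)
  have "rel_mat m e (adj n (Suc k)) * rel_mat m e (desc_rel n k) = rel_mat m e (adj n (Suc k) O desc_rel n k)"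
    by (rule rel_mat_comp[OF e adj_subset]) (rule adj_desc_rel(2); use Suc.prems in simp)
  thus ?case using Suc by (simp add: adj_desc_rel(1))
qed

lemma long_word_rel_mat:
  assumes e: "bij_betw e {0..<m} (flags n)" and k: "k \<le> n"
  shows "long_word m (\<lambda>i. rel_mat m e (adj n i)) k = rel_mat m e (opp_rel n k)"
  using k
proof (induction k)
  case 0
  thus ?case using rel_mat_Id_on[OF e] by (simp add: opp_rel_0)
next
  case (Suc k)
  have "rel_mat m e (opp_rel n k) * rel_mat m e (desc_rel n (Suc k)) = rel_mat m e (opp_rel n k O desc_rel n (Suc k))"
    by (rule rel_mat_comp[OF e opp_rel_subset]) (rule opp_desc_rel(2); use Suc.prems in simp)
  thus ?case using Suc desc_word_rel_mat[OF e Suc.prems]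
    by (simp add: opp_desc_rel(1) del: desc_word.simps)
qed

lemma adj_mat_mult_vec:
  assumes e: "bij_betw e {0..<m} (flags n)" and a: "a < m" and v: "v \<in> carrier_vec m"
  shows "(cmat (rel_mat m e (adj n i)) *\<^sub>v v) $ a = (\<Sum>V | (e a, V) \<in> adj n i. v $ the_inv_into {0..<m} e V)"
proof -
  have inj: "inj_on e {0..<m}" using e by (simp add: bij_betw_def)
  have "(cmat (rel_mat m e (adj n i)) *\<^sub>v v) $ a = (\<Sum>b = 0..<m. (if (e a, e b) \<in> adj n i then v $ b else 0))"
    using a v by (auto simp: rel_mat_def scalar_prod_def intro!: sum.cong)
  also have "\<dots> = (\<Sum>b = 0..<m. (if (e a, e b) \<in> adj n i then v $ the_inv_into {0..<m} e (e b) else 0))"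
    using the_inv_into_f_f[OF inj] by (intro sum.cong) auto
  also have "\<dots> = (\<Sum>V\<in>flags n. (if (e a, V) \<in> adj n i then v $ the_inv_into {0..<m} e V else 0))"
    by (rule sum.reindex_bij_betw[OF e])
  also have "\<dots> = (\<Sum>V | (e a, V) \<in> adj n i. v $ the_inv_into {0..<m} e V)"
    using bij_betw_finite[OF e] adj_subset[of n i] by (intro sum.mono_neutral_cong_right) auto
  finally show ?thesis .
qed

text \<open>
The equation for \<open>T\<^sub>i\<close> says that \<open>q + 1\<close> times the value at a flag is the sum over its panel of
type \<open>i\<close>. So the vector is constant on panels, and \<open>flags_connected\<close> applies.
\<close>

lemma adj_mats_common_eigenvector:
  fixes e :: "nat \<Rightarrow> nat \<Rightarrow> 'a::{field,finite} vec set"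
  assumes e: "bij_betw e {0..<m} (flags n)" and v: "v \<in> carrier_vec m"
    and fx: "\<And>i. i \<in> {1..n} \<Longrightarrow> cmat (rel_mat m e (adj n i)) *\<^sub>v v = complex_of_real (real CARD('a)) \<cdot>\<^sub>v v"
  shows "\<exists>c. v = c \<cdot>\<^sub>v ones m"
proof -
  define \<phi> where "\<phi> V = v $ the_inv_into {0..<m} e V" for V
  have inj: "inj_on e {0..<m}" using e by (simp add: bij_betw_def)
  have \<phi>e: "\<phi> (e a) = v $ a" if "a < m" for a using the_inv_into_f_f[OF inj, of a] that
    by (simp add: \<phi>_def)
  have sum: "(\<Sum>V | (U, V) \<in> adj n i. \<phi> V) = of_nat CARD('a) * \<phi> U" if U: "U \<in> flags n"
    and i: "i \<in> {1..n}" for U i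
  proof -
    have "U \<in> e ` {0..<m}" using bij_betw_imp_surj_on[OF e] U by simp
    then obtain a where a: "a < m" "U = e a" by auto
    have "(cmat (rel_mat m e (adj n i)) *\<^sub>v v) $ a = (\<Sum>V | (U, V) \<in> adj n i. \<phi> V)"
      unfolding a(2) \<phi>_def by (rule adj_mat_mult_vec[OF e a(1) v])
    thus ?thesis using a v \<phi>e[OF a(1)] by (simp add: fx[OF i])
  qed
  have const: "\<phi> U = \<phi> V" if i: "i \<in> {1..n}" and UV: "(U, V) \<in> adj n i" for U V i
  proof -
    have P: "(\<Sum>W\<in>insert X {W. (X, W) \<in> adj n i}. \<phi> W) = of_nat (CARD('a) + 1) * \<phi> X"
      if "X \<in> flags n" for X
    proof -
      have "X \<notin> {W. (X, W) \<in> adj n i}" using adjD(4)[of X X n i] by blast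
      thus ?thesis using sum[OF that i] by (simp add: sum.insert[OF adj_finite] algebra_simps)
    qed
    have "insert U {W. (U, W) \<in> adj n i} = insert V {W. (V, W) \<in> adj n i}"
      using UV adj_sym[OF UV] adj_trans[of U V n i] adj_trans[of V U n i] by blast
    hence "of_nat (CARD('a) + 1) * \<phi> U = of_nat (CARD('a) + 1) * \<phi> V"
      using P[OF adjD(1)[OF UV]] P[OF adjD(2)[OF UV]] by metis
    thus ?thesis by (simp only: mult_cancel_left of_nat_eq_0_iff) simp
  qed
  show ?thesis
  proof (intro exI eq_vecI)
    fix a assume "a < dim_vec (v $ 0 \<cdot>\<^sub>v ones m)"
    hence a: "a < m" "0 < m" by (auto simp: ones_def)
    have ea: "e a \<in> flags n" "e 0 \<in> flags n" using e a by (auto simp: bij_betw_def)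
    have "\<phi> (e a) = \<phi> (e 0)" by (rule flags_connected[OF const ea])
    thus "v $ a = (v $ 0 \<cdot>\<^sub>v ones m) $ a" using a \<phi>e by (simp add: ones_def)
  qed (use v in \<open>simp add: ones_def\<close>)
qed

theorem flags_coclique_bound:
  fixes S :: "(nat \<Rightarrow> 'a::{field,finite} vec set) set"
  assumes n: "n \<ge> 1" and S: "S \<subseteq> flags n" and indep: "\<And>U V. U \<in> S \<Longrightarrow> V \<in> S \<Longrightarrow> (U, V) \<notin> opp_rel n n"
  shows "real (card S) \<le> (\<Prod>k = 1..n + 1. gauss_num CARD('a) k) / (1 + real CARD('a) powr ((real n + 1) / 2))"
proof -
  define m where "m = card (flags n :: (nat \<Rightarrow> 'a vec set) set)"
  obtain e where e: "bij_betw e {0..<m} (flags n :: (nat \<Rightarrow> 'a vec set) set)"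
    using ex_bij_betw_nat_finite[OF card_flags(1)] unfolding m_def by blast
  define T where "T i = rel_mat m e (adj n i)" for i
  define I where "I = {a \<in> {0..<m}. e a \<in> S}"
  have "e ` I = e ` {0..<m} \<inter> S" by (auto simp: I_def)
  hence "e ` I = S" using bij_betw_imp_surj_on[OF e] S by auto
  moreover have "inj_on e I" using e by (auto simp: bij_betw_def I_def inj_on_def)
  ultimately have cI: "card I = card S" by (metis card_image)
  have "real (card I) \<le> real m / (1 + real CARD('a) powr ((real n + 1) / 2))"
  proof (rule hecke_coclique_bound[where T = T])
    show "hecke_generators m n (real CARD('a)) T" unfolding T_def by (rule adj_mats_hecke[OF e])
    show "1 < real CARD('a)" using CARD_field_ge_2[where 'a = 'a] by simp
    show "(T i)\<^sup>T = T i" for i unfolding T_def by (rule rel_mat_transpose) (rule adj_sym)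
    show "(long_word m T k)\<^sup>T = long_word m T k" if "k \<le> n" for k
      unfolding T_def long_word_rel_mat[OF e that] by (rule rel_mat_transpose) (rule opp_rel_sym)
    show "T i *\<^sub>v ones m = real CARD('a) \<cdot>\<^sub>v ones m" if i: "i \<in> {1..n}" for i
    proof (rule eq_vecI)
      fix a assume "a < dim_vec (real CARD('a) \<cdot>\<^sub>v ones m)"
      hence a: "a < m" by (simp add: ones_def)
      have ea: "e a \<in> flags n" using e a by (auto simp: bij_betw_def)
      have "(T i *\<^sub>v ones m) $ a = (\<Sum>b = 0..<m. of_bool ((e a, e b) \<in> adj n i))"
        using a by (simp add: T_def rel_mat_def scalar_prod_def ones_def)
      also have "\<dots> = (\<Sum>V\<in>flags n. of_bool ((e a, V) \<in> adj n i))" by (rule sum.reindex_bij_betw[OF e])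
      also have "\<dots> = (\<Sum>V | (e a, V) \<in> adj n i. 1)"
        using card_flags(1) adj_subset[of n i] by (intro sum.mono_neutral_cong_right) auto
      also have "\<dots> = real CARD('a)" using card_adj[OF ea i] by simp
      finally show "(T i *\<^sub>v ones m) $ a = (real CARD('a) \<cdot>\<^sub>v ones m) $ a" using a
        by (simp add: ones_def)
    qed (simp add: T_def rel_mat_def ones_def)
    show "\<exists>c. v = c \<cdot>\<^sub>v ones m" if "v \<in> carrier_vec m"
      "\<And>i. i \<in> {1..n} \<Longrightarrow> cmat (T i) *\<^sub>v v = complex_of_real (real CARD('a)) \<cdot>\<^sub>v v" for v
      using adj_mats_common_eigenvector[OF e that(1)] that(2) by (simp add: T_def)
    show "long_word m T n $$ (a, b) = 0" if "a \<in> I" "b \<in> I" for a b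
      using that indep unfolding T_def long_word_rel_mat[OF e order_refl]
        by (auto simp: rel_mat_def I_def)
  qed (use n in \<open>auto simp: I_def\<close>)
  thus ?thesis unfolding cI m_def card_flags(2) .
qed

section \<open>Flags of the projective space\<close>

lemma pg_subspace_lin_sub:
  assumes "pg_subspace n (U :: 'a::field vec set)"
  shows "lin_sub (n + 1) U"
proof -
  have sm: "submodule class_ring U (pg_space TYPE('a) n)"
    using assms unfolding pg_subspace_def by (rule subspace.submod)
  show ?thesis
    unfolding lin_sub_def
    using submodule.subset[OF sm] submodule.zero_closed[OF sm] submodule.m_closed[OF sm]
      submodule.smult_closed[OF sm]
    by (auto simp: module_vec_simps)
qed

lemma pg_subspace_vectorspace:
  assumes "pg_subspace n (U :: 'a::field vec set)"
  shows "vectorspace class_ring ((pg_space TYPE('a) n)\<lparr>carrier := U\<rparr>)"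
proof -
  interpret V: vectorspace class_ring "pg_space TYPE('a) n" by (rule vec_vs)
  show ?thesis using V.subspace_is_vs assms unfolding pg_subspace_def by blast
qed

text \<open>
The dimension is the least size of a generating set, and the coefficients of linear combinations
leave \<open>q\<close> choices for each generator.
\<close>

lemma card_le_pg_dim:
  fixes U :: "'a::{field,finite} vec set"
  assumes U: "pg_subspace n U"
  shows "card U \<le> CARD('a) ^ pg_dim n U"
proof -
  have fin: "finite U" by (rule lin_sub_finite[OF pg_subspace_lin_sub[OF U]])
  interpret W: vectorspace class_ring "(pg_space TYPE('a) n)\<lparr>carrier := U\<rparr>"
    by (rule pg_subspace_vectorspace[OF U])
  have "W.gen_set U" using W.in_own_span[of U] W.span_is_subset2[of U] by auto
  hence "\<exists>k A. finite A \<and> card A = k \<and> A \<subseteq> carrier ((pg_space TYPE('a) n)\<lparr>carrier := U\<rparr>) \<and> W.gen_set A"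
    using fin by (intro exI[of _ "card U"] exI[of _ U]) auto
  hence "\<exists>A. finite A \<and> card A = W.dim \<and> A \<subseteq> carrier ((pg_space TYPE('a) n)\<lparr>carrier := U\<rparr>) \<and> W.gen_set A"
    unfolding W.dim_def by (rule LeastI_ex)
  then obtain A where A: "finite A" "card A = W.dim" "A \<subseteq> carrier ((pg_space TYPE('a) n)\<lparr>carrier := U\<rparr>)" "W.gen_set A"
    by blast
  have "U = {W.lincomb a A | a. a \<in> A \<rightarrow> UNIV}"
    using W.finite_span[OF A(1,3)] A(4) by simp
  also have "\<dots> \<subseteq> (\<lambda>a. W.lincomb a A) ` (A \<rightarrow>\<^sub>E UNIV)"
  proof
    fix x assume "x \<in> {W.lincomb a A | a. a \<in> A \<rightarrow> UNIV}"
    then obtain a where a: "x = W.lincomb a A" by blast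
    have "W.lincomb a A = W.lincomb (restrict a A) A"
      by (rule W.lincomb_cong[OF refl A(3)]) auto
    thus "x \<in> (\<lambda>a. W.lincomb a A) ` (A \<rightarrow>\<^sub>E UNIV)" unfolding a
      by (intro image_eqI[of _ _ "restrict a A"]) auto
  qed
  finally have "card U \<le> card ((\<lambda>a. W.lincomb a A) ` (A \<rightarrow>\<^sub>E (UNIV :: 'a set)))"
    by (rule card_mono[OF finite_imageI[OF finite_PiE[OF A(1)]], rotated]) simp
  also have "\<dots> \<le> card (A \<rightarrow>\<^sub>E (UNIV :: 'a set))" by (intro card_image_le finite_PiE A(1)) simp
  also have "\<dots> = CARD('a) ^ card A" using A(1) by (simp add: card_PiE)
  finally show "card U \<le> CARD('a) ^ pg_dim n U" unfolding pg_dim_def A(2) .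
qed

lemma pg_dim_zero: "pg_dim n {0\<^sub>v (n + 1) :: 'a::field vec} = 0"
proof -
  interpret V: vectorspace class_ring "pg_space TYPE('a) n" by (rule vec_vs)
  have z: "pg_subspace n {0\<^sub>v (n + 1) :: 'a vec}"
    unfolding pg_subspace_def
    by (intro subspace.intro V.vectorspace_axioms submodule.intro V.module_axioms)
      (auto simp: module_vec_simps)
  interpret Z: vectorspace class_ring "(pg_space TYPE('a) n)\<lparr>carrier := {0\<^sub>v (n + 1)}\<rparr>"
    by (rule pg_subspace_vectorspace[OF z])
  have "Z.gen_set {}" using Z.span_empty by (simp add: module_vec_simps)
  hence "Z.dim = 0" unfolding Z.dim_def by (intro Least_eq_0 exI[of _ "{}"]) auto
  thus "pg_dim n {0\<^sub>v (n + 1) :: 'a vec} = 0" by (simp add: pg_dim_def)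
qed

text \<open>
Strict inclusions force the number of elements up to \<open>q\<^sup>i\<close>, and \<open>card_le_pg_dim\<close> bounds it by
\<open>q\<^sup>i\<close>. The chain starts properly because the zero space has dimension zero.
\<close>

lemma maximal_flag_sequence:
  fixes f :: "'a::{field,finite} vec set set"
  assumes f: "maximal_flag n f"
  obtains U where "U \<in> flags n" "f = U ` {1..n}"
proof -
  from f[unfolded maximal_flag_def] obtain U where U: "f = U ` {1..n} \<and>
      (\<forall>i\<in>{1..n}. pg_subspace n (U i) \<and> pg_dim n (U i) = i) \<and> (\<forall>i\<in>{1..<n}. U i \<subset> U (i + 1))"
    by (rule exE)
  have fU: "f = U ` {1..n}" using U by (rule conjunct1)
  have sub: "pg_subspace n (U i)" and dim: "pg_dim n (U i) = i" if "i \<in> {1..n}" for i using U that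
    by simp_all
  have inc: "U i \<subset> U (i + 1)" if "i \<in> {1..<n}" for i using U that by simp
  note lin = pg_subspace_lin_sub[OF sub]
  have up: "sdim (U i) \<le> i" if i: "i \<in> {1..n}" for i
  proof -
    have "CARD('a) ^ sdim (U i) \<le> CARD('a) ^ i"
      using card_le_pg_dim[OF sub[OF i]] card_lin_sub[OF lin[OF i]] dim[OF i] by simp
    thus ?thesis using CARD_field_ge_2[where 'a = 'a] by (simp add: power_increasing_iff)
  qed
  have lo: "i \<le> sdim (U i)" if "i \<in> {1..n}" for i
    using that
  proof (induction i)
    case (Suc i)
    show ?case
    proof (cases "i = 0")
      case True
      have "U 1 \<noteq> {0\<^sub>v (n + 1)}" using dim[of 1] pg_dim_zero[of n, where 'a = 'a] Suc.prems True by auto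
      hence "sdim (U 1) \<noteq> 0" using sdim_0D[OF lin[of 1]] Suc.prems True by auto
      thus ?thesis using True by simp
    next
      case False
      hence i: "i \<in> {1..n}" "i \<in> {1..<n}" using Suc.prems by auto
      have "sdim (U i) < sdim (U (Suc i))"
        using sdim_strict_mono[OF lin[OF i(1)] lin[OF Suc.prems]] inc[OF i(2)] by auto
      thus ?thesis using Suc.IH[OF i(1)] by simp
    qed
  qed simp
  define F where "F i = (if i = 0 then {0\<^sub>v (n + 1)} else if i \<le> n then U i else carrier_vec (n + 1))" for i
  have "F \<in> flags n"
  proof (rule flagI)
    show "sdim (F i) = i" if "i \<in> {1..n}" for i using up[OF that] lo[OF that] that by (simp add: F_def)
    show "lin_sub (n + 1) (F i)" if "i \<in> {1..n}" for i using lin[OF that] that by (simp add: F_def)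
    show "F i \<subseteq> F (Suc i)" if "i \<in> {1..<n}" for i using inc[OF that] that by (auto simp: F_def)
  qed (auto simp: F_def)
  moreover have "f = F ` {1..n}" unfolding fU by (intro image_cong) (auto simp: F_def)
  ultimately show ?thesis by (rule that)
qed

section \<open>Opposite flags in the projective linear group\<close>

lemma lin_sub_mat_mult_vec:
  fixes B :: "'a::field mat"
  assumes U: "lin_sub N U" and B: "B \<in> carrier_mat N d" and x: "x \<in> carrier_vec d"
    and cols: "\<And>j. j < d \<Longrightarrow> x $ j \<noteq> 0 \<Longrightarrow> col B j \<in> U"
  shows "B *\<^sub>v x \<in> U"
proof -
  have "B *\<^sub>v vec d (\<lambda>j. if j < k then x $ j else 0) \<in> U" if "k \<le> d" for k
    using that
  proof (induction k)
    case 0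
    have "vec d (\<lambda>j. if j < 0 then x $ j else 0) = 0\<^sub>v d" by (intro eq_vecI) auto
    thus ?case using mult_mat_zero_vec[OF B] lin_sub_zeroD[OF U] by simp
  next
    case (Suc k)
    define y where "y = vec d (\<lambda>j. if j < k then x $ j else 0)"
    have y: "y \<in> carrier_vec d" by (simp add: y_def)
    have cB: "col B k \<in> carrier_vec N" using B by auto
    have "vec d (\<lambda>j. if j < Suc k then x $ j else 0) = y + x $ k \<cdot>\<^sub>v unit_vec d k"
      using Suc.prems by (intro eq_vecI) (auto simp: y_def less_Suc_eq)
    moreover have "B *\<^sub>v unit_vec d k = col B k" using B Suc.prems by (auto intro!: eq_vecI)
    ultimately have eq: "B *\<^sub>v vec d (\<lambda>j. if j < Suc k then x $ j else 0) = B *\<^sub>v y + x $ k \<cdot>\<^sub>v col B k"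
      using B y by (simp add: mult_add_distrib_mat_vec[of _ N d] mult_mat_vec[of _ N d])
    have "x $ k \<cdot>\<^sub>v col B k \<in> U"
    proof (cases "x $ k = 0")
      case True
      hence "x $ k \<cdot>\<^sub>v col B k = 0\<^sub>v N" using B by (intro eq_vecI) auto
      thus ?thesis using lin_sub_zeroD[OF U] by simp
    next
      case False
      thus ?thesis using lin_sub_smult[OF U] cols[of k] Suc.prems by auto
    qed
    thus ?case unfolding eq using Suc lin_sub_add[OF U] by (simp add: y_def)
  qed
  from this[of d] have "B *\<^sub>v vec d (\<lambda>j. if j < d then x $ j else 0) \<in> U" by simp
  moreover have "vec d (\<lambda>j. if j < d then x $ j else 0) = x" using x by (intro eq_vecI) auto
  ultimately show ?thesis by simp
qed

definition std_frame :: "nat \<Rightarrow> nat \<Rightarrow> 'a::field mat" where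
  "std_frame n i = mat (n + 1) i (\<lambda>(r, c). if r = c then 1 else 0)"

lemma std_span_range:
  assumes i: "i \<le> n + 1"
  shows "pg_span n (basis_vec n ` {1..i}) = (\<lambda>x. std_frame n i *\<^sub>v x) ` (carrier_vec i :: 'a::field vec set)"
proof -
  interpret V: vec_space "TYPE('a)" "n + 1" .
  define E :: "'a mat" where "E = std_frame n i"
  have E: "E \<in> carrier_mat (n + 1) i" by (simp add: E_def std_frame_def)
  have "col E j = basis_vec n (Suc j)" if "j < i" for j
    using that i by (intro eq_vecI) (auto simp: E_def std_frame_def basis_vec_def)
  hence "set (cols E) = (\<lambda>j. basis_vec n (Suc j)) ` {0..<i}" using E by (auto simp: cols_def)
  also have "\<dots> = basis_vec n ` Suc ` {0..<i}" by (simp only: image_image)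
  also have "Suc ` {0..<i} = {1..i}"
    by (simp add: image_Suc_atLeastLessThan atLeastLessThanSuc_atLeastAtMost)
  finally have "pg_span n (basis_vec n ` {1..i}) = V.col_space E" 
    by (simp only: pg_span_def V.col_space_def)
  also have "\<dots> = (\<lambda>x. E *\<^sub>v x) ` carrier_vec i" unfolding V.col_space_eq[OF E] using E by auto
  finally show ?thesis by (simp only: E_def)
qed

text \<open>
The image lies in \<open>U\<^sub>i\<close> since the first \<open>i\<close> columns do, and it has as many elements as \<open>U\<^sub>i\<close>
since \<open>A\<close> is injective.
\<close>

lemma mat_maps_std_span:
  fixes A :: "'a::{field,finite} mat"
  assumes A: "A \<in> carrier_mat (n + 1) (n + 1)" "det A \<noteq> 0" and U: "U \<in> flags n"
    and cols: "\<And>j. j \<le> n \<Longrightarrow> col A j \<in> U (Suc j)" and i: "i \<le> n"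
  shows "(\<lambda>v. A *\<^sub>v v) ` pg_span n (basis_vec n ` {1..i}) = U i"
proof -
  define E :: "'a mat" where "E = std_frame n i"
  have E: "E \<in> carrier_mat (n + 1) i" by (simp add: E_def std_frame_def)
  have AE: "A * E \<in> carrier_mat (n + 1) i" using A E by simp
  have img: "(\<lambda>v. A *\<^sub>v v) ` pg_span n (basis_vec n ` {1..i}) = (\<lambda>x. (A * E) *\<^sub>v x) ` carrier_vec i"
    using i std_span_range[of i n, where 'a = 'a] A E by (simp add: image_image E_def[symmetric])
  have colAE: "col (A * E) j = col A j" if j: "j < i" for j
  proof -
    have "col E j = unit_vec (n + 1) j" using j i by (intro eq_vecI) (auto simp: E_def std_frame_def)
    moreover have "A *\<^sub>v unit_vec (n + 1) j = col A j" using A j i by (auto intro!: eq_vecI)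
    ultimately show ?thesis using col_mult2[OF A(1) E j] by simp
  qed
  have sub: "(\<lambda>x. (A * E) *\<^sub>v x) ` carrier_vec i \<subseteq> U i"
  proof (rule image_subsetI)
    fix x :: "'a vec" assume x: "x \<in> carrier_vec i"
    show "(A * E) *\<^sub>v x \<in> U i"
    proof (rule lin_sub_mat_mult_vec[OF flag_lin_sub[OF U] AE x])
      fix j assume "j < i"
      thus "col (A * E) j \<in> U i" using colAE[of j] cols[of j] flag_mono[OF U, of "Suc j" i] i by auto
    qed
  qed
  have "inj_on (\<lambda>x. (A * E) *\<^sub>v x) (carrier_vec i)"
  proof -
    have "injective_mat (A * E)"
    proof (rule injective_matI[OF AE])
      fix x :: "'a vec" assume x: "x \<in> carrier_vec i" and z: "(A * E) *\<^sub>v x = 0\<^sub>v (n + 1)"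
      have "A *\<^sub>v (E *\<^sub>v x) = 0\<^sub>v (n + 1)" using z A E x by simp
      hence Ez: "E *\<^sub>v x = 0\<^sub>v (n + 1)" using A(2) det_0_iff_vec_prod_zero[OF A(1)] E x
        by (meson mult_mat_vec_carrier)
      have "x $ j = 0" if j: "j < i" for j
      proof -
        have "row E j = unit_vec i j" using j i by (intro eq_vecI) (auto simp: E_def std_frame_def)
        hence "(E *\<^sub>v x) $ j = x $ j" using E x j i by simp
        thus ?thesis using Ez j i by simp
      qed
      thus "x = 0\<^sub>v i" using x by (intro eq_vecI) auto
    qed
    thus ?thesis using injective_mat_cancel[OF AE] by (intro inj_onI)
  qed
  hence "card ((\<lambda>x. (A * E) *\<^sub>v x) ` carrier_vec i) = CARD('a) ^ i"
    using card_carrier_vec[of i, where 'a = 'a] by (simp add: card_image)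
  moreover have "card (U i) = CARD('a) ^ i"
    using card_lin_sub[OF flag_lin_sub[OF U, of i]] flag_dim[OF U, of i] i by simp
  ultimately show ?thesis unfolding img
    using card_subset_eq[OF lin_sub_finite[OF flag_lin_sub[OF U]] sub] by simp
qed

lemma GL_group: "group (GL n :: 'a::field mat monoid)"
  unfolding GL_def by (rule monoid.units_group) (use ring_mat[of "n + 1" "()", where 'a = 'a] in \<open>simp add: ring_def\<close>)

lemma GL_carrier: "A \<in> carrier (GL n) \<longleftrightarrow> A \<in> carrier_mat (n + 1) (n + 1) \<and> det A \<noteq> (0 :: 'a::field)"
proof
  assume "A \<in> carrier (GL n)"
  hence U: "A \<in> Units (ring_mat TYPE('a) (n + 1) ())" by (simp add: GL_def units_of_carrier)
  hence "A \<in> carrier_mat (n + 1) (n + 1)" by (simp add: Units_def ring_mat_simps)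
  thus "A \<in> carrier_mat (n + 1) (n + 1) \<and> det A \<noteq> 0" using unit_imp_det_non_zero[OF U] by auto
next
  assume "A \<in> carrier_mat (n + 1) (n + 1) \<and> det A \<noteq> 0"
  thus "A \<in> carrier (GL n)" using det_non_zero_imp_unit[of A "n + 1" "()"]
    by (auto simp: GL_def units_of_carrier)
qed

lemma GL_mult: "A \<otimes>\<^bsub>GL n\<^esub> B = A * B"
  by (simp add: GL_def units_of_mult ring_mat_simps)

lemma GL_one: "\<one>\<^bsub>GL n\<^esub> = 1\<^sub>m (n + 1)"
  by (simp add: GL_def units_of_one ring_mat_simps)

lemma scalar_mats_normal: "(scalar_mats n :: 'a::field mat set) \<lhd> GL n"
proof -
  interpret G: group "GL n :: 'a mat monoid" by (rule GL_group)
  have sc: "c \<cdot>\<^sub>m 1\<^sub>m (n + 1) \<in> carrier (GL n)" if "c \<noteq> 0" for c :: 'a using that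
    by (simp add: GL_carrier)
  have mult: "(c \<cdot>\<^sub>m 1\<^sub>m (n + 1)) * A = c \<cdot>\<^sub>m A" "A * (c \<cdot>\<^sub>m 1\<^sub>m (n + 1)) = c \<cdot>\<^sub>m A" 
    if "A \<in> carrier_mat (n + 1) (n + 1)" for c :: 'a and A
    using that by (simp_all add: mult_smult_assoc_mat[of _ "n + 1" "n + 1" _ "n + 1"] mult_smult_distrib[of _ "n + 1" "n + 1" _ "n + 1"])
  have smm: "(c \<cdot>\<^sub>m 1\<^sub>m (n + 1)) * (d \<cdot>\<^sub>m 1\<^sub>m (n + 1)) = (c * d) \<cdot>\<^sub>m 1\<^sub>m (n + 1)" for c d :: 'a
    by (subst mult(1)) (auto intro!: eq_matI)
  have "subgroup (scalar_mats n) (GL n :: 'a mat monoid)"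
  proof (rule G.subgroupI)
    show "scalar_mats n \<subseteq> carrier (GL n :: 'a mat monoid)" using sc by (auto simp: scalar_mats_def)
    show "(scalar_mats n :: 'a mat set) \<noteq> {}" by (auto simp: scalar_mats_def intro: exI[of _ 1])
  next
    fix A :: "'a mat" assume "A \<in> scalar_mats n"
    then obtain c where c: "c \<noteq> 0" "A = c \<cdot>\<^sub>m 1\<^sub>m (n + 1)" by (auto simp: scalar_mats_def)
    have "inverse c \<cdot>\<^sub>m 1\<^sub>m (n + 1) * (c \<cdot>\<^sub>m 1\<^sub>m (n + 1)) = (1\<^sub>m (n + 1) :: 'a mat)"
      unfolding smm using c by (intro eq_matI) auto
    hence "inv\<^bsub>GL n\<^esub> A = inverse c \<cdot>\<^sub>m 1\<^sub>m (n + 1)"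
      unfolding c(2) by (intro G.inv_equality sc) (use c in \<open>simp_all add: GL_mult GL_one\<close>)
    thus "inv\<^bsub>GL n\<^esub> A \<in> scalar_mats n" using c by (auto simp: scalar_mats_def)
  next
    fix A B :: "'a mat" assume "A \<in> scalar_mats n" "B \<in> scalar_mats n"
    then obtain c d where "c \<noteq> 0" "A = c \<cdot>\<^sub>m 1\<^sub>m (n + 1)" "d \<noteq> 0" "B = d \<cdot>\<^sub>m 1\<^sub>m (n + 1)"
      by (auto simp: scalar_mats_def)
    thus "A \<otimes>\<^bsub>GL n\<^esub> B \<in> scalar_mats n" unfolding GL_mult using smm by (auto simp: scalar_mats_def)
  qed
  thus ?thesis
  proof (rule G.normalI, intro ballI)
    fix A :: "'a mat" assume "A \<in> carrier (GL n)"
    hence "A \<in> carrier_mat (n + 1) (n + 1)" by (simp add: GL_carrier)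
    thus "scalar_mats n #>\<^bsub>GL n\<^esub> A = A <#\<^bsub>GL n\<^esub> scalar_mats n"
      using mult by (auto simp: r_coset_def l_coset_def scalar_mats_def GL_mult)
  qed
qed

lemma PGL_coset_in_carrier: "A \<in> carrier (GL n) \<Longrightarrow> scalar_mats n #>\<^bsub>GL n\<^esub> A \<in> carrier (PGL n)"
  by (simp add: PGL_def carrier_FactGroup)

text \<open>
Every representative \<open>c A\<close> of the class of \<open>A\<close> satisfies the hypothesis on the columns as well.
\<close>

lemma flag_act_std_flag:
  fixes A :: "'a::{field,finite} mat"
  assumes A: "A \<in> carrier (GL n)" and U: "U \<in> flags n" and cols: "\<And>j. j \<le> n \<Longrightarrow> col A j \<in> U (Suc j)"
  shows "flag_act (scalar_mats n #>\<^bsub>GL n\<^esub> A) (std_flag n) = U ` {1..n}"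
proof -
  have Ac: "A \<in> carrier_mat (n + 1) (n + 1)" "det A \<noteq> 0" using A by (auto simp: GL_carrier)
  have coset: "scalar_mats n #>\<^bsub>GL n\<^esub> A = (\<lambda>c. c \<cdot>\<^sub>m A) ` {c. c \<noteq> 0}"
    using Ac(1) by (auto simp: r_coset_def scalar_mats_def GL_mult mult_smult_assoc_mat[of _ "n + 1" "n + 1" _ "n + 1"])
  have "subspace_act (scalar_mats n #>\<^bsub>GL n\<^esub> A) (pg_span n (basis_vec n ` {1..i})) = U i"
    if i: "i \<in> {1..n}" for i
  proof -
    have "(\<lambda>v. (c \<cdot>\<^sub>m A) *\<^sub>v v) ` pg_span n (basis_vec n ` {1..i}) = U i" if c: "c \<noteq> 0" for c
    proof (rule mat_maps_std_span[OF _ _ U])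
      show "c \<cdot>\<^sub>m A \<in> carrier_mat (n + 1) (n + 1)" "det (c \<cdot>\<^sub>m A) \<noteq> 0" using Ac c by auto
      show "col (c \<cdot>\<^sub>m A) j \<in> U (Suc j)" if "j \<le> n" for j
        using cols[OF that] lin_sub_smult[OF flag_lin_sub[OF U]] Ac(1) that by simp
    qed (use i in simp)
    moreover have ne: "(1 :: 'a) \<in> {c. c \<noteq> 0}" by simp
    ultimately have "(\<Union>c\<in>{c. c \<noteq> 0}. (\<lambda>v. (c \<cdot>\<^sub>m A) *\<^sub>v v) ` pg_span n (basis_vec n ` {1..i})) = (\<Union>c\<in>{c::'a. c \<noteq> 0}. U i)"
      by (intro SUP_cong) auto
    also have "\<dots> = U i" using ne by blast
    finally show ?thesis unfolding subspace_act_def coset by (simp add: image_image)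
  qed
  thus ?thesis unfolding flag_act_def std_flag_def image_image by (intro image_cong) auto
qed

text \<open>
The dimensions of \<open>U\<^bsub>j+1\<^esub>\<close> and \<open>V\<^bsub>n+1-j\<^esub>\<close> add up to \<open>n + 2\<close>, so these subspaces share a nonzero
vector \<open>v\<^sub>j\<close>. In a linear dependency with last index \<open>k\<close> the vector \<open>v\<^sub>k\<close> would lie in \<open>U\<^sub>k\<close> and
in \<open>V\<^bsub>n+1-k\<^esub>\<close>, which meet trivially.
\<close>

lemma opp_rel_adapted_basis:
  fixes U V :: "nat \<Rightarrow> 'a::{field,finite} vec set"
  assumes UV: "(U, V) \<in> opp_rel n n"
  obtains A where "A \<in> carrier (GL n)" "\<And>j. j \<le> n \<Longrightarrow> col A j \<in> U (Suc j) \<inter> V (n + 1 - j)"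
proof -
  have U: "U \<in> flags n" and V: "V \<in> flags n"
    and opp: "\<And>i. i \<in> {1..n} \<Longrightarrow> U i \<inter> V (n + 1 - i) = {0\<^sub>v (n + 1)}"
    using UV by (auto simp: opp_rel_def)
  note lU = flag_lin_sub[OF U] and lV = flag_lin_sub[OF V]
  have "\<exists>v. v \<in> U (Suc j) \<inter> V (n + 1 - j) \<and> v \<noteq> 0\<^sub>v (n + 1)" if j: "j \<le> n" for j
  proof (rule ccontr)
    assume "\<not> ?thesis"
    hence "U (Suc j) \<inter> V (n + 1 - j) = {0\<^sub>v (n + 1)}"
      using lin_sub_zeroD[OF lU] lin_sub_zeroD[OF lV] by blast
    hence "sdim (U (Suc j) \<inter> V (n + 1 - j)) = 0" by (simp only: sdim_zero)
    moreover have "sdim (U (Suc j) \<uplus> V (n + 1 - j)) \<le> n + 1"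
      using sdim_mono[OF lin_sub_vsum[OF lU lV] lin_sub_carrier, of "Suc j" "n + 1 - j"]
        lin_sub_vsum[OF lU lV, of "Suc j" "n + 1 - j"]
        sdim_carrier[where 'a = 'a and N = "n + 1"] by (simp add: lin_sub_def)
    ultimately show False
      using sdim_vsum[OF lU lV, of "Suc j" "n + 1 - j"] flag_dim[OF U, of "Suc j"]
        flag_dim[OF V, of "n + 1 - j"] j by simp
  qed
  then obtain v where v: "\<And>j. j \<le> n \<Longrightarrow> v j \<in> U (Suc j) \<inter> V (n + 1 - j)" "\<And>j. j \<le> n \<Longrightarrow> v j \<noteq> 0\<^sub>v (n + 1)" by metis
  define A where "A = mat (n + 1) (n + 1) (\<lambda>(r, c). v c $ r)"
  have A: "A \<in> carrier_mat (n + 1) (n + 1)" by (simp add: A_def)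
  have colA: "col A j = v j" if j: "j \<le> n" for j
  proof -
    have "v j \<in> carrier_vec (n + 1)" using lin_sub_vecD[OF lU] v(1)[OF j] by blast
    thus ?thesis using j by (intro eq_vecI) (auto simp: A_def)
  qed
  have "det A \<noteq> 0"
  proof
    assume "det A = 0"
    then obtain x where x: "x \<in> carrier_vec (n + 1)" "x \<noteq> 0\<^sub>v (n + 1)" "A *\<^sub>v x = 0\<^sub>v (n + 1)"
      using det_0_iff_vec_prod_zero[OF A] by blast
    define K where "K = {j. j \<le> n \<and> x $ j \<noteq> 0}"
    have "K \<noteq> {}"
    proof
      assume "K = {}"
      hence "x = 0\<^sub>v (n + 1)" using x(1) by (intro eq_vecI) (auto simp: K_def)
      thus False using x(2) by simp
    qed
    moreover have finK: "finite K" by (simp add: K_def)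
    ultimately have "Max K \<in> K" by (intro Max_in)
    define k where "k = Max K"
    have k: "k \<le> n" "x $ k \<noteq> 0" using \<open>Max K \<in> K\<close> by (auto simp: K_def k_def)
    have above: "x $ j = 0" if "k < j" "j \<le> n" for j
    proof (rule ccontr)
      assume "x $ j \<noteq> 0"
      hence "j \<le> k" unfolding k_def using that by (intro Max_ge[OF finK]) (simp add: K_def)
      thus False using that by simp
    qed
    define y where "y = vec (n + 1) (\<lambda>j. if j < k then x $ j else 0)"
    have y: "y \<in> carrier_vec (n + 1)" by (simp add: y_def)
    have Ay: "A *\<^sub>v y \<in> U k"
    proof (rule lin_sub_mat_mult_vec[OF lU A y])
      fix j assume j: "j < n + 1" "y $ j \<noteq> 0"
      hence "j < k" by (auto simp: y_def split: if_splits)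
      thus "col A j \<in> U k" using v(1)[of j] colA[of j] flag_mono[OF U, of "Suc j" k] k by auto
    qed
    have "x = y + x $ k \<cdot>\<^sub>v unit_vec (n + 1) k"
    proof (rule eq_vecI)
      fix i assume "i < dim_vec (y + x $ k \<cdot>\<^sub>v unit_vec (n + 1) k)"
      hence i: "i < n + 1" by simp
      consider "i < k" | "i = k" | "k < i" by linarith
      thus "x $ i = (y + x $ k \<cdot>\<^sub>v unit_vec (n + 1) k) $ i"
        by cases (use i above[of i] k in \<open>simp_all add: y_def\<close>)
    qed (use x(1) in simp)
    moreover have "A *\<^sub>v unit_vec (n + 1) k = v k" using mat_mult_unit_vec[OF A, of k] k colA[of k]
      by simp
    ultimately have "A *\<^sub>v x = A *\<^sub>v y + x $ k \<cdot>\<^sub>v v k"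
      using A y by (metis mult_add_distrib_mat_vec mult_mat_vec smult_carrier_vec unit_vec_carrier)
    hence z: "A *\<^sub>v y + x $ k \<cdot>\<^sub>v v k = 0\<^sub>v (n + 1)" using x(3) by simp
    have vc: "v k \<in> carrier_vec (n + 1)" using v(1)[OF k(1)] lin_sub_vecD[OF lU] by blast
    have "v k = (- inverse (x $ k)) \<cdot>\<^sub>v (A *\<^sub>v y)"
    proof (rule eq_vecI)
      fix r assume "r < dim_vec ((- inverse (x $ k)) \<cdot>\<^sub>v (A *\<^sub>v y))"
      hence r: "r < n + 1" using A by simp
      have "(A *\<^sub>v y + x $ k \<cdot>\<^sub>v v k) $ r = 0" using z r by simp
      hence "(A *\<^sub>v y) $ r + x $ k * v k $ r = 0" using r A vc by simp
      hence "x $ k * v k $ r = - (A *\<^sub>v y) $ r" by (simp add: eq_neg_iff_add_eq_0 add.commute)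
      hence "v k $ r = - inverse (x $ k) * (A *\<^sub>v y) $ r" using k(2) by (simp add: field_simps)
      thus "v k $ r = ((- inverse (x $ k)) \<cdot>\<^sub>v (A *\<^sub>v y)) $ r" using r A by simp
    qed (use vc A in simp)
    hence "v k \<in> U k" using lin_sub_smult[OF lU Ay] by simp
    moreover have "v k \<in> V (n + 1 - k)" using v(1)[OF k(1)] by simp
    moreover have "U k \<inter> V (n + 1 - k) \<subseteq> {0\<^sub>v (n + 1)}"
      using opp[of k] k(1) flag_0[OF U] by (cases "k = 0") auto
    ultimately have "v k = 0\<^sub>v (n + 1)" by auto
    thus False using v(2)[OF k(1)] by simp
  qed
  thus ?thesis using that[of A] A v(1) colA by (simp add: GL_carrier)
qed

lemma w0_perm_mat:
  fixes A :: "'a::field mat"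
  shows "(perm_mat n (w0 n) :: 'a mat) * perm_mat n (w0 n) = 1\<^sub>m (n + 1)"
    and "A \<in> carrier_mat (n + 1) (n + 1) \<Longrightarrow> j \<le> n \<Longrightarrow> col (A * perm_mat n (w0 n)) j = col A (n - j)"
proof -
  define P :: "'a mat" where "P = perm_mat n (w0 n)"
  have P: "P \<in> carrier_mat (n + 1) (n + 1)" by (simp add: P_def perm_mat_def)
  have colP: "col P j = unit_vec (n + 1) (n - j)" if "j \<le> n" for j
    using that by (intro eq_vecI) (auto simp: P_def perm_mat_def w0_def)
  show *: "col (A * perm_mat n (w0 n)) j = col A (n - j)" if A: "A \<in> carrier_mat (n + 1) (n + 1)"
    and j: "j \<le> n" for A :: "'a mat" and j
  proof -
    have "col (A * P) j = A *\<^sub>v unit_vec (n + 1) (n - j)" using col_mult2[OF A P, of j] colP[OF j] j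
      by simp
    also have "\<dots> = col A (n - j)" using A j by (auto intro!: eq_vecI)
    finally show ?thesis by (simp only: P_def)
  qed
  have "P * P = 1\<^sub>m (n + 1)"
  proof (rule mat_col_eqI)
    fix j assume "j < dim_col (1\<^sub>m (n + 1) :: 'a mat)"
    hence j: "j \<le> n" by simp
    have "col (P * P) j = col P (n - j)" using *[OF P j] by (simp only: P_def)
    also have "\<dots> = unit_vec (n + 1) j" using colP[of "n - j"] j by simp
    finally show "col (P * P) j = col (1\<^sub>m (n + 1)) j" using j by simp
  qed (use P in auto)
  thus "(perm_mat n (w0 n) :: 'a mat) * perm_mat n (w0 n) = 1\<^sub>m (n + 1)" by (simp only: P_def)
qed

text \<open>
With \<open>A\<close> the matrix of an adapted basis, \<open>A\<close> maps the standard flag to \<open>U\<close>, and \<open>A w\<^sub>0\<close>, which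
lists the basis in reverse order, maps it to \<open>V\<close>. For the classes \<open>g\<close> and \<open>h\<close> of these matrices
the product of the inverse of \<open>h\<close> with \<open>g\<close> is the class of \<open>w\<^sub>0\<close>, as \<open>w\<^sub>0\<close> is an involution.
\<close>

lemma opp_rel_imp_opposite:
  fixes U V :: "nat \<Rightarrow> 'a::{field,finite} vec set"
  assumes UV: "(U, V) \<in> opp_rel n n"
  shows "opposite n (U ` {1..n}) (V ` {1..n})"
proof -
  interpret G: group "GL n :: 'a mat monoid" by (rule GL_group)
  interpret N: normal "scalar_mats n :: 'a mat set" "GL n" by (rule scalar_mats_normal)
  interpret P: group "PGL n :: 'a mat set monoid" unfolding PGL_def by (rule N.factorgroup_is_group)
  have U: "U \<in> flags n" and V: "V \<in> flags n" using UV by (auto simp: opp_rel_def)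
  obtain A where A: "A \<in> carrier (GL n)" and cols: "\<And>j. j \<le> n \<Longrightarrow> col A j \<in> U (Suc j) \<inter> V (n + 1 - j)"
    by (rule opp_rel_adapted_basis[OF UV]) blast
  have Ac: "A \<in> carrier_mat (n + 1) (n + 1)" using A by (simp add: GL_carrier)
  define W :: "'a mat" where "W = perm_mat n (w0 n)"
  have Wc: "W \<in> carrier_mat (n + 1) (n + 1)" by (simp add: W_def perm_mat_def)
  have WW: "W * W = 1\<^sub>m (n + 1)" unfolding W_def by (rule w0_perm_mat(1))
  hence "det W * det W = 1" using det_mult[OF Wc Wc] by simp
  hence W: "W \<in> carrier (GL n)" using Wc by (auto simp: GL_carrier)
  have AW: "A * W \<in> carrier (GL n)" using G.m_closed[OF A W] by (simp add: GL_mult)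
  define g where "g = scalar_mats n #>\<^bsub>GL n\<^esub> A"
  define h where "h = scalar_mats n #>\<^bsub>GL n\<^esub> (A * W)"
  define w where "w = scalar_mats n #>\<^bsub>GL n\<^esub> W"
  have gc: "g \<in> carrier (PGL n)" and hc: "h \<in> carrier (PGL n)" and wc: "w \<in> carrier (PGL n)"
    unfolding g_def h_def w_def using PGL_coset_in_carrier A AW W by auto
  have mult: "(scalar_mats n #>\<^bsub>GL n\<^esub> X) \<otimes>\<^bsub>PGL n\<^esub> (scalar_mats n #>\<^bsub>GL n\<^esub> Y) = scalar_mats n #>\<^bsub>GL n\<^esub> (X * Y)"
    if "X \<in> carrier (GL n)" "Y \<in> carrier (GL n)" for X Y :: "'a mat"
    using N.rcos_sum[OF that] by (simp add: PGL_def GL_mult)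
  have hgw: "h = g \<otimes>\<^bsub>PGL n\<^esub> w" unfolding g_def h_def w_def by (rule mult[OF A W, symmetric])
  have "w \<otimes>\<^bsub>PGL n\<^esub> w = scalar_mats n #>\<^bsub>GL n\<^esub> \<one>\<^bsub>GL n\<^esub>" unfolding w_def mult[OF W W] WW GL_one ..
  also have "\<dots> = \<one>\<^bsub>PGL n\<^esub>" using N.rcos_const[OF GL_group N.one_closed] by (simp add: PGL_def)
  finally have ww: "w \<otimes>\<^bsub>PGL n\<^esub> w = \<one>\<^bsub>PGL n\<^esub>" .
  have "h \<otimes>\<^bsub>PGL n\<^esub> w = g" unfolding hgw using gc wc ww by (simp add: P.m_assoc)
  hence "inv\<^bsub>PGL n\<^esub> h \<otimes>\<^bsub>PGL n\<^esub> g = w" using P.inv_solve_left[OF wc hc gc] by simp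
  moreover have "weyl_elem n (w0 n) = w" by (simp add: weyl_elem_def w_def W_def)
  moreover have "flag_act g (std_flag n) = U ` {1..n}" unfolding g_def
    by (rule flag_act_std_flag[OF A U]) (use cols in blast)
  moreover have "flag_act h (std_flag n) = V ` {1..n}" unfolding h_def
  proof (rule flag_act_std_flag[OF AW V])
    fix j assume j: "j \<le> n"
    have "col (A * W) j = col A (n - j)" unfolding W_def by (rule w0_perm_mat(2)[OF Ac j])
    moreover have "n + 1 - (n - j) = Suc j" using j by simp
    ultimately show "col (A * W) j \<in> V (Suc j)" using cols[of "n - j"] by simp
  qed
  ultimately show ?thesis unfolding opposite_def using gc hc by metis
qed

theorem theorem3p1:
  fixes C :: "'a::{field, finite} vec set set set" and n q :: nat
  assumes "n \<ge> 3"
    and "primepow q" and "CARD('a) = q"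
    and "EKR_set n C"
  shows "real (card C) \<le>
    (\<Prod>k = 1..n + 1. gauss_num q k) / (1 + real q powr ((real n + 1) / 2))"
proof -
  have flagC: "\<exists>U. U \<in> flags n \<and> f = U ` {1..n}" if "f \<in> C" for f
    using that assms(4) maximal_flag_sequence unfolding EKR_set_def by metis
  have indep: "\<not> opposite n f f'" if "f \<in> C" "f' \<in> C" "f \<noteq> f'" for f f'
    using that assms(4) unfolding EKR_set_def pairwise_def by blast
  define s where "s f = (SOME U. U \<in> flags n \<and> f = U ` {1..n})" for f :: "'a vec set set"
  have s: "s f \<in> flags n" "f = s f ` {1..n}" if "f \<in> C" for f
    using someI_ex[OF flagC[OF that]] unfolding s_def by auto
  have "inj_on s C" by (rule inj_onI) (metis s(2))
  hence "card C = card (s ` C)" by (simp add: card_image)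
  moreover have "real (card (s ` C)) \<le> (\<Prod>k = 1..n + 1. gauss_num CARD('a) k) / (1 + real CARD('a) powr ((real n + 1) / 2))"
  proof (rule flags_coclique_bound)
    show "s ` C \<subseteq> flags n" using s(1) by blast
    fix U V assume "U \<in> s ` C" "V \<in> s ` C"
    then obtain f f' where ff: "f \<in> C" "U = s f" "f' \<in> C" "V = s f'" by blast
    show "(U, V) \<notin> opp_rel n n"
    proof
      assume opp: "(U, V) \<in> opp_rel n n"
      show False
      proof (cases "f = f'")
        case True
        have U: "U \<in> flags n" using s(1) ff by simp
        \<comment> \<open>A flag is not opposite to itself, as its smallest member lies in its largest one.\<close>
        have "\<forall>i\<in>{1..n}. U i \<inter> V (n + 1 - i) = {0\<^sub>v (n + 1)}" using opp by (simp add: opp_rel_def)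
        from bspec[OF this, of 1] have "U 1 \<inter> V (n + 1 - 1) = {0\<^sub>v (n + 1)}" using assms(1) by simp
        hence "U 1 \<inter> U n = {0\<^sub>v (n + 1)}" using True ff by simp
        moreover have "U 1 \<subseteq> U n" using flag_mono[OF U, of 1 n] assms(1) by simp
        ultimately have "U 1 = {0\<^sub>v (n + 1)}" by blast
        hence "sdim (U 1) = 0" by (simp only: sdim_zero)
        thus False using flag_dim[OF U, of 1] by simp
      next
        case False
        have "opposite n f f'"
          using opp_rel_imp_opposite[OF opp] s(2)[OF ff(1)] s(2)[OF ff(3)] ff(2,4) by simp
        thus False using indep[OF ff(1,3) False] by simp
      qed
    qed
  qed (use assms(1) in simp)
  ultimately show ?thesis using assms(3) by simp
qed

end
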